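(* If $G$ is a convex body in $\mathbb{R}^2$, then there exist two linearly independent vectors $\xi_1,\xi_2\in\mathbb{S}^1$ such that for all $r\in\mathbb{N}$, $0<p\le\infty$ and $f\in L^p(G)$, $$E_{r-1}(f;\{\xi_1,\xi_2\})_{L^p(G)}\le C(p,r)\,\omega^r(f,G;\{\xi_1,\xi_2\})_p,$$ where the constant $C(p,r)$ depends only on $p$ and $r$.
   Context: A convex body is a compact convex set with non-empty interior; $\mathbb{S}^1$ is the unit circle of $\mathbb{R}^2$. For $\mathcal{E}\subset\mathbb{S}^1$ with $\mathrm{span}(\mathcal{E})=\mathbb{R}^2$, $\Pi^2_{r-1}(\mathcal{E})$ is the (finite-dimensional) set of all algebraic polynomials $Q$ on $\mathbb{R}^2$ such that for every $x\in\mathbb{R}^2$ and $e\in\mathcal{E}$ the function $t\mapsto Q(x+te)$ is a polynomial of degree $<r$ in $t\in\mathbb{R}$, and $E_{r-1}(f;\mathcal{E})_{L^p(G)}=\inf\{\|f-Q\|_{L^p(G)}:Q\in\Pi^2_{r-1}(\mathcal{E})\}$. $\triangle^r_\xi f(\eta)=\sum_{j=0}^r(-1)^{r+j}\binom rjf(\eta+j\xi)$ and $\omega^r(f,G;\mathcal{E})_p=\sup_{e\in\mathcal{E}}\sup_{0<u\le\mathrm{diam}(G)}\|\triangle^r_{ue}f\|_{L^p(\{\xi\in G:[\xi,\xi+rue]\subset G\})}$. *)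

theory Defs
  imports "HOL-Analysis.Analysis" "HOL-Probability.Essential_Supremum"
    "HOL-Computational_Algebra.Polynomial"
begin

definition convex_body :: "'a::euclidean_space set \<Rightarrow> bool" where
  "convex_body G \<longleftrightarrow> compact G \<and> convex G \<and> interior G \<noteq> {}"

text \<open>
  The \<open>L\<^sup>p\<close> (quasi-)norm with respect to Lebesgue measure on \<open>S\<close>, for \<open>0 < p \<le> \<infinity>\<close>, with
  values in \<open>[0, \<infinity>]\<close>. Real powers are not available on \<^typ>\<open>ennreal\<close>, so the outer power
  \<open>1/p\<close> is taken in the reals when the integral is finite. For \<open>p = 0\<close> the value is
  meaningless.
\<close>

definition Lp_norm :: "ennreal \<Rightarrow> 'a::euclidean_space set \<Rightarrow> ('a \<Rightarrow> real) \<Rightarrow> ennreal" where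
  "Lp_norm p S f =
    (if p = \<infinity> then esssup (lebesgue_on S) (\<lambda>x. ennreal \<bar>f x\<bar>)
     else let I = (\<integral>\<^sup>+x. ennreal (\<bar>f x\<bar> powr enn2real p) \<partial>lebesgue_on S)
          in if I = \<infinity> then \<infinity> else ennreal (enn2real I powr (1 / enn2real p)))"

definition Lp_space :: "ennreal \<Rightarrow> 'a::euclidean_space set \<Rightarrow> ('a \<Rightarrow> real) set" where
  "Lp_space p S = {f. f \<in> borel_measurable (lebesgue_on S) \<and> Lp_norm p S f < \<infinity>}"

text \<open>
  \<open>dir_poly r E\<close> is \<open>\<Pi>\<^sub>r\<^sub>-\<^sub>1(E)\<close>: its index is the strict bound \<open>r\<close> on the degree along
  the directions in \<open>E\<close>. The zero polynomial has degree less than every \<open>r\<close>.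
\<close>

definition dir_poly :: "nat \<Rightarrow> 'a::euclidean_space set \<Rightarrow> ('a \<Rightarrow> real) set" where
  "dir_poly r E = {Q. real_polynomial_function Q \<and>
     (\<forall>x. \<forall>e\<in>E. \<exists>q::real poly. (q = 0 \<or> degree q < r) \<and> (\<forall>t. Q (x + t *\<^sub>R e) = poly q t))}"

text \<open>Likewise, \<open>best_approx r\<close> is \<open>E\<^sub>r\<^sub>-\<^sub>1\<close>.\<close>

definition best_approx ::
    "nat \<Rightarrow> 'a::euclidean_space set \<Rightarrow> ennreal \<Rightarrow> 'a set \<Rightarrow> ('a \<Rightarrow> real) \<Rightarrow> ennreal" where
  "best_approx r E p G f = (INF Q\<in>dir_poly r E. Lp_norm p G (\<lambda>x. f x - Q x))"

definition fin_diff :: "nat \<Rightarrow> 'a::real_vector \<Rightarrow> ('a \<Rightarrow> real) \<Rightarrow> 'a \<Rightarrow> real" where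
  "fin_diff r \<xi> f \<eta> = (\<Sum>j=0..r. (-1) ^ (r + j) * real (r choose j) * f (\<eta> + real j *\<^sub>R \<xi>))"

definition dir_modulus ::
    "nat \<Rightarrow> 'a::euclidean_space set \<Rightarrow> ennreal \<Rightarrow> 'a set \<Rightarrow> ('a \<Rightarrow> real) \<Rightarrow> ennreal" where
  "dir_modulus r E p G f =
    (SUP e\<in>E. SUP u\<in>{0<..diameter G}.
       Lp_norm p {\<xi>\<in>G. closed_segment \<xi> (\<xi> + (real r * u) *\<^sub>R e) \<subseteq> G} (fin_diff r (u *\<^sub>R e) f))"

end

theory Submission
  imports Defs
begin

text \<open>
  Take a pair of chords of \<open>G\<close> whose cross product is maximal. Each of them joins two support lines of
  \<open>G\<close> parallel to the other one; their directions are \<open>\<xi>\<^sub>1\<close> and \<open>\<xi>\<^sub>2\<close>. In the coordinates given by the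
  chords, a square of universal size at their intersection lies in \<open>G\<close>, and all of \<open>G\<close> is reached from
  this square in a bounded number of horizontal and vertical moves. Both the degree condition and the
  modulus are invariant under this affine change of coordinates.

  On the square, Kemperman's identity bounds mixed \<open>r\<close>-th differences with different steps. The
  mixed differences of order \<open>r - 1\<close> are then nearly constant in the first variable, and nearly
  additive in each of their steps, so by Hyers--Ulam stability they are nearly multilinear; this
  gives the top coefficient of an approximant that is polynomial in one variable, and the others
  follow by induction. Combining the approximants for the two variables by interpolation gives a
  polynomial \<open>Q\<close>. The bound on \<open>f - Q\<close> extends along the moves, because differences of order \<open>r\<close> of
  \<open>f\<close> and of \<open>f - Q\<close> agree and express new values by old ones.
\<close>

section \<open>Finite differences\<close>

text \<open>For \<open>p < 1\<close> a function in \<open>L^p\<close> need not be integrable, so the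
  coefficients of an approximant cannot be means of \<open>f\<close>, and duality is of no help.
  Only \<open>\<bar>f\<bar> powr p\<close> is ever averaged, to find a vertical line on which a
  function is small; what should not depend on the first variable is replaced by its restriction to
  such a line. A quasi-triangle inequality is harmless in finite sums, but stability of additivity
  usually sums an infinite series of errors. Here it comes from one inequality for the supremum of
  the defect, which must carry a factor below 1. Additivity in a step makes sense only if that step
  varies while the others stay fixed; hence the differences with different steps. As for uniformity
  in \<open>G\<close>: in the chord coordinates \<open>G\<close> contains \<open>[-A, A]^2\<close>
  with \<open>A = 1 + 4 r^2\<close>, which leaves room around \<open>Q\<close> for the nodes of all
  differences that Kemperman's identity produces. Scaling each chord by the longer of its two parts
  keeps \<open>G\<close> inside \<open>[-5A, 3A]^2\<close>, so the number of moves depends on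
  \<open>r\<close> alone.\<close>

primrec mixed_diff :: "nat \<Rightarrow> (nat \<Rightarrow> 'a::real_vector) \<Rightarrow> ('a \<Rightarrow> real) \<Rightarrow> 'a \<Rightarrow> real" where
  "mixed_diff 0 h f z = f z"
| "mixed_diff (Suc n) h f z = mixed_diff n h f (z + h n) - mixed_diff n h f z"

lemma mixed_diff_cong: "(\<And>i. i < n \<Longrightarrow> h i = k i) \<Longrightarrow> mixed_diff n h f z = mixed_diff n k f z"
  by (induction n arbitrary: z) auto

lemma mixed_diff_diff: "mixed_diff n h (\<lambda>z. f z - g z) z = mixed_diff n h f z - mixed_diff n h g z"
  by (induction n arbitrary: z) auto

lemma mixed_diff_cmult: "mixed_diff n h (\<lambda>z. c * f z) z = c * mixed_diff n h f z"
  by (induction n arbitrary: z) (auto simp: algebra_simps)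

lemma mixed_diff_sum_fun:
  "mixed_diff n h (\<lambda>z. \<Sum>i\<in>I. f i z) z = (\<Sum>i\<in>I. mixed_diff n h (f i) z)"
  by (induction n arbitrary: z) (auto simp: sum_subtractf)

text \<open>The cocycle identity of differences in one slot: the step \<open>u + v\<close> is split
  at \<open>z + v\<close>. The shift by \<open>v\<close> in the first term is the only failure of
  additivity, so a mixed difference that is nearly invariant under such shifts is nearly additive in
  each of its steps.\<close>

lemma mixed_diff_slot_add:
  assumes "k < n"
  shows "mixed_diff n (h(k := u + v)) f z =
    mixed_diff n (h(k := u)) f (z + v) + mixed_diff n (h(k := v)) f z"
  using assms
proof (induction n arbitrary: z)
  case 0 then show ?case by simp
next
  case (Suc n)
  show ?case
  proof (cases "k = n")
    case True
    have eq: "mixed_diff n (h(k := w)) f z = mixed_diff n h f z" for w z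
      by (rule mixed_diff_cong) (use True in auto)
    show ?thesis unfolding True by (simp add: eq[unfolded True] add_ac del: fun_upd_apply) (simp add: add_ac)
  next
    case False
    then have "k < n" using Suc.prems by simp
    then have IH: "mixed_diff n (h(k := u + v)) f w =
      mixed_diff n (h(k := u)) f (w + v) + mixed_diff n (h(k := v)) f w" for w
      by (rule Suc.IH)
    have comm: "z + h n + v = z + v + h n" by simp
    have hn: "(h(k := w)) n = h n" for w using False by simp
    show ?thesis by (simp only: mixed_diff.simps hn IH) (simp only: comm)
  qed
qed

lemma sum_Pow_insert:
  assumes "finite A" "a \<notin> A"
  shows "(\<Sum>S\<in>Pow (insert a A). g S) = (\<Sum>S\<in>Pow A. g S + g (insert a S))"
proof -
  have disj: "Pow A \<inter> insert a ` Pow A = {}" using assms by auto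
  have inj: "inj_on (insert a) (Pow A)" using assms by (auto simp: inj_on_def)
  show ?thesis
    using assms disj inj
    by (simp add: Pow_insert sum.union_disjoint sum.reindex sum.distrib)
qed

lemma mixed_diff_expand:
  "mixed_diff n h f z = (\<Sum>S\<in>Pow {..<n}. (-1) ^ (n + card S) * f (z + sum h S))"
proof (induction n arbitrary: z)
  case 0 then show ?case by simp
next
  case (Suc n)
  have fin: "finite S" "n \<notin> S" if "S \<in> Pow {..<n}" for S
    using that finite_subset by auto
  have "(\<Sum>S\<in>Pow {..<Suc n}. (-1) ^ (Suc n + card S) * f (z + sum h S)) =
     (\<Sum>S\<in>Pow {..<n}. (-1) ^ (n + card S) * f (z + h n + sum h S) - (-1) ^ (n + card S) * f (z + sum h S))"
    unfolding lessThan_Suc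
    by (subst sum_Pow_insert) (auto intro!: sum.cong simp: fin add_ac)
  then show ?case by (simp add: Suc sum_subtractf)
qed

text \<open>Kemperman's identity: for \<open>k \<ge> 1\<close> the \<open>k\<close>-th node of the difference attached to
  \<open>S\<close> does not see \<open>h (k - 1)\<close>, so these terms cancel in pairs.\<close>

lemma mixed_diff_fin_diff:
  "mixed_diff r h f z = (\<Sum>S\<in>Pow {..<r}. (-1) ^ card S *
     fin_diff r (- (\<Sum>i\<in>S. (1 / real (Suc i)) *\<^sub>R h i)) f (z + sum h S))"
proof -
  define g where "g = (\<lambda>k S. f (z + sum h S + real k *\<^sub>R (- (\<Sum>i\<in>S. (1 / real (Suc i)) *\<^sub>R h i))))"
  have zero: "(\<Sum>S\<in>Pow {..<r}. (-1) ^ card S * g k S) = 0" if "k \<in> {1..r}" for k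
  proof -
    obtain a where a: "k = Suc a" "a < r" using \<open>k \<in> {1..r}\<close> by (cases k) auto
    have ins: "{..<r} = insert a ({..<r} - {a})" using a by auto
    have "(\<Sum>S\<in>Pow {..<r}. (-1) ^ card S * g k S) = (\<Sum>S\<in>Pow ({..<r} - {a}).
        (-1) ^ card S * g k S + (-1) ^ card (insert a S) * g k (insert a S))"
      by (subst ins, subst sum_Pow_insert) auto
    also have "\<dots> = 0"
    proof (rule sum.neutral, rule ballI)
      fix S assume "S \<in> Pow ({..<r} - {a})"
      then have S: "finite S" "a \<notin> S" using finite_subset by auto
      have "g k (insert a S) = g k S"
        using S by (simp add: g_def a scaleR_add_right)
      then show "(-1) ^ card S * g k S + (-1) ^ card (insert a S) * g k (insert a S) = 0"
        using S by simp
    qed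
    finally show ?thesis .
  qed
  have "(\<Sum>S\<in>Pow {..<r}. (-1) ^ card S *
     fin_diff r (- (\<Sum>i\<in>S. (1 / real (Suc i)) *\<^sub>R h i)) f (z + sum h S)) =
     (\<Sum>S\<in>Pow {..<r}. \<Sum>k=0..r. (-1) ^ (r + k) * real (r choose k) * ((-1) ^ card S * g k S))"
    unfolding fin_diff_def g_def sum_distrib_left by (intro sum.cong) (auto simp: algebra_simps)
  also have "\<dots> = (\<Sum>k=0..r. (-1) ^ (r + k) * real (r choose k) * (\<Sum>S\<in>Pow {..<r}. (-1) ^ card S * g k S))"
    by (subst sum.swap) (simp add: sum_distrib_left)
  also have "\<dots> = (\<Sum>k=0..0. (-1) ^ (r + k) * real (r choose k) * (\<Sum>S\<in>Pow {..<r}. (-1) ^ card S * g k S))"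
    by (rule sum.mono_neutral_right) (auto simp: zero)
  also have "\<dots> = (\<Sum>S\<in>Pow {..<r}. (-1) ^ (r + card S) * f (z + sum h S))"
    by (simp add: g_def sum_distrib_left power_add mult.assoc)
  finally show ?thesis by (simp add: mixed_diff_expand)
qed

text \<open>One difference turns a power into a combination of lower powers. Of these, the remaining
  \<open>n\<close> differences leave only the \<open>n\<close>-th, which occurs just when the
  original exponent is \<open>n + 1\<close>.\<close>

lemma mixed_diff_power:
  fixes h :: "nat \<Rightarrow> real"
  shows "k \<le> n \<Longrightarrow> mixed_diff n h (\<lambda>x. x ^ k) x = (if k = n then fact n * (\<Prod>i<n. h i) else 0)"
proof (induction n arbitrary: k x)
  case 0 then show ?case by simp
next
  case (Suc n)
  have shift: "mixed_diff n h f (x + t) = mixed_diff n h (\<lambda>x. f (x + t)) x" for f :: "real \<Rightarrow> real" and t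
  proof (induction n arbitrary: x)
    case (Suc n)
    have "x + t + h n = x + h n + t" by simp
    then show ?case by (simp only: mixed_diff.simps Suc)
  qed simp
  have "mixed_diff (Suc n) h (\<lambda>x. x ^ k) x = mixed_diff n h (\<lambda>x. (x + h n) ^ k - x ^ k) x"
    by (simp add: shift mixed_diff_diff)
  also have "(\<lambda>x. (x + h n) ^ k - x ^ k) = (\<lambda>x. \<Sum>j<k. (real (k choose j) * h n ^ (k - j)) * x ^ j)"
    by (auto simp: binomial_ring atMost_Suc lessThan_Suc_atMost[symmetric] algebra_simps intro!: ext)
  also have "mixed_diff n h \<dots> x = (\<Sum>j<k. (real (k choose j) * h n ^ (k - j)) * mixed_diff n h (\<lambda>x. x ^ j) x)"
    by (simp only: mixed_diff_sum_fun mixed_diff_cmult)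
  also have "\<dots> = (\<Sum>j<k. if j = n then (real (k choose n) * h n ^ (k - n)) * (fact n * (\<Prod>i<n. h i)) else 0)"
    by (rule sum.cong) (use Suc in auto)
  also have "\<dots> = (if k = Suc n then fact (Suc n) * (\<Prod>i<Suc n. h i) else 0)"
    using Suc.prems by (auto simp: sum.delta)
  finally show ?case .
qed

lemma fin_diff_diff: "fin_diff r v (\<lambda>z. f z - g z) z = fin_diff r v f z - fin_diff r v g z"
  by (simp add: fin_diff_def right_diff_distrib sum_subtractf)

text \<open>Reversal of the order of the nodes. Kemperman's identity produces steps of both signs,
  whereas the modulus tests positive ones.\<close>

lemma fin_diff_minus:
  "fin_diff r (- v) f (z + real r *\<^sub>R v) = (-1) ^ r * fin_diff r v f z"
proof -
  have "fin_diff r (- v) f (z + real r *\<^sub>R v) =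
     (\<Sum>j=0..r. (-1) ^ (r + (r - j)) * real (r choose (r - j)) * f (z + real r *\<^sub>R v + real (r - j) *\<^sub>R (- v)))"
    unfolding fin_diff_def by (rule sum.reindex_bij_witness[where i="\<lambda>j. r - j" and j="\<lambda>j. r - j"]) auto
  also have "\<dots> = (\<Sum>j=0..r. (-1) ^ r * ((-1) ^ (r + j) * real (r choose j) * f (z + real j *\<^sub>R v)))"
  proof (rule sum.cong)
    fix j assume j: "j \<in> {0..r}"
    have "(-1) ^ (r + (r - j)) = ((-1) ^ (r + (r + j)) :: real)"
      using j by (intro minus_one_power_iff[THEN trans] minus_one_power_iff[THEN trans, THEN sym]) auto
    moreover have "z + real r *\<^sub>R v + real (r - j) *\<^sub>R (- v) = z + real j *\<^sub>R v"
      using j by (simp add: of_nat_diff algebra_simps)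
    ultimately show "(-1) ^ (r + (r - j)) * real (r choose (r - j)) * f (z + real r *\<^sub>R v + real (r - j) *\<^sub>R (- v)) =
      (-1) ^ r * ((-1) ^ (r + j) * real (r choose j) * f (z + real j *\<^sub>R v))"
      using j by (simp only: binomial_symmetric[symmetric] power_add atLeastAtMost_iff)
  qed simp
  finally show ?thesis by (simp add: fin_diff_def sum_distrib_left)
qed

lemma fin_diff_last:
  "f (z + real r *\<^sub>R v) = fin_diff r v f z - (\<Sum>j<r. (-1) ^ (r + j) * real (r choose j) * f (z + real j *\<^sub>R v))"
  by (simp add: fin_diff_def atLeast0AtMost lessThan_Suc_atMost[symmetric])

section \<open>Gauges modelled on \<open>L\<^sup>p\<close> norms\<close>

type_synonym plane = "real \<times> real"

abbreviation "mble \<equiv> borel_measurable (borel :: plane measure)"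
abbreviation "Q \<equiv> {-1..1} \<times> {-1..1} :: plane set"

text \<open>The common properties of \<open>\<integral>\<bar>f\<bar>\<^sup>p\<close>, with \<open>s = p\<close>, and of the essential supremum, with \<open>s = 1\<close>. The
  parameter \<open>\<kappa>\<close> replaces Minkowski's inequality: one of the two constants is as close to 1 as
  desired, for \<open>p < 1\<close> as well.\<close>

locale lp_gauge =
  fixes R :: "plane set \<Rightarrow> (plane \<Rightarrow> real) \<Rightarrow> ennreal" and s :: real
  assumes s_pos: "0 < s"
    and mono: "\<And>S T f g. S \<in> sets borel \<Longrightarrow> T \<in> sets borel \<Longrightarrow> f \<in> mble \<Longrightarrow>
      g \<in> mble \<Longrightarrow> S \<subseteq> T \<Longrightarrow> (\<And>z. z \<in> S \<Longrightarrow> \<bar>f z\<bar> \<le> \<bar>g z\<bar>) \<Longrightarrow> R S f \<le> R T g"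
    and union: "\<And>S T f. S \<in> sets borel \<Longrightarrow> T \<in> sets borel \<Longrightarrow> f \<in> mble \<Longrightarrow>
      R (S \<union> T) f \<le> R S f + R T f"
    and cmult: "\<And>S f c. S \<in> sets borel \<Longrightarrow> f \<in> mble \<Longrightarrow>
      R S (\<lambda>z. c * f z) = ennreal (\<bar>c\<bar> powr s) * R S f"
    and tri: "\<And>S f g \<kappa>. S \<in> sets borel \<Longrightarrow> f \<in> mble \<Longrightarrow> g \<in> mble \<Longrightarrow>
      0 < \<kappa> \<Longrightarrow> R S (\<lambda>z. f z + g z) \<le>
        ennreal ((1 + \<kappa>) powr s) * R S f + ennreal ((1 + 1 / \<kappa>) powr s) * R S g"
    and shift: "\<And>S T f w. S \<in> sets borel \<Longrightarrow> T \<in> sets borel \<Longrightarrow> f \<in> mble \<Longrightarrow>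
      (\<And>z. z \<in> S \<Longrightarrow> z + w \<in> T) \<Longrightarrow> R S (\<lambda>z. f (z + w)) \<le> R T f"
    and swap: "\<And>S T f. S \<in> sets borel \<Longrightarrow> T \<in> sets borel \<Longrightarrow> f \<in> mble \<Longrightarrow>
      (\<And>z. z \<in> S \<Longrightarrow> prod.swap z \<in> T) \<Longrightarrow> R S (\<lambda>z. f (prod.swap z)) \<le> R T f"
    and average_shift: "\<And>f \<epsilon>. f \<in> mble \<Longrightarrow> 0 \<le> \<epsilon> \<Longrightarrow>
      (\<And>t. \<bar>t\<bar> \<le> 2 \<Longrightarrow> R Q (\<lambda>z. f (z + (t, 0)) - f z) \<le> ennreal \<epsilon>) \<Longrightarrow>
      \<exists>x\<in>{-1..1}. R Q (\<lambda>z. f z - f (x, snd z)) \<le> ennreal (2 * \<epsilon>)"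
    and average_section: "\<And>f \<epsilon> a b. f \<in> mble \<Longrightarrow> 0 \<le> \<epsilon> \<Longrightarrow> -1 \<le> a \<Longrightarrow> a < b \<Longrightarrow> b \<le> 1 \<Longrightarrow>
      R Q f \<le> ennreal \<epsilon> \<Longrightarrow>
      \<exists>x\<in>{a..b}. R Q (\<lambda>z. f (x, snd z)) \<le> ennreal (2 / (b - a) * \<epsilon>)"
begin

lemma tri_real:
  assumes "S \<in> sets borel" "f \<in> mble" "g \<in> mble" "0 < \<kappa>"
    "R S f \<le> ennreal a" "R S g \<le> ennreal b" "0 \<le> a" "0 \<le> b"
  shows "R S (\<lambda>z. f z + g z) \<le> ennreal ((1 + \<kappa>) powr s * a + (1 + 1 / \<kappa>) powr s * b)"
proof -
  have "R S (\<lambda>z. f z + g z) \<le> ennreal ((1 + \<kappa>) powr s) * R S f + ennreal ((1 + 1 / \<kappa>) powr s) * R S g"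
    by (rule tri) (use assms in auto)
  also have "\<dots> \<le> ennreal ((1 + \<kappa>) powr s) * ennreal a + ennreal ((1 + 1 / \<kappa>) powr s) * ennreal b"
    using assms by (intro add_mono mult_left_mono) auto
  also have "\<dots> = ennreal ((1 + \<kappa>) powr s * a + (1 + 1 / \<kappa>) powr s * b)"
    using assms by (simp add: ennreal_mult ennreal_plus)
  finally show ?thesis .
qed

lemma cmult_real:
  assumes "S \<in> sets borel" "f \<in> mble" "R S f \<le> ennreal a" "0 \<le> a"
  shows "R S (\<lambda>z. c * f z) \<le> ennreal (\<bar>c\<bar> powr s * a)"
  using assms by (simp add: cmult ennreal_mult mult_left_mono)

lemma R_minus:
  assumes "S \<in> sets borel" "f \<in> mble"
  shows "R S (\<lambda>z. - f z) = R S f"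
  using cmult[OF assms, of "-1"] by simp

lemma mult_bound:
  assumes "S \<in> sets borel" "f \<in> mble" "g \<in> mble" "\<And>z. z \<in> S \<Longrightarrow> \<bar>g z\<bar> \<le> c"
    "R S f \<le> ennreal a" "0 \<le> a"
  shows "R S (\<lambda>z. g z * f z) \<le> ennreal (\<bar>c\<bar> powr s * a)"
proof -
  have "R S (\<lambda>z. g z * f z) \<le> R S (\<lambda>z. c * f z)"
    using assms(1-3) by (rule_tac mono) (auto simp: abs_mult intro!: mult_right_mono order_trans[OF assms(4)])
  also have "\<dots> \<le> ennreal (\<bar>c\<bar> powr s * a)" by (rule cmult_real) (use assms in auto)
  finally show ?thesis .
qed

lemma add_bound:
  assumes "S \<in> sets borel" "f \<in> mble" "g \<in> mble"
    "R S f \<le> ennreal a" "R S g \<le> ennreal b" "0 \<le> a" "0 \<le> b"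
  shows "R S (\<lambda>z. f z + g z) \<le> ennreal (2 powr s * (a + b))"
  using tri_real[of S f g 1 a b] assms by (simp add: algebra_simps)

lemma diff_bound:
  assumes "S \<in> sets borel" "f \<in> mble" "g \<in> mble"
    "R S f \<le> ennreal a" "R S g \<le> ennreal b" "0 \<le> a" "0 \<le> b"
  shows "R S (\<lambda>z. f z - g z) \<le> ennreal (2 powr s * (a + b))"
  using add_bound[of S f "\<lambda>z. - g z" a b] assms by (simp add: R_minus)

text \<open>The price of adding \<open>n\<close> functions one at a time with
  \<open>\<kappa> = 1\<close>. Only its dependence on \<open>n\<close> and \<open>s\<close>
  matters.\<close>

definition sum_const :: "nat \<Rightarrow> real" where
  "sum_const n = real n * (2 powr s) ^ n"

lemma sum_const_nonneg: "0 \<le> sum_const n"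
  by (simp add: sum_const_def)

lemma R_zero: "S \<in> sets borel \<Longrightarrow> R S (\<lambda>z. 0) = 0"
  using cmult[of S "\<lambda>_. 0" 0] by simp

lemma sum_bound:
  assumes "finite I" "S \<in> sets borel" "0 \<le> e" "\<And>i. i \<in> I \<Longrightarrow> f i \<in> mble"
    "\<And>i. i \<in> I \<Longrightarrow> R S (f i) \<le> ennreal e"
  shows "R S (\<lambda>z. \<Sum>i\<in>I. f i z) \<le> ennreal (sum_const (card I) * e)"
  using assms
proof (induction I rule: finite_induct)
  case empty then show ?case by (simp add: R_zero sum_const_def)
next
  case (insert i I)
  have "R S (\<lambda>z. f i z + (\<Sum>i\<in>I. f i z)) \<le> ennreal (2 powr s * (e + sum_const (card I) * e))"
    using insert sum_const_nonneg by (intro add_bound borel_measurable_sum) auto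
  also have "\<dots> \<le> ennreal (sum_const (card (insert i I)) * e)"
  proof (rule ennreal_leI)
    define P where "P = 2 powr s"
    have P: "1 \<le> P" using s_pos by (auto simp: P_def intro: ge_one_powr_ge_zero)
    then have "P * 1 \<le> P * P ^ card I" by (intro mult_left_mono one_le_power) auto
    then have "P * (1 + real (card I) * P ^ card I) \<le> (1 + real (card I)) * (P * P ^ card I)"
      by (simp add: algebra_simps)
    from mult_right_mono[OF this \<open>0 \<le> e\<close>]
    show "2 powr s * (e + sum_const (card I) * e) \<le> sum_const (card (insert i I)) * e"
      using insert(1,2) by (simp add: sum_const_def P_def algebra_simps)
  qed
  finally show ?case using insert(1,2) by simp
qed

text \<open>Hyers--Ulam stability: the constant at the main term of the triangle inequality is so close to 1
  that the halving step \<open>2 m u \<approx> m (2 u)\<close> contracts the defect of \<open>m\<close> from being linear.\<close>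

lemma approx_additive:
  "\<exists>C\<ge>0. \<forall>m S E \<epsilon>. S \<in> sets borel \<longrightarrow> 0 \<le> \<epsilon> \<longrightarrow>
     (\<forall>u. \<bar>u\<bar> \<le> 4 \<longrightarrow> m u \<in> mble \<and> R S (m u) \<le> ennreal E) \<longrightarrow>
     (\<forall>u v. \<bar>u\<bar> \<le> 4 \<longrightarrow> \<bar>v\<bar> \<le> 4 \<longrightarrow> \<bar>u + v\<bar> \<le> 4 \<longrightarrow>
        R S (\<lambda>z. m (u + v) z - m u z - m v z) \<le> ennreal \<epsilon>) \<longrightarrow>
     (\<forall>u. \<bar>u\<bar> \<le> 4 \<longrightarrow> R S (\<lambda>z. m u z - u / 4 * m 4 z) \<le> ennreal (C * \<epsilon>))"
proof -
  \<comment> \<open>The triangle inequality is used with \<open>\<kappa> = 1/5\<close>, so the main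
    term costs 6/5 and the error term 6. Halving turns 6/5 into 3/5; the reflection at 4 costs
    another 6/5, and \<open>(6/5) * (3/5) = 18/25 < 1\<close>. In \<open>c\<close>, the first
    summand is the error of the reflection and the second that of the halving, carried through
    it.\<close>
  define \<theta> where "\<theta> = (18 / 25 :: real) powr s"
  define c where "c = 6 powr s + (6/5) powr s * 3 powr s"
  define D where "D = c / (1 - \<theta>)"
  define C where "C = 2 powr s * (D + 2 powr s * (D + 1))"
  have \<theta>: "0 < \<theta>" "\<theta> < 1" using s_pos powr_less_mono2[of s "18 / 25" 1] by (auto simp: \<theta>_def)
  have c0: "0 \<le> c" by (simp add: c_def)
  have D0: "0 \<le> D" using \<theta> c0 by (simp add: D_def)
  have C0: "0 \<le> C" using D0 by (simp add: C_def)
  have DC: "D \<le> C"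
  proof -
    have "1 * (D + 0) \<le> 2 powr s * (D + 2 powr s * (D + 1))"
      using D0 s_pos by (intro mult_mono add_left_mono ge_one_powr_ge_zero) auto
    then show ?thesis by (simp add: C_def)
  qed
  show ?thesis
  proof (intro exI[of _ C] conjI allI impI C0)
    fix m :: "real \<Rightarrow> plane \<Rightarrow> real" and S and E \<epsilon> u :: real
    assume S[measurable]: "S \<in> sets borel" and \<epsilon>: "0 \<le> \<epsilon>"
      and m: "\<forall>u. \<bar>u\<bar> \<le> 4 \<longrightarrow> m u \<in> mble \<and> R S (m u) \<le> ennreal E"
      and add: "\<forall>u v. \<bar>u\<bar> \<le> 4 \<longrightarrow> \<bar>v\<bar> \<le> 4 \<longrightarrow> \<bar>u + v\<bar> \<le> 4 \<longrightarrow>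
        R S (\<lambda>z. m (u + v) z - m u z - m v z) \<le> ennreal \<epsilon>"
      and u: "\<bar>u\<bar> \<le> 4"
    \<comment> \<open>The defect from the linear function that agrees with \<open>m\<close> at 4. It
      satisfies the same additivity bound and vanishes at 4.\<close>
    define N where "N = (\<lambda>u z. m u z - u / 4 * m 4 z)"
    have mm: "m u \<in> mble" if "\<bar>u\<bar> \<le> 4" for u using m that by blast
    have Nm: "N u \<in> mble" if "\<bar>u\<bar> \<le> 4" for u
      unfolding N_def using mm[OF that] mm[of 4] by simp
    have N4: "N 4 z = 0" for z by (simp add: N_def)
    have Nadd: "R S (\<lambda>z. N (u + v) z - N u z - N v z) \<le> ennreal \<epsilon>"
      if "\<bar>u\<bar> \<le> 4" "\<bar>v\<bar> \<le> 4" "\<bar>u + v\<bar> \<le> 4" for u v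
    proof -
      have "(\<lambda>z. N (u + v) z - N u z - N v z) = (\<lambda>z. m (u + v) z - m u z - m v z)"
        by (auto simp: N_def field_simps)
      then show ?thesis using add that by simp
    qed
    \<comment> \<open>\<open>E\<close> serves only to make this supremum finite; without that,
      \<open>\<sigma> \<le> \<theta> * \<sigma> + c * \<epsilon>\<close> would say nothing. It does
      not enter the constant.\<close>
    define \<sigma>' where "\<sigma>' = (SUP u\<in>{0..4}. R S (N u))"
    have "\<sigma>' \<le> ennreal (2 powr s * (max 0 E + 1 powr s * max 0 E))"
      unfolding \<sigma>'_def
    proof (rule SUP_least)
      fix u :: real assume u: "u \<in> {0..4}"
      have E: "R S (m v) \<le> ennreal (max 0 E)" if "\<bar>v\<bar> \<le> 4" for v
        using m that by (metis ennreal_max_0)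
      have "R S (\<lambda>z. u / 4 * m 4 z) \<le> ennreal (\<bar>1\<bar> powr s * max 0 E)"
        using u E by (intro mult_bound mm) auto
      then show "R S (N u) \<le> ennreal (2 powr s * (max 0 E + 1 powr s * max 0 E))"
        unfolding N_def using u E mm[of u] mm[of 4] by (intro diff_bound) auto
    qed
    then obtain \<sigma> where \<sigma>: "\<sigma>' = ennreal \<sigma>" "0 \<le> \<sigma>"
      by (cases \<sigma>') (auto simp: top_unique)
    have up: "R S (N u) \<le> ennreal \<sigma>" if "u \<in> {0..4}" for u
      using that \<sigma>(1) by (metis SUP_upper \<sigma>'_def)
    have half: "R S (N u) \<le> ennreal ((3/5) powr s * \<sigma> + 3 powr s * \<epsilon>)" if "u \<in> {0..2}" for u
    proof -
      have meas: "N u \<in> mble" "N (2 * u) \<in> mble" using that Nm by auto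
      have neg: "R S (\<lambda>z. - (N (u + u) z - N u z - N u z)) \<le> ennreal \<epsilon>"
        using that meas Nadd[of u u] by (subst R_minus) auto
      have "R S (\<lambda>z. N (2 * u) z + - (N (u + u) z - N u z - N u z)) \<le>
         ennreal ((1 + 1/5) powr s * \<sigma> + (1 + 1 / (1/5)) powr s * \<epsilon>)"
        using that meas \<sigma> \<epsilon> up[of "2 * u"] neg
        by (intro tri_real) auto
      moreover have "(\<lambda>z. N (2 * u) z + - (N (u + u) z - N u z - N u z)) = (\<lambda>z. 2 * N u z)"
        by (auto simp flip: mult_2)
      ultimately have "R S (\<lambda>z. 2 * N u z) \<le> ennreal ((6/5) powr s * \<sigma> + 6 powr s * \<epsilon>)" by simp
      then have "R S (\<lambda>z. (1/2) * (2 * N u z)) \<le> ennreal (\<bar>1/2\<bar> powr s * ((6/5) powr s * \<sigma> + 6 powr s * \<epsilon>))"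
        using meas \<sigma> \<epsilon> by (intro cmult_real) auto
      moreover have "\<bar>1/2::real\<bar> powr s * ((6/5) powr s * \<sigma> + 6 powr s * \<epsilon>) = (3/5) powr s * \<sigma> + 3 powr s * \<epsilon>"
        by (simp add: distrib_left mult.assoc[symmetric] powr_mult[symmetric])
      ultimately show ?thesis by simp
    qed
    have full: "R S (N u) \<le> ennreal (\<theta> * \<sigma> + c * \<epsilon>)" if "u \<in> {0..4}" for u
    proof (cases "u \<le> 2")
      case True
      have "(3/5) powr s * \<sigma> + 3 powr s * \<epsilon> \<le> \<theta> * \<sigma> + c * \<epsilon>"
      proof (intro add_mono mult_right_mono \<sigma> \<epsilon>)
        show "(3/5) powr s \<le> \<theta>" unfolding \<theta>_def using s_pos by (intro powr_mono2) auto
        have "3 powr s \<le> 6 powr s" using s_pos by (intro powr_mono2) auto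
        then show "3 powr s \<le> c" by (simp add: c_def add_increasing2)
      qed
      then show ?thesis using half[of u] that True by (meson atLeastAtMost_iff ennreal_leI order_trans)
    next
      case False
      \<comment> \<open>The halving step needs \<open>2 * u \<le> 4\<close>. For larger
        \<open>u\<close>, reflect: as \<open>N 4 = 0\<close>, near additivity makes
        \<open>N u\<close> close to \<open>- N v\<close> with \<open>v\<close> in the range already
        treated.\<close>
      define v where "v = 4 - u"
      have v: "v \<in> {0..2}" using that False by (auto simp: v_def)
      have meas: "N u \<in> mble" "N v \<in> mble" "N (u + v) \<in> mble" using that v Nm by (auto simp: v_def)
      have "R S (\<lambda>z. - (N (u + v) z - N u z - N v z)) \<le> ennreal \<epsilon>"
        using that v meas Nadd[of u v] by (subst R_minus) (auto simp: v_def)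
      moreover have "R S (\<lambda>z. - N v z) \<le> ennreal ((3/5) powr s * \<sigma> + 3 powr s * \<epsilon>)"
        using v meas half[of v] by (subst R_minus) auto
      ultimately
      have "R S (\<lambda>z. - N v z + - (N (u + v) z - N u z - N v z)) \<le>
         ennreal ((1 + 1/5) powr s * ((3/5) powr s * \<sigma> + 3 powr s * \<epsilon>) + (1 + 1 / (1/5)) powr s * \<epsilon>)"
        using meas \<sigma> \<epsilon> by (intro tri_real) auto
      moreover have "(\<lambda>z. - N v z + - (N (u + v) z - N u z - N v z)) = N u"
        by (auto simp: v_def N4)
      moreover have "(1 + 1/5) powr s * ((3/5) powr s * \<sigma> + 3 powr s * \<epsilon>) + (1 + 1 / (1/5)) powr s * \<epsilon> = \<theta> * \<sigma> + c * \<epsilon>"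
        by (simp add: \<theta>_def c_def algebra_simps mult.assoc[symmetric] powr_mult[symmetric])
      ultimately show ?thesis by simp
    qed
    have "\<sigma>' \<le> ennreal (\<theta> * \<sigma> + c * \<epsilon>)"
      unfolding \<sigma>'_def by (rule SUP_least) (rule full)
    then have "\<sigma> \<le> \<theta> * \<sigma> + c * \<epsilon>"
      using \<sigma> \<theta> c0 \<epsilon> by (simp add: ennreal_le_iff del: ennreal_plus)
    then have "\<sigma> * (1 - \<theta>) \<le> c * \<epsilon>" by (simp add: algebra_simps)
    then have "\<sigma> \<le> D * \<epsilon>" using \<theta> by (simp add: D_def pos_le_divide_eq)
    then have pos: "R S (N u) \<le> ennreal (D * \<epsilon>)" if "u \<in> {0..4}" for u
      using up[OF that] by (meson ennreal_leI order_trans)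
    show "R S (\<lambda>z. m u z - u / 4 * m 4 z) \<le> ennreal (C * \<epsilon>)"
    proof (cases "0 \<le> u")
      case True
      have "D * \<epsilon> \<le> C * \<epsilon>" using DC \<epsilon> by (rule mult_right_mono)
      with pos[of u] True u show ?thesis unfolding N_def
        by (meson abs_le_D1 atLeastAtMost_iff ennreal_leI order_trans)
    next
      case False
      have meas: "N u \<in> mble" "N (- u) \<in> mble" "N 0 \<in> mble" using u Nm by auto
      have Nu: "R S (\<lambda>z. N (u + - u) z - N u z - N (- u) z) \<le> ennreal \<epsilon>"
        by (rule Nadd) (use u in auto)
      have N0: "R S (\<lambda>z. N 0 z - (N (u + - u) z - N u z - N (- u) z)) \<le> ennreal (2 powr s * (D * \<epsilon> + \<epsilon>))"
        by (rule diff_bound) (use meas pos[of 0] D0 \<epsilon> Nu in auto)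
      have "R S (\<lambda>z. (N 0 z - (N (u + - u) z - N u z - N (- u) z)) - N (- u) z)
           \<le> ennreal (2 powr s * (2 powr s * (D * \<epsilon> + \<epsilon>) + D * \<epsilon>))"
        by (rule diff_bound) (use u meas pos[of "-u"] False D0 \<epsilon> N0 in auto)
      also have "(\<lambda>z. (N 0 z - (N (u + - u) z - N u z - N (- u) z)) - N (- u) z) = N u" by auto
      also have "2 powr s * (2 powr s * (D * \<epsilon> + \<epsilon>) + D * \<epsilon>) = C * \<epsilon>" by (simp add: C_def algebra_simps)
      finally show ?thesis unfolding N_def .
    qed
  qed
qed

end

section \<open>Approximation on slices\<close>

lemma mixed_diff_Suc_fun:
  "mixed_diff (Suc n) h f = (\<lambda>z. mixed_diff n h f (z + h n) - mixed_diff n h f z)"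
  by auto

lemma borel_measurable_shift [measurable]:
  fixes f :: "'a::{real_normed_vector,second_countable_topology} \<Rightarrow> real"
  assumes [measurable]: "f \<in> borel_measurable borel"
  shows "(\<lambda>z. f (z + w)) \<in> borel_measurable borel"
  by measurable

lemma borel_measurable_mixed_diff [measurable]:
  fixes f :: "'a::{real_normed_vector,second_countable_topology} \<Rightarrow> real"
  assumes [measurable]: "f \<in> borel_measurable borel"
  shows "mixed_diff n h f \<in> borel_measurable borel"
proof (induction n)
  case (Suc n)
  then show ?case by simp
qed simp

lemma borel_measurable_fst_snd:
  fixes a :: "real \<Rightarrow> real"
  assumes "a \<in> borel_measurable borel"
  shows "(\<lambda>z::plane. a (fst z)) \<in> borel_measurable borel"
    "(\<lambda>z::plane. a (snd z)) \<in> borel_measurable borel"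
  by (rule measurable_compose[OF _ assms], intro borel_measurable_continuous_onI continuous_intros)+

lemma borel_measurable_section:
  fixes f :: "plane \<Rightarrow> real"
  assumes "f \<in> borel_measurable borel"
  shows "(\<lambda>y. f (x, y)) \<in> borel_measurable borel"
  by (rule measurable_compose[OF _ assms]) (intro borel_measurable_continuous_onI continuous_intros)

lemma mixed_diff_fst:
  "mixed_diff n (\<lambda>i. (h i, 0)) (\<lambda>z::plane. c (snd z) * g (fst z)) z =
     c (snd z) * mixed_diff n h g (fst z)"
  by (induction n arbitrary: z) (auto simp: algebra_simps)

context lp_gauge begin

lemma Q_borel [measurable]: "Q \<in> sets borel"
  by (intro borel_closed closed_Times) auto

text \<open>Crude, since each difference doubles the number of terms. It only guarantees that bounds
  demanded by \<open>approx_additive\<close> and by the induction below exist; their size does not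
  affect the constants.\<close>

lemma mixed_diff_bound:
  assumes f: "f \<in> mble" and E: "0 \<le> E"
    and b: "\<And>t. \<bar>t\<bar> \<le> B \<Longrightarrow> R Q (\<lambda>z. f (z + (t, 0))) \<le> ennreal E"
    and h: "\<And>i. i < n \<Longrightarrow> \<bar>h i\<bar> \<le> 4" and t: "\<bar>t\<bar> + 4 * real n \<le> B"
  shows "R Q (\<lambda>z. mixed_diff n (\<lambda>i. (h i, 0)) f (z + (t, 0))) \<le> ennreal ((2 * 2 powr s) ^ n * E)"
  using h t
proof (induction n arbitrary: t)
  case 0 then show ?case using b by simp
next
  case (Suc n)
  note [measurable] = f
  let ?g = "mixed_diff n (\<lambda>i. (h i, 0)) f"
  have "\<bar>h n\<bar> \<le> 4" using Suc.prems by simp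
  then have "\<bar>t + h n\<bar> + 4 * real n \<le> B" using Suc.prems(2) by simp
  then have "R Q (\<lambda>z. ?g (z + (t + h n, 0)) - ?g (z + (t, 0))) \<le>
      ennreal (2 powr s * ((2 * 2 powr s) ^ n * E + (2 * 2 powr s) ^ n * E))"
    using Suc.prems E by (intro diff_bound Suc.IH) auto
  moreover have "z + (t, 0) + (h n, 0) = z + (t + h n, 0)" for z :: "plane"
    by (cases z) simp
  ultimately show ?case by (simp add: algebra_simps)
qed

definition slice_approx :: "nat \<Rightarrow> (plane \<Rightarrow> real) \<Rightarrow> real \<Rightarrow> bool" where
  "slice_approx n f e \<longleftrightarrow> (\<exists>a. (\<forall>i<n. a i \<in> borel_measurable borel) \<and>
     R Q (\<lambda>z. f z - (\<Sum>i<n. a i (snd z) * fst z ^ i)) \<le> ennreal e)"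

text \<open>The top coefficient is read off from the \<open>n\<close>-th mixed differences, which are nearly constant in the
  first variable, and nearly linear in each step by \<open>approx_additive\<close>; subtracting it
  reduces \<open>n\<close>.\<close>

lemma slicewise_polynomial:
  "\<exists>C\<ge>0. \<forall>f \<epsilon> E. f \<in> mble \<longrightarrow> 0 \<le> \<epsilon> \<longrightarrow>
     (\<forall>t. \<bar>t\<bar> \<le> 4 * real n \<longrightarrow> R Q (\<lambda>z. f (z + (t, 0))) \<le> ennreal E) \<longrightarrow>
     (\<forall>h. (\<forall>i<n. \<bar>h i\<bar> \<le> 4) \<longrightarrow> R Q (mixed_diff n (\<lambda>i. (h i, 0)) f) \<le> ennreal \<epsilon>) \<longrightarrow>
     slice_approx n f (C * \<epsilon>)"
proof (induction n)
  case 0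
  show ?case by (rule exI[of _ 1]) (auto simp: slice_approx_def)
next
  case (Suc n)
  obtain C1 where C1: "0 \<le> C1" and IH: "\<And>f \<epsilon> E. f \<in> mble \<Longrightarrow> 0 \<le> \<epsilon> \<Longrightarrow>
     (\<forall>t. \<bar>t\<bar> \<le> 4 * real n \<longrightarrow> R Q (\<lambda>z. f (z + (t, 0))) \<le> ennreal E) \<Longrightarrow>
     (\<forall>h. (\<forall>i<n. \<bar>h i\<bar> \<le> 4) \<longrightarrow> R Q (mixed_diff n (\<lambda>i. (h i, 0)) f) \<le> ennreal \<epsilon>) \<Longrightarrow>
     slice_approx n f (C1 * \<epsilon>)"
    using Suc.IH by blast
  obtain C2 where C2: "0 \<le> C2" and HU: "\<And>m S E \<epsilon>. S \<in> sets borel \<Longrightarrow> 0 \<le> \<epsilon> \<Longrightarrow>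
     (\<forall>u. \<bar>u\<bar> \<le> 4 \<longrightarrow> m u \<in> mble \<and> R S (m u) \<le> ennreal E) \<Longrightarrow>
     (\<forall>u v. \<bar>u\<bar> \<le> 4 \<longrightarrow> \<bar>v\<bar> \<le> 4 \<longrightarrow> \<bar>u + v\<bar> \<le> 4 \<longrightarrow>
        R S (\<lambda>z. m (u + v) z - m u z - m v z) \<le> ennreal \<epsilon>) \<Longrightarrow>
     (\<forall>u. \<bar>u\<bar> \<le> 4 \<longrightarrow> R S (\<lambda>z. m u z - u / 4 * m 4 z) \<le> ennreal (C2 * \<epsilon>))"
    using approx_additive by blast
  define P where "P = 2 powr s"
  have P0: "0 \<le> P" by (simp add: P_def)
  define C3 where "C3 = C2 * (sum_const 4 * 2)"
  have C3: "0 \<le> C3" using C2 sum_const_nonneg by (simp add: C3_def)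
  define C4 where "C4 = P * (2 + sum_const n * C3)"
  have C4: "0 \<le> C4" using P0 sum_const_nonneg C3 by (simp add: C4_def)
  show ?case
  proof (intro exI[of _ "C1 * C4"] conjI allI impI)
    show "0 \<le> C1 * C4" using C1 C4 by simp
  next
    fix f \<epsilon> E
    assume f[measurable]: "f \<in> mble" and \<epsilon>: "0 \<le> \<epsilon>"
      and fb: "\<forall>t. \<bar>t\<bar> \<le> 4 * real (Suc n) \<longrightarrow> R Q (\<lambda>z. f (z + (t, 0))) \<le> ennreal E"
      and fd: "\<forall>h. (\<forall>i<Suc n. \<bar>h i\<bar> \<le> 4) \<longrightarrow> R Q (mixed_diff (Suc n) (\<lambda>i. (h i, 0)) f) \<le> ennreal \<epsilon>"
    define F where "F = max 0 E"
    have F0: "0 \<le> F" by (simp add: F_def)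
    have fF: "R Q (\<lambda>z. f (z + (t, 0))) \<le> ennreal F" if "\<bar>t\<bar> \<le> 4 * real (Suc n)" for t
      using fb that by (metis F_def ennreal_max_0)
    define g where "g h = mixed_diff n (\<lambda>i. (h i, 0)) f" for h :: "nat \<Rightarrow> real"
    have gm[measurable]: "g h \<in> mble" for h by (simp add: g_def)
    define adm where "adm h \<longleftrightarrow> (\<forall>i<n. \<bar>h i\<bar> \<le> 4)" for h :: "nat \<Rightarrow> real"
    have g_step: "R Q (\<lambda>z. g h (z + (t, 0)) - g h z) \<le> ennreal \<epsilon>" if "adm h" "\<bar>t\<bar> \<le> 4" for h t
    proof -
      have "R Q (mixed_diff (Suc n) (\<lambda>i. ((h(n := t)) i, 0)) f) \<le> ennreal \<epsilon>"
        using fd that by (auto simp: adm_def less_Suc_eq)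
      moreover have "mixed_diff n (\<lambda>i. ((h(n := t)) i, 0)) f z = g h z" for z
        unfolding g_def by (rule mixed_diff_cong) auto
      ultimately show ?thesis by (simp add: mixed_diff_Suc_fun)
    qed
    have "\<exists>x. R Q (\<lambda>z. g h z - g h (x, snd z)) \<le> ennreal (2 * \<epsilon>)" if "adm h" for h
      using average_shift[of "g h" \<epsilon>] g_step[OF that] gm \<epsilon> by fastforce
    \<comment> \<open>The line is chosen as a function of the difference \<open>g h\<close> and not
      of \<open>h\<close>. Hence step sequences that agree below \<open>n\<close> get the same line,
      and \<open>m (hk h n)\<close> is literally \<open>M\<close> later on.\<close>
    then have "\<exists>\<xi>. \<forall>G. (\<exists>h. adm h \<and> G = g h) \<longrightarrow> R Q (\<lambda>z. G z - G (\<xi> G, snd z)) \<le> ennreal (2 * \<epsilon>)"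
      by (intro choice) blast
    then obtain \<xi> where \<xi>: "\<And>h. adm h \<Longrightarrow> R Q (\<lambda>z. g h z - g h (\<xi> (g h), snd z)) \<le> ennreal (2 * \<epsilon>)"
      by blast
    define m where "m h y = g h (\<xi> (g h), y)" for h y
    have m1: "m h \<in> borel_measurable borel" for h
      unfolding m_def by (rule borel_measurable_section) (rule gm)
    have mm[measurable]: "(\<lambda>z. m h (snd z)) \<in> mble" for h
      by (rule borel_measurable_fst_snd) (rule m1)
    have gmd: "R Q (\<lambda>z. g h z - m h (snd z)) \<le> ennreal (2 * \<epsilon>)" if "adm h" for h
      using \<xi>[OF that] by (simp add: m_def)
    define E' where "E' = P * ((2 * P) ^ n * F + 2 * \<epsilon>)"
    have E'0: "0 \<le> E'" using P0 F0 \<epsilon> by (simp add: E'_def)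
    have mE: "R Q (\<lambda>z. m h (snd z)) \<le> ennreal E'" if "adm h" for h
    proof -
      have "R Q (\<lambda>z. g h (z + (0, 0))) \<le> ennreal ((2 * P) ^ n * F)"
        unfolding g_def P_def
        by (rule mixed_diff_bound[where B="4 * real (Suc n)"]) (use that fF F0 in \<open>auto simp: adm_def\<close>)
      then have "R Q (g h) \<le> ennreal ((2 * P) ^ n * F)" by (simp flip: zero_prod_def)
      then have "R Q (\<lambda>z. g h z - (g h z - m h (snd z))) \<le> ennreal (2 powr s * ((2 * P) ^ n * F + 2 * \<epsilon>))"
        using gmd[OF that] \<epsilon> F0 P0 by (intro diff_bound) auto
      then show ?thesis by (simp add: E'_def P_def)
    qed
    have m_add: "R Q (\<lambda>z. m (h(k := u + v)) (snd z) - m (h(k := u)) (snd z) - m (h(k := v)) (snd z))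
        \<le> ennreal (sum_const 4 * (2 * \<epsilon>))"
      if "adm h" "k < n" "\<bar>u\<bar> \<le> 4" "\<bar>v\<bar> \<le> 4" "\<bar>u + v\<bar> \<le> 4" for h k u v
    proof -
      \<comment> \<open>The four errors: each of the three differences is replaced by its
        restriction to a line, and the shift by \<open>v\<close> in the slot identity is
        dropped.\<close>
      define w where "w = (\<lambda>j::nat. if j = 0 then (\<lambda>z. - (g (h(k := u + v)) z - m (h(k := u + v)) (snd z)))
        else if j = 1 then (\<lambda>z. g (h(k := u)) z - m (h(k := u)) (snd z))
        else if j = 2 then (\<lambda>z. g (h(k := v)) z - m (h(k := v)) (snd z))
        else (\<lambda>z. g (h(k := u)) (z + (v, 0)) - g (h(k := u)) z))"
      have adm: "adm (h(k := u))" "adm (h(k := v))" "adm (h(k := u + v))"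
        using that by (auto simp: adm_def)
      have slot: "g (h(k := u + v)) z = g (h(k := u)) (z + (v, 0)) + g (h(k := v)) z" for z
      proof -
        have "(\<lambda>i. ((h(k := x)) i, 0::real)) = (\<lambda>i. (h i, 0))(k := (x, 0))" for x by auto
        then show ?thesis
          unfolding g_def using mixed_diff_slot_add[OF that(2), of "\<lambda>i. (h i, 0)" "(u, 0)" "(v, 0)" f z]
          by (simp del: fun_upd_apply)
      qed
      have "R Q (\<lambda>z. \<Sum>j\<in>{0,1,2,3}. w j z) \<le> ennreal (sum_const (card {0,1,2,3::nat}) * (2 * \<epsilon>))" (is "_ \<le> ?b")
      proof (rule sum_bound)
        fix j :: nat assume "j \<in> {0,1,2,3}"
        show "w j \<in> mble" by (auto simp: w_def)
        have "R Q (\<lambda>z. - (g (h(k := u + v)) z - m (h(k := u + v)) (snd z))) \<le> ennreal (2 * \<epsilon>)"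
          by (subst R_minus) (use adm gmd in auto)
        moreover have "R Q (\<lambda>z. g (h(k := u)) (z + (v, 0)) - g (h(k := u)) z) \<le> ennreal (2 * \<epsilon>)"
          using g_step[OF adm(1) that(4)] \<epsilon> by (rule_tac order_trans[OF _ ennreal_leI[of \<epsilon>]]) auto
        ultimately show "R Q (w j) \<le> ennreal (2 * \<epsilon>)"
          using gmd[OF adm(1)] gmd[OF adm(2)] by (simp add: w_def)
      qed (use \<epsilon> in auto)
      moreover have "(\<lambda>z. \<Sum>j\<in>{0,1,2,3}. w j z) =
         (\<lambda>z. m (h(k := u + v)) (snd z) - m (h(k := u)) (snd z) - m (h(k := v)) (snd z))"
        by (auto simp: w_def slot)
      moreover have "?b = ennreal (sum_const 4 * (2 * \<epsilon>))" by (simp add: numeral_eq_Suc)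
      ultimately show ?thesis by simp
    qed
    have m_lin: "R Q (\<lambda>z. m h (snd z) - h k / 4 * m (h(k := 4)) (snd z)) \<le> ennreal (C3 * \<epsilon>)"
      if "adm h" "k < n" for h k
    proof -
      have "\<forall>u. \<bar>u\<bar> \<le> 4 \<longrightarrow> R Q (\<lambda>z. m (h(k := u)) (snd z) - u / 4 * m (h(k := 4)) (snd z))
          \<le> ennreal (C2 * (sum_const 4 * (2 * \<epsilon>)))"
      proof (rule HU[where E=E'])
        have "adm (h(k := u))" if "\<bar>u\<bar> \<le> 4" for u
          using \<open>adm h\<close> that by (auto simp: adm_def)
        then show "\<forall>u. \<bar>u\<bar> \<le> 4 \<longrightarrow> (\<lambda>z. m (h(k := u)) (snd z)) \<in> mble \<and>
            R Q (\<lambda>z. m (h(k := u)) (snd z)) \<le> ennreal E'"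
          using mE mm by blast
      qed (use that \<epsilon> sum_const_nonneg m_add in auto)
      from this[rule_format, of "h k"] show ?thesis
        using that by (simp add: C3_def adm_def mult_ac)
    qed
    \<comment> \<open>The first \<open>k\<close> steps are replaced by 4, one at a time. The
      telescoping sum turns near linearity in each slot into nearness of \<open>m h\<close> to the
      product of all \<open>h i / 4\<close> times \<open>M\<close>; the weights are at most 1
      because \<open>\<bar>h i\<bar> \<le> 4\<close>.\<close>
    define hk where "hk h k = (\<lambda>i. if i < k then 4 else h i)" for h :: "nat \<Rightarrow> real" and k
    define w where "w h k z = (\<Prod>i<k. h i / 4) * (m (hk h k) (snd z) - h k / 4 * m (hk h (Suc k)) (snd z))"
      for h k and z :: "plane"
    have wm: "w h k \<in> mble" for h k unfolding w_def by measurable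
    have tele: "(\<Sum>k<j. w h k z) = m h (snd z) - (\<Prod>i<j. h i / 4) * m (hk h j) (snd z)" for h j z
    proof (induction j)
      case 0 then show ?case by (simp add: hk_def)
    next
      case (Suc j) then show ?case by (simp add: w_def algebra_simps)
    qed
    define M where "M = m (\<lambda>_. 4)"
    have m_prod: "R Q (\<lambda>z. m h (snd z) - (\<Prod>i<n. h i / 4) * M (snd z)) \<le> ennreal (sum_const n * (C3 * \<epsilon>))"
      if "adm h" for h
    proof -
      have "R Q (\<lambda>z. \<Sum>k<n. w h k z) \<le> ennreal (sum_const (card {..<n}) * (C3 * \<epsilon>))"
      proof (rule sum_bound)
        fix k assume "k \<in> {..<n}"
        then have k: "k < n" by simp
        have adm: "adm (hk h k)" using that by (auto simp: adm_def hk_def)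
        have upd: "(hk h k)(k := 4) = hk h (Suc k)" by (auto simp: hk_def less_Suc_eq)
        have hkk: "hk h k k = h k" by (simp add: hk_def)
        have "R Q (\<lambda>z. m (hk h k) (snd z) - h k / 4 * m (hk h (Suc k)) (snd z)) \<le> ennreal (C3 * \<epsilon>)"
          using m_lin[OF adm k] by (simp only: upd hkk)
        then have "R Q (w h k) \<le> ennreal (\<bar>1\<bar> powr s * (C3 * \<epsilon>))"
          unfolding w_def
        proof (rule mult_bound[rotated 4])
          have "(\<Prod>i<k. \<bar>h i / 4\<bar>) \<le> (\<Prod>i<k. 1)"
            using that k by (intro prod_mono) (auto simp: adm_def)
          then show "\<bar>\<Prod>i<k. h i / 4\<bar> \<le> 1" by (simp add: abs_prod)
        qed (use C3 \<epsilon> in auto)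
        then show "R Q (w h k) \<le> ennreal (C3 * \<epsilon>)" by simp
      qed (use C3 \<epsilon> wm in auto)
      moreover have "m (hk h n) = M"
      proof -
        have "g (hk h n) = g (\<lambda>_. 4)"
          unfolding g_def by (intro ext mixed_diff_cong) (auto simp: hk_def)
        then show ?thesis unfolding M_def m_def by simp
      qed
      ultimately show ?thesis by (simp add: tele)
    qed
    \<comment> \<open>Normalised so that the \<open>n\<close>-th mixed difference of
      \<open>c y * x ^ n\<close>, which is \<open>c y * fact n\<close> times the product of the
      steps, equals the multilinear expression in \<open>m_prod\<close>.\<close>
    define c where "c y = M y / (4 ^ n * fact n)" for y
    have c1: "c \<in> borel_measurable borel" unfolding c_def M_def using m1 by simp
    have cm[measurable]: "(\<lambda>z. c (snd z)) \<in> mble" by (rule borel_measurable_fst_snd) (rule c1)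
    have fstm[measurable]: "(\<lambda>z. fst z) \<in> mble" by (intro borel_measurable_continuous_onI continuous_intros)
    define f1 where "f1 = (\<lambda>z. f z - c (snd z) * fst z ^ n)"
    have f1m[measurable]: "f1 \<in> mble" unfolding f1_def by measurable
    have diff_f1: "mixed_diff n (\<lambda>i. (h i, 0)) f1 z = g h z - (\<Prod>i<n. h i / 4) * M (snd z)" for h z
    proof -
      have "mixed_diff n (\<lambda>i. (h i, 0)) f1 z = g h z - c (snd z) * (fact n * (\<Prod>i<n. h i))"
        unfolding f1_def mixed_diff_diff g_def
        using mixed_diff_fst[of n h c "\<lambda>x. x ^ n" z] by (simp add: mixed_diff_power)
      then show ?thesis by (simp add: c_def prod_dividef)
    qed
    have f1d: "R Q (mixed_diff n (\<lambda>i. (h i, 0)) f1) \<le> ennreal (C4 * \<epsilon>)" if "\<forall>i<n. \<bar>h i\<bar> \<le> 4" for h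
    proof -
      have adm: "adm h" using that by (simp add: adm_def)
      have [measurable]: "(\<lambda>z. M (snd z)) \<in> mble" by (simp add: M_def)
      have "R Q (\<lambda>z. (g h z - m h (snd z)) + (m h (snd z) - (\<Prod>i<n. h i / 4) * M (snd z))) \<le>
         ennreal (2 powr s * (2 * \<epsilon> + sum_const n * (C3 * \<epsilon>)))"
        using gmd[OF adm] m_prod[OF adm] \<epsilon> C3 sum_const_nonneg by (intro add_bound) auto
      also have "2 powr s * (2 * \<epsilon> + sum_const n * (C3 * \<epsilon>)) = C4 * \<epsilon>"
        by (simp add: C4_def P_def algebra_simps)
      also have "(\<lambda>z. (g h z - m h (snd z)) + (m h (snd z) - (\<Prod>i<n. h i / 4) * M (snd z))) =
          mixed_diff n (\<lambda>i. (h i, 0)) f1"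
        by (auto simp: diff_f1)
      finally show ?thesis .
    qed
    \<comment> \<open>Bounds \<open>\<bar>x + t\<bar>\<close> for \<open>x\<close> in
      \<open>{-1..1}\<close>. This only supplies some finite bound on the translates of
      \<open>f1\<close> for the induction hypothesis.\<close>
    define L where "L = 1 + 4 * real n"
    have f1b: "R Q (\<lambda>z. f1 (z + (t, 0))) \<le> ennreal (P * (F + \<bar>L ^ n / (4 ^ n * fact n)\<bar> powr s * E'))"
      if t: "\<bar>t\<bar> \<le> 4 * real n" for t
    proof -
      have [measurable]: "(\<lambda>z. M (snd z)) \<in> mble" by (simp add: M_def)
      have "R Q (\<lambda>z. (fst z + t) ^ n / (4 ^ n * fact n) * M (snd z)) \<le> ennreal (\<bar>L ^ n / (4 ^ n * fact n)\<bar> powr s * E')"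
      proof (rule mult_bound)
        show "R Q (\<lambda>z. M (snd z)) \<le> ennreal E'" unfolding M_def by (rule mE) (simp add: adm_def)
        fix z :: "plane" assume "z \<in> Q"
        then have "\<bar>fst z\<bar> \<le> 1" by (cases z) auto
        then have "\<bar>fst z + t\<bar> \<le> L" unfolding L_def using t by linarith
        then show "\<bar>(fst z + t) ^ n / (4 ^ n * fact n)\<bar> \<le> L ^ n / (4 ^ n * fact n)"
          by (simp add: power_abs divide_right_mono power_mono abs_mult)
      qed (use E'0 in auto)
      then have "R Q (\<lambda>z. f (z + (t, 0)) - (fst z + t) ^ n / (4 ^ n * fact n) * M (snd z)) \<le>
        ennreal (2 powr s * (F + \<bar>L ^ n / (4 ^ n * fact n)\<bar> powr s * E'))"
        using t by (intro diff_bound fF F0) (use E'0 in auto)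
      moreover have "(\<lambda>z. f (z + (t, 0)) - (fst z + t) ^ n / (4 ^ n * fact n) * M (snd z)) = (\<lambda>z. f1 (z + (t, 0)))"
        by (auto simp: f1_def c_def)
      ultimately show ?thesis by (simp add: P_def)
    qed
    have "slice_approx n f1 (C1 * (C4 * \<epsilon>))"
      by (rule IH[OF f1m]) (use C4 \<epsilon> f1b f1d in auto)
    then obtain a where a: "\<And>i. i < n \<Longrightarrow> a i \<in> borel_measurable borel"
      "R Q (\<lambda>z. f1 z - (\<Sum>i<n. a i (snd z) * fst z ^ i)) \<le> ennreal (C1 * (C4 * \<epsilon>))" unfolding slice_approx_def by blast
    show "slice_approx (Suc n) f (C1 * C4 * \<epsilon>)"
      unfolding slice_approx_def
    proof (intro exI[of _ "a(n := c)"] conjI)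
      show "\<forall>i<Suc n. (a(n := c)) i \<in> borel_measurable borel"
        using a(1) c1 by (auto simp: less_Suc_eq)
      have "(\<lambda>z. f z - (\<Sum>i<Suc n. (a(n := c)) i (snd z) * fst z ^ i)) =
        (\<lambda>z. f1 z - (\<Sum>i<n. a i (snd z) * fst z ^ i))"
        by (auto simp: f1_def)
      then show "R Q (\<lambda>z. f z - (\<Sum>i<Suc n. (a(n := c)) i (snd z) * fst z ^ i)) \<le> ennreal (C1 * C4 * \<epsilon>)"
        using a(2) by (simp add: mult.assoc)
    qed
  qed
qed

end

section \<open>Interpolation\<close>

lemma sum_Pow_card:
  fixes g :: "nat \<Rightarrow> 'b::real_vector"
  assumes "finite A"
  shows "(\<Sum>S\<in>Pow A. g (card S)) = (\<Sum>k\<le>card A. real (card A choose k) *\<^sub>R g k)"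
proof -
  have "(\<Sum>S\<in>Pow A. g (card S)) = (\<Sum>k\<le>card A. \<Sum>S\<in>{S\<in>Pow A. card S = k}. g (card S))"
    by (rule sum.group[symmetric]) (use assms in \<open>auto intro: card_mono\<close>)
  also have "\<dots> = (\<Sum>k\<le>card A. real (card A choose k) *\<^sub>R g k)"
    by (rule sum.cong) (use assms n_subsets[OF assms] in \<open>auto simp: scaleR_conv_of_real of_nat_sum[symmetric] sum_constant_scaleR\<close>)
  finally show ?thesis .
qed

lemma fin_diff_eq_mixed_diff: "fin_diff r v f z = mixed_diff r (\<lambda>_. v) f z"
proof -
  have "mixed_diff r (\<lambda>_. v) f z = (\<Sum>S\<in>Pow {..<r}. (-1) ^ (r + card S) * f (z + real (card S) *\<^sub>R v))"
    by (simp add: mixed_diff_expand sum_constant_scaleR)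
  also have "\<dots> = fin_diff r v f z"
    by (subst sum_Pow_card) (auto simp: fin_diff_def atLeast0AtMost mult_ac)
  finally show ?thesis by simp
qed

definition coord_poly :: "nat \<Rightarrow> (nat \<Rightarrow> nat \<Rightarrow> real) \<Rightarrow> plane \<Rightarrow> real" where
  "coord_poly r c z = (\<Sum>i<r. \<Sum>j<r. c i j * fst z ^ i * snd z ^ j)"

text \<open>Any substitution that carries shifts to shifts commutes with differences. It is applied
  to the exchange of the coordinates and to the affine frame.\<close>

lemma mixed_diff_comp:
  assumes "\<And>i z. \<phi> (z + h i) = \<phi> z + k i"
  shows "mixed_diff n h (\<lambda>z. g (\<phi> z)) z = mixed_diff n k g (\<phi> z)"
  by (induction n arbitrary: z) (auto simp: assms)

lemma fin_diff_comp:
  assumes "\<And>z. \<phi> (z + h) = \<phi> z + k"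
  shows "fin_diff n h (\<lambda>z. g (\<phi> z)) z = fin_diff n k g (\<phi> z)"
  unfolding fin_diff_eq_mixed_diff by (rule mixed_diff_comp) (rule assms)

lemma fin_diff_coord_poly:
  "fin_diff r (t, 0) (coord_poly r c) z = 0" "fin_diff r (0, t) (coord_poly r c) z = 0"
proof -
  have 1: "coord_poly r c = (\<lambda>z. \<Sum>i<r. (\<Sum>j<r. c i j * snd z ^ j) * fst z ^ i)"
    by (auto simp: coord_poly_def sum_distrib_left sum_distrib_right mult_ac intro!: sum.cong)
  have "mixed_diff r (\<lambda>_. (t, 0)) (\<lambda>z::plane. a (snd z) * fst z ^ i) z = 0" if "i < r" for a i
    using mixed_diff_fst[of r "\<lambda>_. t" a "\<lambda>x. x ^ i" z] mixed_diff_power[of i r "\<lambda>_. t"] that by simp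
  then show "fin_diff r (t, 0) (coord_poly r c) z = 0"
    unfolding 1 fin_diff_eq_mixed_diff mixed_diff_sum_fun by (intro sum.neutral) auto
  have 2: "coord_poly r c = (\<lambda>z. (\<lambda>z. \<Sum>j<r. (\<Sum>i<r. c i j * snd z ^ i) * fst z ^ j) (prod.swap z))"
  proof
    fix z :: "plane"
    have "coord_poly r c z = (\<Sum>j<r. \<Sum>i<r. c i j * fst z ^ i * snd z ^ j)"
      unfolding coord_poly_def by (rule sum.swap)
    then show "coord_poly r c z = (\<lambda>z. \<Sum>j<r. (\<Sum>i<r. c i j * snd z ^ i) * fst z ^ j) (prod.swap z)"
      by (simp add: sum_distrib_right)
  qed
  have K: "mixed_diff r (\<lambda>_. (t, 0)) (\<lambda>z::plane. a (snd z) * fst z ^ i) w = 0" if "i < r" for a i w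
    using mixed_diff_fst[of r "\<lambda>_. t" a "\<lambda>x. x ^ i" w] mixed_diff_power[of i r "\<lambda>_. t"] that by simp
  have "fin_diff r (0, t) (coord_poly r c) z =
      fin_diff r (t, 0) (\<lambda>z. \<Sum>j<r. (\<Sum>i<r. c i j * snd z ^ i) * fst z ^ j) (prod.swap z)"
    unfolding 2 by (rule fin_diff_comp) auto
  also have "\<dots> = 0"
    unfolding fin_diff_eq_mixed_diff mixed_diff_sum_fun by (rule sum.neutral) (auto intro: K simp del: swap_simp)
  finally show "fin_diff r (0, t) (coord_poly r c) z = 0" .
qed

section \<open>Lagrange interpolation at freely chosen nodes\<close>

definition lagrange_basis :: "nat \<Rightarrow> (nat \<Rightarrow> real) \<Rightarrow> nat \<Rightarrow> real poly" where
  "lagrange_basis r x k = (\<Prod>l\<in>{..<r} - {k}. smult (1 / (x k - x l)) [:- x l, 1:])"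

lemma degree_lagrange_basis:
  assumes "k < r"
  shows "degree (lagrange_basis r x k) < r"
proof -
  have "degree (lagrange_basis r x k) \<le> (\<Sum>l\<in>{..<r} - {k}. degree (smult (1 / (x k - x l)) [:- x l, 1:]))"
    using degree_prod_sum_le[of "{..<r} - {k}" "\<lambda>l. smult (1 / (x k - x l)) [:- x l, 1:]"]
    by (simp add: o_def lagrange_basis_def)
  also have "\<dots> \<le> (\<Sum>l\<in>{..<r} - {k}. 1)"
    by (intro sum_mono order_trans[OF degree_smult_le]) simp
  also have "\<dots> < r" using assms by simp
  finally show ?thesis .
qed

text \<open>The difference of the two sides has degree below \<open>r\<close> and vanishes at
  \<open>r\<close> distinct nodes.\<close>

lemma lagrange_interpolation:
  assumes inj: "inj_on x {..<r}" and p: "degree p < r"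
  shows "p = (\<Sum>k<r. smult (poly p (x k)) (lagrange_basis r x k))"
proof -
  let ?L = "lagrange_basis r x"
  have val: "poly (?L k) (x l) = (if k = l then 1 else 0)" if "k < r" "l < r" for k l
  proof (cases "k = l")
    case True
    have "poly (smult (1 / (x k - x l)) [:- x l, 1:]) (x k) = 1" if "l \<in> {..<r} - {k}" for l
    proof -
      have "x k \<noteq> x l" using inj that \<open>k < r\<close> by (auto simp: inj_on_def)
      then show ?thesis by (simp add: divide_simps)
    qed
    then show ?thesis using True
      by (simp add: lagrange_basis_def poly_prod)
  next
    case False
    then show ?thesis using that by (auto simp: lagrange_basis_def poly_prod intro!: prod_zero bexI[of _ l])
  qed
  define d where "d = p - (\<Sum>k<r. smult (poly p (x k)) (?L k))"
  have "degree d < r"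
    unfolding d_def using p degree_lagrange_basis
    by (intro degree_diff_less degree_sum_less) (auto intro: le_less_trans[OF degree_smult_le])
  moreover have "poly d (x l) = 0" if "l < r" for l
    using that by (simp add: d_def poly_sum val if_distrib cong: if_cong)
  then have "x ` {..<r} \<subseteq> {y. poly d y = 0}" by auto
  then have "r \<le> degree d" if "d \<noteq> 0"
    using that card_mono[of "{y. poly d y = 0}" "x ` {..<r}"] card_poly_roots_bound[of d] poly_roots_finite[of d] inj
    by (simp add: card_image)
  ultimately have "d = 0" by linarith
  then show ?thesis unfolding d_def by (rule eq_iff_diff_eq_0[THEN iffD2])
qed

lemma poly_sum_lessThan:
  fixes p :: "real poly"
  assumes "degree p < r"
  shows "poly p x = (\<Sum>i<r. coeff p i * x ^ i)"
proof -
  have "(\<Sum>i\<le>degree p. coeff p i * x ^ i) = (\<Sum>i<r. coeff p i * x ^ i)"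
    by (rule sum.mono_neutral_left) (use assms in \<open>auto simp: coeff_eq_0\<close>)
  then show ?thesis by (simp add: poly_altdef)
qed

section \<open>Approximation on a square\<close>

lemma borel_measurable_fin_diff [measurable]:
  fixes f :: "'a::{real_normed_vector,second_countable_topology} \<Rightarrow> real"
  assumes "f \<in> borel_measurable borel"
  shows "fin_diff n v f \<in> borel_measurable borel"
  unfolding fin_diff_eq_mixed_diff[abs_def] using assms by (rule borel_measurable_mixed_diff)

lemma borel_measurable_coord_poly [measurable]: "coord_poly r c \<in> borel_measurable borel"
  unfolding coord_poly_def[abs_def] by (intro borel_measurable_continuous_onI continuous_intros)

lemma sets_borel_shift [measurable]:
  fixes S :: "'a::{real_normed_vector,second_countable_topology} set"
  assumes [measurable]: "S \<in> sets borel"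
  shows "{z\<in>S. z + w \<in> S} \<in> sets borel"
proof -
  have "S \<inter> ((\<lambda>z. z + w) -` S \<inter> space borel) \<in> sets borel" by measurable
  also have "S \<inter> ((\<lambda>z. z + w) -` S \<inter> space borel) = {z\<in>S. z + w \<in> S}" by auto
  finally show ?thesis .
qed

lemma sets_borel_box: "{a..b} \<times> {c..d} \<in> sets (borel :: plane measure)"
  by (intro borel_closed closed_Times) auto

context lp_gauge begin

definition small_diffs :: "nat \<Rightarrow> plane set \<Rightarrow> plane \<Rightarrow> (plane \<Rightarrow> real) \<Rightarrow> real \<Rightarrow> bool" where
  "small_diffs r G v f \<epsilon> \<longleftrightarrow>
     (\<forall>t. R {z\<in>G. z + (real r * t) *\<^sub>R v \<in> G} (fin_diff r (t *\<^sub>R v) f) \<le> ennreal \<epsilon>)"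

lemma small_diffs_subset:
  assumes "small_diffs r G v f \<epsilon>" "S \<subseteq> G" "S \<in> sets borel" "G \<in> sets borel" "f \<in> mble"
  shows "small_diffs r S v f \<epsilon>"
  unfolding small_diffs_def
proof
  fix t
  have "R {z\<in>S. z + (real r * t) *\<^sub>R v \<in> S} (fin_diff r (t *\<^sub>R v) f) \<le>
      R {z\<in>G. z + (real r * t) *\<^sub>R v \<in> G} (fin_diff r (t *\<^sub>R v) f)"
    using assms by (intro mono sets_borel_shift borel_measurable_fin_diff) auto
  then show "R {z\<in>S. z + (real r * t) *\<^sub>R v \<in> S} (fin_diff r (t *\<^sub>R v) f) \<le> ennreal \<epsilon>"
    using assms(1) order_trans unfolding small_diffs_def by blast
qed

lemma small_diffs_minus: "small_diffs r G v f \<epsilon> \<Longrightarrow> small_diffs r G (- v) f \<epsilon>"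
  unfolding small_diffs_def
proof
  fix t
  assume "\<forall>t. R {z\<in>G. z + (real r * t) *\<^sub>R v \<in> G} (fin_diff r (t *\<^sub>R v) f) \<le> ennreal \<epsilon>"
  from this[rule_format, of "- t"]
  show "R {z\<in>G. z + (real r * t) *\<^sub>R - v \<in> G} (fin_diff r (t *\<^sub>R - v) f) \<le> ennreal \<epsilon>"
    by simp
qed

text \<open>Kemperman's identity bounds the mixed differences, and \<open>A\<close> is what it
  needs. With steps at most 4, the first node of the difference attached to \<open>S\<close> is
  displaced by at most \<open>4 * r\<close>. The last is displaced by the sum of
  \<open>(1 - r / (i + 1)) * h i\<close>, at most \<open>r\<close> terms of size at most
  \<open>4 * r\<close>. Only the first variable moves, so \<open>B\<close> is no taller than
  \<open>Q\<close>.\<close>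

lemma slice_approximation:
  assumes r: "1 \<le> r"
  defines "A \<equiv> 1 + 4 * (real r)\<^sup>2"
  defines "B \<equiv> {-A..A} \<times> {-1..1}"
  shows "\<exists>C\<ge>0. \<forall>f \<epsilon>. f \<in> mble \<longrightarrow> 0 \<le> \<epsilon> \<longrightarrow> R B f < \<infinity> \<longrightarrow> small_diffs r B (1, 0) f \<epsilon> \<longrightarrow>
     slice_approx r f (C * \<epsilon>)"
proof -
  obtain C where C: "0 \<le> C" and poly: "\<And>f \<epsilon> E. f \<in> mble \<Longrightarrow> 0 \<le> \<epsilon> \<Longrightarrow>
     (\<forall>t. \<bar>t\<bar> \<le> 4 * real r \<longrightarrow> R Q (\<lambda>z. f (z + (t, 0))) \<le> ennreal E) \<Longrightarrow>
     (\<forall>h. (\<forall>i<r. \<bar>h i\<bar> \<le> 4) \<longrightarrow> R Q (mixed_diff r (\<lambda>i. (h i, 0)) f) \<le> ennreal \<epsilon>) \<Longrightarrow>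
     slice_approx r f (C * \<epsilon>)"
    using slicewise_polynomial[of r] by blast
  have Bm: "B \<in> sets borel" unfolding B_def by (rule sets_borel_box)
  define K where "K = sum_const (card (Pow {..<r}))"
  have rr: "real r \<le> (real r)\<^sup>2" using r by (simp add: power2_eq_square mult_le_cancel_left1)
  show ?thesis
  proof (intro exI[of _ "C * K"] conjI allI impI)
    show "0 \<le> C * K" using C sum_const_nonneg by (simp add: K_def)
  next
    fix f \<epsilon>
    assume f[measurable]: "f \<in> mble" and \<epsilon>: "0 \<le> \<epsilon>" and fin: "R B f < \<infinity>" and sd: "small_diffs r B (1, 0) f \<epsilon>"
    have "R Q (\<lambda>z. f (z + (t, 0))) \<le> ennreal (enn2real (R B f))" if "\<bar>t\<bar> \<le> 4 * real r" for t
    proof -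
      have t: "\<bar>t\<bar> \<le> 4 * (real r)\<^sup>2" using that rr by linarith
      have "R Q (\<lambda>z. f (z + (t, 0))) \<le> R B f"
      proof (rule shift[OF Q_borel Bm f])
        fix z :: "plane" assume "z \<in> Q"
        then show "z + (t, 0) \<in> B" using t unfolding B_def A_def by (cases z) auto
      qed
      then show ?thesis using fin by simp
    qed
    moreover have "R Q (mixed_diff r (\<lambda>i. (h i, 0)) f) \<le> ennreal (K * \<epsilon>)" if h: "\<forall>i<r. \<bar>h i\<bar> \<le> 4" for h
    proof -
      define \<tau> where "\<tau> S = - (\<Sum>i\<in>S. h i / real (Suc i))" for S
      define F where "F S = fin_diff r (\<tau> S *\<^sub>R (1, 0)) f" for S
      have Fm: "F S \<in> mble" for S unfolding F_def by measurable
      have "mixed_diff r (\<lambda>i. (h i, 0)) f = (\<lambda>z. \<Sum>S\<in>Pow {..<r}. (-1) ^ card S * F S (z + (sum h S, 0)))"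
      proof -
        have "(\<Sum>i\<in>S. (h i, 0)) = (sum h S, 0::real)" for S
          by (induction S rule: infinite_finite_induct) (auto simp: zero_prod_def)
        moreover have "- (\<Sum>i\<in>S. (1 / real (Suc i)) *\<^sub>R (h i, 0::real)) = \<tau> S *\<^sub>R (1, 0)" for S
          by (induction S rule: infinite_finite_induct) (auto simp: zero_prod_def \<tau>_def)
        ultimately show ?thesis unfolding F_def by (auto simp: mixed_diff_fin_diff)
      qed
      moreover have "R Q (\<lambda>z. \<Sum>S\<in>Pow {..<r}. (-1) ^ card S * F S (z + (sum h S, 0))) \<le> ennreal (K * \<epsilon>)"
        unfolding K_def
      proof (rule sum_bound)
        fix S assume S: "S \<in> Pow {..<r}"
        then have cS: "real (card S) \<le> real r" using card_mono[of "{..<r}" S] by simp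
        have hS: "\<bar>sum h S\<bar> \<le> 4 * (real r)\<^sup>2"
        proof -
          have "\<bar>sum h S\<bar> \<le> (\<Sum>i\<in>S. 4)"
            using S h by (intro order_trans[OF sum_abs] sum_mono) auto
          also have "\<dots> \<le> 4 * real r" using cS by simp
          finally show ?thesis using rr by linarith
        qed
        have hS': "\<bar>sum h S + real r * \<tau> S\<bar> \<le> 4 * (real r)\<^sup>2"
        proof -
          have "sum h S + real r * \<tau> S = (\<Sum>i\<in>S. (1 - real r / real (Suc i)) * h i)"
            by (simp add: \<tau>_def sum_distrib_left sum_subtractf algebra_simps)
          also have "\<bar>\<dots>\<bar> \<le> (\<Sum>i\<in>S. real r * 4)"
          proof (intro order_trans[OF sum_abs] sum_mono)
            fix i assume "i \<in> S"
            then have i: "i < r" using S by auto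
            have "1 \<le> real r / real (Suc i)" "real r / real (Suc i) \<le> real r"
              using i by (auto simp: divide_le_eq mult_le_cancel_left1)
            then have "\<bar>1 - real r / real (Suc i)\<bar> \<le> real r" by linarith
            then show "\<bar>(1 - real r / real (Suc i)) * h i\<bar> \<le> real r * 4"
              unfolding abs_mult using h i by (intro mult_mono) auto
          qed
          also have "\<dots> = real (card S) * (real r * 4)" by simp
          also have "\<dots> \<le> real r * (real r * 4)" using cS by (intro mult_right_mono) auto
          finally show ?thesis by (simp add: power2_eq_square)
        qed
        have "R Q (\<lambda>z. F S (z + (sum h S, 0))) \<le>
            R {z\<in>B. z + (real r * \<tau> S) *\<^sub>R (1, 0) \<in> B} (F S)"
        proof (rule shift[OF Q_borel sets_borel_shift[OF Bm] Fm])
          fix z :: "plane" assume "z \<in> Q"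
          then show "z + (sum h S, 0) \<in> {z\<in>B. z + (real r * \<tau> S) *\<^sub>R (1, 0) \<in> B}"
            using hS hS' unfolding B_def A_def by (cases z) auto
        qed
        also have "\<dots> \<le> ennreal \<epsilon>" using sd unfolding small_diffs_def F_def by blast
        finally show "R Q (\<lambda>z. (-1) ^ card S * F S (z + (sum h S, 0))) \<le> ennreal \<epsilon>"
          using Fm by (subst cmult) (auto simp: power_abs)
        show "(\<lambda>z. (-1) ^ card S * F S (z + (sum h S, 0))) \<in> mble" using Fm[measurable] by measurable
      qed (use \<epsilon> in auto)
      ultimately show ?thesis by simp
    qed
    ultimately have "slice_approx r f (C * (K * \<epsilon>))"
      using \<epsilon> sum_const_nonneg by (intro poly f) (auto simp: K_def)
    then show "slice_approx r f (C * K * \<epsilon>)"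
      by (simp add: mult.assoc)
  qed
qed

text \<open>Each of the \<open>r - 1\<close> factors has numerator at most 2 and denominator at
  least \<open>d\<close>; the exponent is rounded up, as \<open>2 / d\<close> is at least 1.\<close>

lemma abs_poly_lagrange_basis_le:
  assumes d: "0 < d" "d \<le> 2" and x: "\<And>k. k < r \<Longrightarrow> x k \<in> {-1..1}"
    and sep: "\<And>k l. k < r \<Longrightarrow> l < r \<Longrightarrow> k \<noteq> l \<Longrightarrow> d \<le> \<bar>x k - x l\<bar>"
    and k: "k < r" and y: "\<bar>y\<bar> \<le> 1"
  shows "\<bar>poly (lagrange_basis r x k) y\<bar> \<le> (2 / d) ^ r"
proof -
  have "\<bar>poly (lagrange_basis r x k) y\<bar> = (\<Prod>l\<in>{..<r} - {k}. \<bar>y - x l\<bar> / \<bar>x k - x l\<bar>)"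
    by (simp add: lagrange_basis_def poly_prod abs_prod abs_divide[symmetric] diff_divide_distrib)
  also have "\<dots> \<le> (\<Prod>l\<in>{..<r} - {k}. 2 / d)"
  proof (intro prod_mono conjI frac_le)
    fix l assume l: "l \<in> {..<r} - {k}"
    show "\<bar>y - x l\<bar> \<le> 2" using x[of l] y l by auto
    show "d \<le> \<bar>x k - x l\<bar>" using sep k l by auto
  qed (use d in auto)
  also have "\<dots> = (2 / d) ^ (r - 1)" using k by simp
  also have "\<dots> \<le> (2 / d) ^ r" using d by (intro power_increasing) auto
  finally show ?thesis .
qed

text \<open>Both slicewise approximants are close to \<open>f\<close>, hence to each other. The one that is polynomial
  in the first variable is determined by its values on \<open>r\<close> vertical lines, where it may be
  replaced by the other one.\<close>

lemma square_approximation: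
  assumes r: "1 \<le> r"
  defines "A \<equiv> 1 + 4 * (real r)\<^sup>2"
  defines "B \<equiv> {-A..A} \<times> {-A..A}"
  shows "\<exists>C\<ge>0. \<forall>f \<epsilon>. f \<in> mble \<longrightarrow> 0 \<le> \<epsilon> \<longrightarrow> R B f < \<infinity> \<longrightarrow>
     small_diffs r B (1, 0) f \<epsilon> \<longrightarrow> small_diffs r B (0, 1) f \<epsilon> \<longrightarrow>
     (\<exists>c. R Q (\<lambda>z. f z - coord_poly r c z) \<le> ennreal (C * \<epsilon>))"
proof -
  define B1 where "B1 = {-A..A} \<times> {-1..1::real}"
  have A: "1 \<le> A" by (simp add: A_def)
  have Bm: "B \<in> sets borel" "B1 \<in> sets borel" unfolding B_def B1_def by (rule sets_borel_box)+
  have B1B: "B1 \<subseteq> B" using A by (auto simp: B_def B1_def)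
  obtain C where C: "0 \<le> C" and slice: "\<And>f \<epsilon>. f \<in> mble \<Longrightarrow> 0 \<le> \<epsilon> \<Longrightarrow> R B1 f < \<infinity> \<Longrightarrow> small_diffs r B1 (1, 0) f \<epsilon> \<Longrightarrow>
     slice_approx r f (C * \<epsilon>)"
    using slice_approximation[OF r] unfolding A_def B1_def by blast
  define C2 where "C2 = 2 powr s * (C + C)"
  \<comment> \<open>Nodes at mutual distance at least \<open>1 / r\<close> give the bound
    \<open>(2 * r) ^ r\<close> for the basis polynomials. The factor \<open>2 * r\<close> is the
    loss \<open>2 / (b - a)\<close> of choosing a line in an interval of length
    \<open>1 / r\<close>.\<close>
  define C3 where "C3 = \<bar>(2 * real r) ^ r\<bar> powr s * (2 * real r * C2)"
  define C4 where "C4 = 2 powr s * (C + sum_const r * C3)"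
  have C2: "0 \<le> C2" and C3: "0 \<le> C3" using C by (auto simp: C2_def C3_def)
  have C4: "0 \<le> C4" using C C3 sum_const_nonneg by (simp add: C4_def)
  show ?thesis
  proof (intro exI[of _ C4] conjI allI impI C4)
    fix f \<epsilon>
    assume f[measurable]: "f \<in> mble" and \<epsilon>: "0 \<le> \<epsilon>" and fin: "R B f < \<infinity>"
      and sd1: "small_diffs r B (1, 0) f \<epsilon>" and sd2: "small_diffs r B (0, 1) f \<epsilon>"
    have [measurable]: "prod.swap \<in> borel \<rightarrow>\<^sub>M (borel :: plane measure)"
      by (intro borel_measurable_continuous_onI) (simp add: prod.swap_def[abs_def] continuous_intros)
    define f' where "f' z = f (prod.swap z)" for z
    have f'[measurable]: "f' \<in> mble" unfolding f'_def by measurable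
    have "R B1 f < \<infinity>"
      using mono[OF Bm(2,1) f f B1B] fin by (auto intro: le_less_trans)
    then obtain a where a: "\<And>i. i < r \<Longrightarrow> a i \<in> borel_measurable borel"
      "R Q (\<lambda>z. f z - (\<Sum>i<r. a i (snd z) * fst z ^ i)) \<le> ennreal (C * \<epsilon>)"
      using slice[OF f \<epsilon>] small_diffs_subset[OF sd1 B1B Bm(2,1) f] unfolding slice_approx_def by blast
    have "R B1 f' \<le> R B f"
      unfolding f'_def by (rule swap[OF Bm(2,1) f]) (use A in \<open>auto simp: B1_def B_def\<close>)
    then have fin': "R B1 f' < \<infinity>" using fin by (auto intro: le_less_trans)
    have "small_diffs r B1 (1, 0) f' \<epsilon>" unfolding small_diffs_def
    proof
      fix t
      have eq: "fin_diff r (t *\<^sub>R (1, 0)) f' = (\<lambda>z. fin_diff r (t *\<^sub>R (0, 1)) f (prod.swap z))"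
        unfolding f'_def by (intro ext fin_diff_comp) auto
      have "R {z\<in>B1. z + (real r * t) *\<^sub>R (1, 0) \<in> B1} (fin_diff r (t *\<^sub>R (1, 0)) f') \<le>
        R {z\<in>B. z + (real r * t) *\<^sub>R (0, 1) \<in> B} (fin_diff r (t *\<^sub>R (0, 1)) f)"
        unfolding eq
        by (rule swap[OF sets_borel_shift[OF Bm(2)] sets_borel_shift[OF Bm(1)] borel_measurable_fin_diff[OF f]])
          (use A in \<open>auto simp: B1_def B_def\<close>)
      also have "\<dots> \<le> ennreal \<epsilon>" using sd2 unfolding small_diffs_def by blast
      finally show "R {z\<in>B1. z + (real r * t) *\<^sub>R (1, 0) \<in> B1} (fin_diff r (t *\<^sub>R (1, 0)) f') \<le> ennreal \<epsilon>" .
    qed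
    then obtain b where b: "\<And>i. i < r \<Longrightarrow> b i \<in> borel_measurable borel"
      "R Q (\<lambda>z. f' z - (\<Sum>i<r. b i (snd z) * fst z ^ i)) \<le> ennreal (C * \<epsilon>)"
      using slice[OF f' \<epsilon> fin'] unfolding slice_approx_def by blast
    define P1 where "P1 z = (\<Sum>i<r. a i (snd z) * fst z ^ i)" for z
    define P2 where "P2 z = (\<Sum>j<r. b j (fst z) * snd z ^ j)" for z
    have fsm[measurable]: "fst \<in> mble" "snd \<in> mble"
      by (intro borel_measurable_continuous_onI continuous_intros)+
    have P1m[measurable]: "P1 \<in> mble" unfolding P1_def
      by (intro borel_measurable_sum borel_measurable_times borel_measurable_power fsm borel_measurable_fst_snd a) auto
    have P2m[measurable]: "P2 \<in> mble" unfolding P2_def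
      by (intro borel_measurable_sum borel_measurable_times borel_measurable_power fsm borel_measurable_fst_snd b) auto
    have fP1: "R Q (\<lambda>z. f z - P1 z) \<le> ennreal (C * \<epsilon>)" using a(2) by (simp add: P1_def)
    have fP2: "R Q (\<lambda>z. f z - P2 z) \<le> ennreal (C * \<epsilon>)"
    proof -
      have "R Q (\<lambda>z. f z - P2 z) = R Q (\<lambda>z. (\<lambda>z. f' z - P2 (prod.swap z)) (prod.swap z))"
        by (simp add: f'_def)
      also have "\<dots> \<le> R Q (\<lambda>z. f' z - P2 (prod.swap z))"
        by (rule swap) auto
      also have "\<dots> \<le> ennreal (C * \<epsilon>)" using b(2) by (simp add: P2_def)
      finally show ?thesis .
    qed
    have "R Q (\<lambda>z. (f z - P2 z) - (f z - P1 z)) \<le> ennreal (2 powr s * (C * \<epsilon> + C * \<epsilon>))"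
      by (rule diff_bound) (use fP1 fP2 C \<epsilon> in auto)
    then have P12: "R Q (\<lambda>z. P1 z - P2 z) \<le> ennreal (C2 * \<epsilon>)" by (simp add: C2_def algebra_simps)
    define lo where "lo k = -1 + 2 * real k / real r" for k
    have "\<exists>y\<in>{lo k..lo k + 1 / real r}. R Q (\<lambda>z. P1 (y, snd z) - P2 (y, snd z)) \<le> ennreal (2 * real r * C2 * \<epsilon>)"
      if "k < r" for k
    proof -
      have "real (Suc k) \<le> real r" using that by (intro of_nat_mono) simp
      then have "lo k + 1 / real r \<le> 1" using r by (simp add: lo_def divide_simps)
      then show ?thesis
        using average_section[of "\<lambda>z. P1 z - P2 z" "C2 * \<epsilon>" "lo k" "lo k + 1 / real r"] r P12 C2 \<epsilon>
        by (auto simp: lo_def mult_ac)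
    qed
    then have "\<forall>k. \<exists>y. k < r \<longrightarrow> y \<in> {lo k..lo k + 1 / real r} \<and>
        R Q (\<lambda>z. P1 (y, snd z) - P2 (y, snd z)) \<le> ennreal (2 * real r * C2 * \<epsilon>)"
      by blast
    from choice[OF this] obtain x where x: "\<And>k. k < r \<Longrightarrow> x k \<in> {lo k..lo k + 1 / real r}"
      "\<And>k. k < r \<Longrightarrow> R Q (\<lambda>z. P1 (x k, snd z) - P2 (x k, snd z)) \<le> ennreal (2 * real r * C2 * \<epsilon>)"
      by blast
    have x1: "x k \<in> {-1..1}" if "k < r" for k
    proof -
      have "real (Suc k) \<le> real r" using that by (intro of_nat_mono) simp
      then have "lo k + 1 / real r \<le> 1" using r by (simp add: lo_def divide_simps)
      moreover have "-1 \<le> lo k" by (simp add: lo_def)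
      ultimately show ?thesis using x(1)[OF that] by auto
    qed
    have gap: "1 / real r \<le> x l - x k" if "k < l" "l < r" for k l
    proof -
      have "real (Suc k) \<le> real l" using that by (intro of_nat_mono) simp
      then have "2 * (real k + 1) / real r \<le> 2 * real l / real r" by (intro divide_right_mono) auto
      moreover have "x k \<le> lo k + 1 / real r" "lo l \<le> x l" using x(1)[of k] x(1)[of l] that by auto
      ultimately show ?thesis by (simp add: lo_def add_divide_distrib)
    qed
    have sep: "1 / real r \<le> \<bar>x k - x l\<bar>" if "k < r" "l < r" "k \<noteq> l" for k l
      using gap[of k l] gap[of l k] that by (cases k l rule: linorder_cases) auto
    have inj: "inj_on x {..<r}"
    proof (rule inj_onI)
      fix k l assume "k \<in> {..<r}" "l \<in> {..<r}" "x k = x l"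
      then show "k = l" using sep[of k l] r by (cases "k = l") auto
    qed
    define L where "L = lagrange_basis r x"
    \<comment> \<open>The unknown functions \<open>b j\<close> enter only through the numbers
      \<open>b j (x k)\<close>, so this is a polynomial in both variables. Interpolation reproduces
      \<open>P1\<close>, hence \<open>P1 - P3\<close> is a combination of the values of
      \<open>P1 - P2\<close> on the chosen lines.\<close>
    define P3 where "P3 z = (\<Sum>k<r. poly (L k) (fst z) * P2 (x k, snd z))" for z
    define c where "c i j = (\<Sum>k<r. coeff (L k) i * b j (x k))" for i j
    have P3c: "P3 = coord_poly r c"
    proof
      fix z :: "plane"
      have "P3 z = (\<Sum>k<r. (\<Sum>i<r. coeff (L k) i * fst z ^ i) * (\<Sum>j<r. b j (x k) * snd z ^ j))"
        unfolding P3_def P2_def L_def by (intro sum.cong) (auto simp: poly_sum_lessThan degree_lagrange_basis)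
      also have "\<dots> = (\<Sum>k<r. \<Sum>i<r. \<Sum>j<r. coeff (L k) i * b j (x k) * fst z ^ i * snd z ^ j)"
        by (simp add: sum_product mult_ac)
      also have "\<dots> = (\<Sum>i<r. \<Sum>k<r. \<Sum>j<r. coeff (L k) i * b j (x k) * fst z ^ i * snd z ^ j)"
        by (rule sum.swap)
      also have "\<dots> = (\<Sum>i<r. \<Sum>j<r. \<Sum>k<r. coeff (L k) i * b j (x k) * fst z ^ i * snd z ^ j)"
        by (intro sum.cong refl sum.swap)
      also have "\<dots> = coord_poly r c z"
        by (simp add: coord_poly_def c_def sum_distrib_right)
      finally show "P3 z = coord_poly r c z" .
    qed
    have P1L: "P1 z = (\<Sum>k<r. poly (L k) (fst z) * P1 (x k, snd z))" for z
    proof -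
      define p where "p = (\<Sum>i<r. monom (a i (snd z)) i)"
      have "degree p < r" unfolding p_def using r
        by (intro degree_sum_less) (auto intro: le_less_trans[OF degree_monom_le])
      then have "p = (\<Sum>k<r. smult (poly p (x k)) (L k))"
        unfolding L_def by (rule lagrange_interpolation[OF inj])
      then have "poly p (fst z) = poly (\<Sum>k<r. smult (poly p (x k)) (L k)) (fst z)" by simp
      moreover have "poly p y = P1 (y, snd z)" for y by (simp add: p_def P1_def poly_sum poly_monom)
      ultimately show ?thesis by (simp add: poly_sum mult_ac)
    qed
    define W where "W k z = poly (L k) (fst z) * (P1 (x k, snd z) - P2 (x k, snd z))" for k and z :: "plane"
    have D_m: "(\<lambda>z. P1 (x k, snd z) - P2 (x k, snd z)) \<in> mble" for k
      by (rule borel_measurable_fst_snd) (intro borel_measurable_diff borel_measurable_section P1m P2m)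
    have Lm: "(\<lambda>z. poly (L k) (fst z)) \<in> mble" for k
      by (intro borel_measurable_continuous_onI continuous_intros)
    have Wm: "W k \<in> mble" for k
      unfolding W_def by (intro borel_measurable_times Lm D_m)
    have "R Q (\<lambda>z. \<Sum>k<r. W k z) \<le> ennreal (sum_const (card {..<r}) * (C3 * \<epsilon>))"
    proof (rule sum_bound)
      fix k assume "k \<in> {..<r}"
      then have k: "k < r" by simp
      have "R Q (W k) \<le> ennreal (\<bar>(2 * real r) ^ r\<bar> powr s * (2 * real r * C2 * \<epsilon>))"
        unfolding W_def
      proof (rule mult_bound[OF Q_borel D_m Lm _ x(2)[OF k]])
        fix z :: "plane" assume "z \<in> Q"
        then have "\<bar>fst z\<bar> \<le> 1" by auto
        then show "\<bar>poly (L k) (fst z)\<bar> \<le> (2 * real r) ^ r"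
          using abs_poly_lagrange_basis_le[of "1 / real r" r x k "fst z"] r x1 sep k
          by (simp add: L_def divide_le_eq)
      qed (use C2 \<epsilon> in auto)
      then show "R Q (W k) \<le> ennreal (C3 * \<epsilon>)" by (simp add: C3_def mult_ac)
    qed (use Wm C3 \<epsilon> in auto)
    moreover have "(\<Sum>k<r. W k z) = P1 z - P3 z" for z
      unfolding P1L[of z] P3_def W_def by (simp add: right_diff_distrib sum_subtractf)
    ultimately have P13: "R Q (\<lambda>z. P1 z - P3 z) \<le> ennreal (sum_const r * (C3 * \<epsilon>))" by simp
    have "R Q (\<lambda>z. (f z - P1 z) + (P1 z - P3 z)) \<le> ennreal (2 powr s * (C * \<epsilon> + sum_const r * (C3 * \<epsilon>)))"
      by (rule add_bound) (use fP1 P13 C C3 \<epsilon> sum_const_nonneg P3c in auto)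
    then show "\<exists>c. R Q (\<lambda>z. f z - coord_poly r c z) \<le> ennreal (C4 * \<epsilon>)"
      by (intro exI[of _ c]) (simp add: C4_def P3c algebra_simps)
  qed
qed

end

section \<open>Extension to the body\<close>

context lp_gauge begin

text \<open>A bound on a slab is propagated in direction \<open>v\<close>, one \<open>r\<close>-th of the width of the slab at a
  time: a difference of that step expresses the new values by old ones.\<close>

lemma slab_extension:
  assumes r: "1 \<le> r"
  shows "\<exists>C\<ge>0. \<forall>f G W v \<phi> \<alpha> \<beta> \<epsilon> \<delta>. f \<in> mble \<longrightarrow> G \<in> sets borel \<longrightarrow> W \<in> sets borel \<longrightarrow> W \<subseteq> G \<longrightarrow>
    small_diffs r G v f \<epsilon> \<longrightarrow> 0 \<le> \<epsilon> \<longrightarrow> 0 \<le> \<delta> \<longrightarrow> \<phi> \<in> mble \<longrightarrow>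
    (\<forall>z t. \<phi> (z + t *\<^sub>R v) = \<phi> z + t) \<longrightarrow> \<alpha> < \<beta> \<longrightarrow>
    (\<forall>z\<in>W. \<beta> \<le> \<phi> z \<longrightarrow> (\<forall>t\<in>{0..\<phi> z - \<alpha>}. z - t *\<^sub>R v \<in> W)) \<longrightarrow>
    R {z\<in>W. \<alpha> \<le> \<phi> z \<and> \<phi> z \<le> \<beta>} f \<le> ennreal \<delta> \<longrightarrow>
    R {z\<in>W. \<alpha> \<le> \<phi> z \<and> \<phi> z \<le> \<beta> + real N * (\<beta> - \<alpha>)} f \<le> ennreal (C * (\<epsilon> + \<delta>))"
proof -
  define P where "P = 2 powr s"
  define \<kappa> where "\<kappa> = sum_const r * (2 ^ r) powr s"
  \<comment> \<open>The old part contributes \<open>e\<close> and the next layer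
    \<open>P * (\<epsilon> + \<kappa> * e)\<close>, where \<open>\<epsilon> \<le> e\<close>. Here
    \<open>\<kappa>\<close> accounts for \<open>r\<close> old values with binomial weights at most
    \<open>2 ^ r\<close>.\<close>
  define K where "K = 1 + P * (1 + \<kappa>)"
  have P0: "0 \<le> P" and \<kappa>0: "0 \<le> \<kappa>" using sum_const_nonneg by (auto simp: P_def \<kappa>_def)
  have K1: "1 \<le> K" using P0 \<kappa>0 by (simp add: K_def)
  show ?thesis
  proof (intro exI[of _ "K ^ (N * r)"] conjI allI impI)
    show "0 \<le> K ^ (N * r)" using K1 by simp
  next
    fix f G W and v :: "plane" and \<phi> and \<alpha> \<beta> \<epsilon> \<delta> :: real
    assume f[measurable]: "f \<in> mble" and G: "G \<in> sets borel" and W[measurable]: "W \<in> sets borel" and WG: "W \<subseteq> G"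
      and sd: "small_diffs r G v f \<epsilon>" and \<epsilon>: "0 \<le> \<epsilon>" and \<delta>: "0 \<le> \<delta>" and \<phi>m[measurable]: "\<phi> \<in> mble"
      and \<phi>: "\<forall>z t. \<phi> (z + t *\<^sub>R v) = \<phi> z + t" and \<alpha>\<beta>: "\<alpha> < \<beta>"
      and inv: "\<forall>z\<in>W. \<beta> \<le> \<phi> z \<longrightarrow> (\<forall>t\<in>{0..\<phi> z - \<alpha>}. z - t *\<^sub>R v \<in> W)"
      and start: "R {z\<in>W. \<alpha> \<le> \<phi> z \<and> \<phi> z \<le> \<beta>} f \<le> ennreal \<delta>"
    have \<phi>': "\<phi> (z - t *\<^sub>R v) = \<phi> z - t" for z t
      using \<phi>[rule_format, of z "- t"] by simp
    define u where "u = (\<beta> - \<alpha>) / real r"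
    have u0: "0 < u" and ru: "real r * u = \<beta> - \<alpha>" using r \<alpha>\<beta> by (auto simp: u_def)
    define S where "S i = {z\<in>W. \<alpha> \<le> \<phi> z \<and> \<phi> z \<le> \<beta> + real i * u}" for i
    define D where "D i = {z\<in>W. \<beta> + real i * u \<le> \<phi> z \<and> \<phi> z \<le> \<beta> + real (Suc i) * u}" for i
    have W_eq: "{z \<in> W. p z} = W \<inter> {z \<in> space borel. p z}" for p by auto
    have Sm[measurable]: "S i \<in> sets borel" for i unfolding S_def W_eq by measurable
    have Dm[measurable]: "D i \<in> sets borel" for i unfolding D_def W_eq by measurable
    have "R (S i) f \<le> ennreal (K ^ i * (\<epsilon> + \<delta>))" for i
    proof (induction i)
      case 0
      have "R (S 0) f \<le> ennreal \<delta>" using start by (simp add: S_def)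
      also have "\<dots> \<le> ennreal (K ^ 0 * (\<epsilon> + \<delta>))" using \<epsilon> by (intro ennreal_leI) simp
      finally show ?case .
    next
      case (Suc i)
      define e where "e = K ^ i * (\<epsilon> + \<delta>)"
      have e0: "0 \<le> e" using K1 \<epsilon> \<delta> by (simp add: e_def)
      have "1 * (\<epsilon> + 0) \<le> K ^ i * (\<epsilon> + \<delta>)"
        using K1 \<epsilon> \<delta> by (intro mult_mono add_left_mono one_le_power) auto
      then have \<epsilon>e: "\<epsilon> \<le> e" by (simp add: e_def)
      \<comment> \<open>The nodes below a point of the layer \<open>D i\<close> have heights between
        \<open>\<alpha> + i * u\<close> and \<open>\<beta> + i * u\<close>, because
        \<open>r * u = \<beta> - \<alpha>\<close>. This is why the step is an \<open>r\<close>-th of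
        the width, and why \<open>W\<close> must allow moves back to height
        \<open>\<alpha>\<close>.\<close>
      have D_in: "z - (real (r - j) * u) *\<^sub>R v \<in> S i" if z: "z \<in> D i" and j: "j < r" for z j
      proof -
        have z': "z \<in> W" "\<beta> + real i * u \<le> \<phi> z" "\<phi> z \<le> \<beta> + real i * u + u"
          using z by (auto simp: D_def algebra_simps)
        have iu: "0 \<le> real i * u" using u0 by simp
        have 1: "1 * u \<le> real (r - j) * u" using j u0 by (intro mult_right_mono) auto
        have 2: "real (r - j) * u \<le> real r * u" using u0 by (intro mult_right_mono) auto
        have "real (r - j) * u \<in> {0..\<phi> z - \<alpha>}"
          unfolding atLeastAtMost_iff using z'(2) 1 2 iu u0 ru by (intro conjI; linarith)
        moreover have "\<beta> \<le> \<phi> z" using z'(2) iu by linarith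
        ultimately have "z - (real (r - j) * u) *\<^sub>R v \<in> W" using inv z'(1) by blast
        then show ?thesis
          using z'(2,3) 1 2 iu ru unfolding S_def mem_Collect_eq \<phi>' by (intro conjI; linarith?)
      qed
      have base: "R (D i) (\<lambda>z. fin_diff r (u *\<^sub>R v) f (z + - ((real r * u) *\<^sub>R v))) \<le> ennreal \<epsilon>"
      proof -
        have "R (D i) (\<lambda>z. fin_diff r (u *\<^sub>R v) f (z + - ((real r * u) *\<^sub>R v))) \<le>
            R {z\<in>G. z + (real r * u) *\<^sub>R v \<in> G} (fin_diff r (u *\<^sub>R v) f)"
        proof (rule shift[OF Dm sets_borel_shift[OF G] borel_measurable_fin_diff[OF f]])
          fix z assume z: "z \<in> D i"
          have "z - (real (r - 0) * u) *\<^sub>R v \<in> S i" by (rule D_in) (use z r in auto)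
          then have "z - (real r * u) *\<^sub>R v \<in> G" "z \<in> G" using WG z by (auto simp: S_def D_def)
          then show "z + - ((real r * u) *\<^sub>R v) \<in> {z \<in> G. z + (real r * u) *\<^sub>R v \<in> G}" by simp
        qed
        also have "\<dots> \<le> ennreal \<epsilon>" using sd unfolding small_diffs_def by blast
        finally show ?thesis .
      qed
      define h where "h j z = (-1) ^ (r + j) * real (r choose j) * f (z + - ((real (r - j) * u) *\<^sub>R v))"
        for j z
      have hm: "h j \<in> mble" for j unfolding h_def by measurable
      have "R (D i) (\<lambda>z. \<Sum>j<r. h j z) \<le> ennreal (sum_const (card {..<r}) * ((2 ^ r) powr s * e))"
      proof (rule sum_bound)
        fix j assume "j \<in> {..<r}"
        then have j: "j < r" by simp
        have fj: "R (D i) (\<lambda>z. f (z + - ((real (r - j) * u) *\<^sub>R v))) \<le> ennreal e"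
        proof -
          have "R (D i) (\<lambda>z. f (z + - ((real (r - j) * u) *\<^sub>R v))) \<le> R (S i) f"
            by (rule shift[OF Dm Sm f]) (use D_in j in auto)
          then show ?thesis using Suc.IH unfolding e_def by (rule order_trans)
        qed
        have "R (D i) (h j) \<le> ennreal (\<bar>2 ^ r\<bar> powr s * e)"
          unfolding h_def
        proof (rule mult_bound[OF Dm _ _ _ fj e0])
          have "real (r choose j) \<le> 2 ^ r" using of_nat_mono[OF binomial_le_pow2[of r j], where ?'a = real] by simp
          then show "\<bar>(-1) ^ (r + j) * real (r choose j)\<bar> \<le> 2 ^ r" by (simp add: abs_mult)
        qed auto
        then show "R (D i) (h j) \<le> ennreal ((2 ^ r) powr s * e)" by simp
      qed (use e0 hm in auto)
      then have hs: "R (D i) (\<lambda>z. \<Sum>j<r. h j z) \<le> ennreal (\<kappa> * e)" by (simp add: \<kappa>_def mult.assoc)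
      have f_eq: "f z = fin_diff r (u *\<^sub>R v) f (z + - ((real r * u) *\<^sub>R v)) - (\<Sum>j<r. h j z)" for z
      proof -
        have eq: "z + - ((real r * u) *\<^sub>R v) + real j *\<^sub>R u *\<^sub>R v = z + - ((real (r - j) * u) *\<^sub>R v)" if "j < r" for j
          using that by (simp add: of_nat_diff algebra_simps)
        have "(\<Sum>j<r. (-1) ^ (r + j) * real (r choose j) * f (z + - ((real r * u) *\<^sub>R v) + real j *\<^sub>R u *\<^sub>R v)) =
           (\<Sum>j<r. h j z)"
          by (intro sum.cong refl) (simp only: h_def lessThan_iff eq)
        then show ?thesis
          using fin_diff_last[of f "z + - ((real r * u) *\<^sub>R v)" r "u *\<^sub>R v"] by (simp add: scaleR_scaleR)
      qed
      have "R (D i) (\<lambda>z. fin_diff r (u *\<^sub>R v) f (z + - ((real r * u) *\<^sub>R v)) - (\<Sum>j<r. h j z)) \<le>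
          ennreal (2 powr s * (\<epsilon> + \<kappa> * e))"
      proof (rule diff_bound[OF Dm _ _ base hs \<epsilon>])
        show "(\<lambda>z. \<Sum>j<r. h j z) \<in> mble" using hm by (intro borel_measurable_sum) auto
      qed (use \<kappa>0 e0 in auto)
      moreover have "(\<lambda>z. fin_diff r (u *\<^sub>R v) f (z + - ((real r * u) *\<^sub>R v)) - (\<Sum>j<r. h j z)) = f"
        by (rule ext) (rule f_eq[symmetric])
      ultimately have RD: "R (D i) f \<le> ennreal (P * (\<epsilon> + \<kappa> * e))"
        by (simp add: P_def)
      have "S (Suc i) \<subseteq> S i \<union> D i" by (auto simp: S_def D_def)
      then have "R (S (Suc i)) f \<le> R (S i \<union> D i) f" by (intro mono) auto
      also have "\<dots> \<le> R (S i) f + R (D i) f" by (rule union) auto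
      also have "\<dots> \<le> ennreal e + ennreal (P * (\<epsilon> + \<kappa> * e))"
        using Suc.IH RD unfolding e_def by (rule add_mono)
      also have "\<dots> = ennreal (e + P * (\<epsilon> + \<kappa> * e))"
        using e0 P0 \<kappa>0 \<epsilon> by (simp add: ennreal_plus)
      also have "\<dots> \<le> ennreal (e + P * (e + \<kappa> * e))"
        using \<epsilon>e P0 by (intro ennreal_leI add_left_mono mult_left_mono add_right_mono)
      also have "e + P * (e + \<kappa> * e) = K ^ Suc i * (\<epsilon> + \<delta>)"
        by (simp add: e_def K_def algebra_simps)
      finally show ?case .
    qed
    from this[of "N * r"] show "R {z\<in>W. \<alpha> \<le> \<phi> z \<and> \<phi> z \<le> \<beta> + real N * (\<beta> - \<alpha>)} f \<le> ennreal (K ^ (N * r) * (\<epsilon> + \<delta>))"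
      by (simp add: S_def flip: ru) (simp add: mult_ac)
  qed
qed

end

lemma convex_horizontal:
  fixes G :: "plane set"
  assumes "convex G" "(a, y) \<in> G" "(b, y) \<in> G" "a \<le> x" "x \<le> b"
  shows "(x, y) \<in> G"
proof -
  have "x \<in> closed_segment a b" using assms by (auto simp: closed_segment_eq_real_ivl)
  then obtain u where u: "0 \<le> u" "u \<le> 1" "x = (1 - u) *\<^sub>R a + u *\<^sub>R b" by (auto simp: closed_segment_def)
  then have "(1 - u) *\<^sub>R (a, y) + u *\<^sub>R (b, y) \<in> G" using assms by (intro convexD_alt) auto
  moreover have "(1 - u) *\<^sub>R (a, y) + u *\<^sub>R (b, y) = (x, y)" using u by (simp add: algebra_simps)
  ultimately show ?thesis by simp
qed

lemma convex_vertical: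
  fixes G :: "plane set"
  assumes "convex G" "(x, a) \<in> G" "(x, b) \<in> G" "a \<le> y" "y \<le> b"
  shows "(x, y) \<in> G"
proof -
  have "y \<in> closed_segment a b" using assms by (auto simp: closed_segment_eq_real_ivl)
  then obtain u where u: "0 \<le> u" "u \<le> 1" "y = (1 - u) *\<^sub>R a + u *\<^sub>R b" by (auto simp: closed_segment_def)
  then have "(1 - u) *\<^sub>R (x, a) + u *\<^sub>R (x, b) \<in> G" using assms by (intro convexD_alt) auto
  moreover have "(1 - u) *\<^sub>R (x, a) + u *\<^sub>R (x, b) = (x, y)" using u by (simp add: algebra_simps)
  ultimately show ?thesis by simp
qed

context lp_gauge begin

lemma small_diffs_coord_poly:
  assumes "v = (1, 0) \<or> v = (0, 1)" "small_diffs r G v f \<epsilon>"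
  shows "small_diffs r G v (\<lambda>z. f z - coord_poly r c z) \<epsilon>"
proof -
  have "fin_diff r (t *\<^sub>R v) (\<lambda>z. f z - coord_poly r c z) = fin_diff r (t *\<^sub>R v) f" for t
    using assms(1) by (auto simp: fun_eq_iff fin_diff_diff fin_diff_coord_poly)
  then show ?thesis using assms(2) by (simp add: small_diffs_def)
qed

text \<open>From the square, the strip \<open>\<bar>y\<bar> \<le> 1\<close> is reached horizontally, and then everything above it. Below
  it, the vertical lines at \<open>-A - m / 2 \<le> x \<le> A\<close> meet \<open>G\<close> in the full height of the strip, since the
  upper boundary is concave; the rest is reached from them horizontally.\<close>

lemma body_approximation:
  assumes r: "1 \<le> r"
  defines "A \<equiv> 1 + 4 * (real r)\<^sup>2"
  shows "\<exists>C\<ge>0. \<forall>f \<epsilon> G m n. f \<in> mble \<longrightarrow> 0 \<le> \<epsilon> \<longrightarrow> G \<in> sets borel \<longrightarrow> convex G \<longrightarrow>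
     m \<in> {0..4 * A} \<longrightarrow> n \<in> {0..4 * A} \<longrightarrow>
     (-A, 3 * A) \<in> G \<longrightarrow> (3 * A, -A) \<in> G \<longrightarrow> (-A - m, -A) \<in> G \<longrightarrow> (-A, -A - n) \<in> G \<longrightarrow>
     G \<subseteq> {-A - m..3 * A} \<times> {-A - n..3 * A} \<longrightarrow> R G f < \<infinity> \<longrightarrow>
     small_diffs r G (1, 0) f \<epsilon> \<longrightarrow> small_diffs r G (0, 1) f \<epsilon> \<longrightarrow>
     (\<exists>c. R G (\<lambda>z. f z - coord_poly r c z) \<le> ennreal (C * \<epsilon>))"
proof -
  define B where "B = {-A..A} \<times> {-A..A}"
  have A1: "1 \<le> A" by (simp add: A_def)
  \<comment> \<open>As a natural number, \<open>3 * A\<close>. From the slab between -1 and 1 this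
    many widths lead to \<open>1 + 6 * A\<close>, beyond \<open>5 * A\<close>, the largest
    coordinate that occurs up to sign.\<close>
  define N where "N = 3 * (1 + 4 * r\<^sup>2)"
  have NA: "real N = 3 * A" by (simp add: N_def A_def)
  obtain C0 where C0: "0 \<le> C0" and square: "\<And>f \<epsilon>. f \<in> mble \<Longrightarrow> 0 \<le> \<epsilon> \<Longrightarrow> R B f < \<infinity> \<Longrightarrow>
     small_diffs r B (1, 0) f \<epsilon> \<Longrightarrow> small_diffs r B (0, 1) f \<epsilon> \<Longrightarrow>
     (\<exists>c. R Q (\<lambda>z. f z - coord_poly r c z) \<le> ennreal (C0 * \<epsilon>))"
    using square_approximation[OF r] unfolding A_def B_def by blast
  obtain C where C: "0 \<le> C" and slab: "\<And>f G W v \<phi> \<alpha> \<beta> \<epsilon> \<delta>. f \<in> mble \<Longrightarrow> G \<in> sets borel \<Longrightarrow> W \<in> sets borel \<Longrightarrow> W \<subseteq> G \<Longrightarrow>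
    small_diffs r G v f \<epsilon> \<Longrightarrow> 0 \<le> \<epsilon> \<Longrightarrow> 0 \<le> \<delta> \<Longrightarrow> \<phi> \<in> mble \<Longrightarrow>
    (\<forall>z t. \<phi> (z + t *\<^sub>R v) = \<phi> z + t) \<Longrightarrow> \<alpha> < \<beta> \<Longrightarrow>
    (\<forall>z\<in>W. \<beta> \<le> \<phi> z \<longrightarrow> (\<forall>t\<in>{0..\<phi> z - \<alpha>}. z - t *\<^sub>R v \<in> W)) \<Longrightarrow>
    R {z\<in>W. \<alpha> \<le> \<phi> z \<and> \<phi> z \<le> \<beta>} f \<le> ennreal \<delta> \<Longrightarrow>
    R {z\<in>W. \<alpha> \<le> \<phi> z \<and> \<phi> z \<le> \<beta> + real N * (\<beta> - \<alpha>)} f \<le> ennreal (C * (\<epsilon> + \<delta>))"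
    using slab_extension[OF r, of N] by blast
  define D1 where "D1 = C * (1 + C0)"
  define D2 where "D2 = D1 + D1"
  define D3 where "D3 = C * (1 + D2)"
  define D4 where "D4 = D2 + D3 + C * (1 + D2)"
  define D5 where "D5 = C * (1 + D4)"
  define D6 where "D6 = D4 + D5"
  define D7 where "D7 = D3 + D5 + D6"
  have D: "0 \<le> D1" "0 \<le> D2" "0 \<le> D3" "0 \<le> D4" "0 \<le> D5" "0 \<le> D6" "0 \<le> D7"
    using C C0 by (simp_all add: D1_def D2_def D3_def D4_def D5_def D6_def D7_def)
  show ?thesis
  proof (intro exI[of _ D7] conjI allI impI D)
    fix f \<epsilon> G m n
    assume f[measurable]: "f \<in> mble" and \<epsilon>: "0 \<le> \<epsilon>" and G[measurable]: "G \<in> sets borel" and cvx: "convex G"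
      and m: "m \<in> {0..4 * A}" and n: "n \<in> {0..4 * A}"
      and top: "(-A, 3 * A) \<in> G" and right: "(3 * A, -A) \<in> G"
      and left: "(-A - m, -A) \<in> G" and bot: "(-A, -A - n) \<in> G"
      and Gsub: "G \<subseteq> {-A - m..3 * A} \<times> {-A - n..3 * A}" and fin: "R G f < \<infinity>"
      and sd1: "small_diffs r G (1, 0) f \<epsilon>" and sd2: "small_diffs r G (0, 1) f \<epsilon>"
    note hor = convex_horizontal[OF cvx] and ver = convex_vertical[OF cvx]
    have bounds: "-A - m \<le> x" "x \<le> 3 * A" "-A - n \<le> y" "y \<le> 3 * A" if "(x, y) \<in> G" for x y
      using that Gsub by auto
    have hchord: "(x, -A) \<in> G" if "-A - m \<le> x" "x \<le> 3 * A" for x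
      by (rule hor[OF left right]) (use that in auto)
    have vchord: "(-A, y) \<in> G" if "-A - n \<le> y" "y \<le> 3 * A" for y
      by (rule ver[OF bot top]) (use that in auto)
    \<comment> \<open>With the chords crossing at \<open>(-A, -A)\<close> and their longer parts
      ending at \<open>3 * A\<close>, the midpoints of the segments from the top end to the left and
      right ends have height \<open>A\<close>. The segment between them lies above the horizontal
      chord, which gives \<open>strip\<close> and in particular the square \<open>B\<close>.\<close>
    have "(1 / 2) *\<^sub>R (-A - m, -A) + (1 / 2) *\<^sub>R (-A, 3 * A) \<in> G"
      by (rule convexD[OF cvx left top]) auto
    moreover have "(1 / 2) *\<^sub>R (-A - m, -A) + (1 / 2) *\<^sub>R (-A, 3 * A) = (-A - m / 2, A)"
      by simp (simp add: field_simps)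
    ultimately have UL: "(-A - m / 2, A) \<in> G" by simp
    have "(1 / 2) *\<^sub>R (3 * A, -A) + (1 / 2) *\<^sub>R (-A, 3 * A) \<in> G"
      by (rule convexD[OF cvx right top]) auto
    then have UR: "(A, A) \<in> G" by (simp add: field_simps)
    have strip: "(x, y) \<in> G" if "-A - m / 2 \<le> x" "x \<le> A" "-A \<le> y" "y \<le> A" for x y
      by (rule ver[OF hchord hor[OF UL UR]]) (use that m A1 in auto)
    have BG: "B \<subseteq> G" using strip m by (auto simp: B_def)
    have Bm: "B \<in> sets borel" unfolding B_def by (rule sets_borel_box)
    have "R B f \<le> R G f" using BG Bm by (intro mono) auto
    then have "R B f < \<infinity>" using fin by (rule le_less_trans)
    then obtain c where c: "R Q (\<lambda>z. f z - coord_poly r c z) \<le> ennreal (C0 * \<epsilon>)"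
      using square[OF f \<epsilon>] small_diffs_subset[OF sd1 BG Bm G f] small_diffs_subset[OF sd2 BG Bm G f] by blast
    define g where "g = (\<lambda>z. f z - coord_poly r c z)"
    have g[measurable]: "g \<in> mble" unfolding g_def by measurable
    have gQ: "R Q g \<le> ennreal (C0 * \<epsilon>)" using c by (simp add: g_def)
    have sd: "small_diffs r G v g \<epsilon>" if "v \<in> {(1, 0), (-1, 0), (0, 1), (0, -1)}" for v
    proof -
      have "small_diffs r G (1, 0) g \<epsilon>" "small_diffs r G (0, 1) g \<epsilon>"
        unfolding g_def using sd1 sd2 by (auto intro: small_diffs_coord_poly)
      then show ?thesis using that small_diffs_minus[of r G "(1, 0)"] small_diffs_minus[of r G "(0, 1)"] by auto
    qed
    have fsm[measurable]: "fst \<in> mble" "snd \<in> mble"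
      by (intro borel_measurable_continuous_onI continuous_intros)+
    have Gp: "{z\<in>G. p z} = G \<inter> {z\<in>space borel. p z}" for p by auto
    have sub[measurable]: "{z\<in>G. a \<le> fst z \<and> fst z \<le> b \<and> a' \<le> snd z \<and> snd z \<le> b'} \<in> sets borel" for a b a' b'
      unfolding Gp by measurable
    define G' where "G' a b a' b' = {z\<in>G. a \<le> fst z \<and> fst z \<le> b \<and> a' \<le> snd z \<and> snd z \<le> b'}" for a b a' b'
    have G'm[measurable]: "G' a b a' b' \<in> sets borel" for a b a' b' unfolding G'_def by (rule sub)
    let ?strip = "G' (-A - m) (3 * A) (-1) 1" and ?upper = "G' (-A - m) (3 * A) (-1) (3 * A)"
      and ?mid = "G' (-A - m / 2) A (-A - n) (3 * A)" and ?lower = "G' (-A - m) (3 * A) (-A - n) (-1)"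
      and ?corner = "G' (-A - m) (-A) (-A - n) (-1)"
    have extend: "R T g \<le> ennreal (C * (1 + d) * \<epsilon>)"
      if v: "v \<in> {(1, 0), (-1, 0), (0, 1), (0, -1)}" and "W \<in> sets borel" "W \<subseteq> G" "\<phi> \<in> mble"
        "\<And>z t. \<phi> (z + t *\<^sub>R v) = \<phi> z + t" "\<alpha> < \<beta>"
        and inv: "\<And>z t. z \<in> W \<Longrightarrow> \<beta> \<le> \<phi> z \<Longrightarrow> 0 \<le> t \<Longrightarrow> t \<le> \<phi> z - \<alpha> \<Longrightarrow> z - t *\<^sub>R v \<in> W"
        and K: "K \<in> sets borel" "R K g \<le> ennreal (d * \<epsilon>)" "0 \<le> d" "\<And>z. z \<in> W \<Longrightarrow> \<alpha> \<le> \<phi> z \<Longrightarrow> \<phi> z \<le> \<beta> \<Longrightarrow> z \<in> K"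
        and T: "T \<in> sets borel" "\<And>z. z \<in> T \<Longrightarrow> z \<in> W \<and> \<alpha> \<le> \<phi> z \<and> \<phi> z \<le> \<beta> + 3 * A * (\<beta> - \<alpha>)"
      for v W \<phi> \<alpha> \<beta> K T d
    proof -
      note [measurable] = that(2,4) K(1) T(1)
      have Wp: "{z\<in>W. p z} = W \<inter> {z\<in>space borel. p z}" for p by auto
      have m1: "{z\<in>W. \<alpha> \<le> \<phi> z \<and> \<phi> z \<le> \<beta>} \<in> sets borel"
        "{z\<in>W. \<alpha> \<le> \<phi> z \<and> \<phi> z \<le> \<beta> + 3 * A * (\<beta> - \<alpha>)} \<in> sets borel"
        unfolding Wp by measurable
      have "R {z\<in>W. \<alpha> \<le> \<phi> z \<and> \<phi> z \<le> \<beta>} g \<le> R K g"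
        by (rule mono[OF m1(1) K(1) g g]) (use K(4) in auto)
      then have "R {z\<in>W. \<alpha> \<le> \<phi> z \<and> \<phi> z \<le> \<beta>} g \<le> ennreal (d * \<epsilon>)" using K(2) by (rule order_trans)
      then have "R {z\<in>W. \<alpha> \<le> \<phi> z \<and> \<phi> z \<le> \<beta> + real N * (\<beta> - \<alpha>)} g \<le> ennreal (C * (\<epsilon> + d * \<epsilon>))"
        using that \<epsilon> by (intro slab[OF g G _ _ sd[OF v]]) auto
      moreover have "R T g \<le> R {z\<in>W. \<alpha> \<le> \<phi> z \<and> \<phi> z \<le> \<beta> + 3 * A * (\<beta> - \<alpha>)} g"
        by (rule mono[OF T(1) m1(2) g g]) (use T(2) in auto)
      ultimately show ?thesis by (simp add: NA algebra_simps)
    qed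
    have join: "R S g \<le> ennreal ((d + e) * \<epsilon>)"
      if "R K g \<le> ennreal (d * \<epsilon>)" "R L g \<le> ennreal (e * \<epsilon>)" "0 \<le> d" "0 \<le> e"
        "K \<in> sets borel" "L \<in> sets borel" "S \<in> sets borel" "S \<subseteq> K \<union> L" for K L S d e
    proof -
      have "R S g \<le> R (K \<union> L) g" using that by (intro mono) auto
      also have "\<dots> \<le> R K g + R L g" using that by (intro union) auto
      also have "\<dots> \<le> ennreal (d * \<epsilon>) + ennreal (e * \<epsilon>)" using that by (intro add_mono) auto
      also have "\<dots> = ennreal ((d + e) * \<epsilon>)" using that \<epsilon> by (simp add: algebra_simps)
      finally show ?thesis .
    qed
    have A2: "A \<le> 3 * A" "5 * A \<le> 1 + 3 * A * 2" using A1 by auto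
    have A3: "A + m \<le> 5 * A" "A + n \<le> 5 * A" using m n by auto
    have AA: "3 * A * (A - - A) \<ge> 2 * A"
      using mult_mono[of 1 "3 * A" "2 * A" "2 * A"] A1 by (simp add: mult_ac)
    have s1: "R (G' (-1) (3 * A) (-1) 1) g \<le> ennreal (D1 * \<epsilon>)" unfolding D1_def
    proof (rule extend[where v="(1, 0)" and \<phi>=fst and \<alpha>="-1" and \<beta>=1 and K=Q and W="?strip"])
      fix z :: "plane" and t assume z: "z \<in> ?strip" "1 \<le> fst z" "0 \<le> t" "t \<le> fst z - - 1"
      obtain x y where xy: "z = (x, y)" by (cases z)
      have "(x - t, y) \<in> G"
        by (rule hor[OF strip[of "-1" y]]) (use z xy A1 m in \<open>auto simp: G'_def\<close>)
      then show "z - t *\<^sub>R (1, 0) \<in> ?strip"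
        using z xy bounds by (auto simp: G'_def)
    qed (use gQ C0 A1 A2 A3 m in \<open>auto simp: G'_def\<close>)
    have s2: "R (G' (-A - m) 1 (-1) 1) g \<le> ennreal (D1 * \<epsilon>)" unfolding D1_def
    proof (rule extend[where v="(-1, 0)" and \<phi>="\<lambda>z. - fst z" and \<alpha>="-1" and \<beta>=1 and K=Q and W="?strip"])
      fix z :: "plane" and t assume z: "z \<in> ?strip" "1 \<le> - fst z" "0 \<le> t" "t \<le> - fst z - - 1"
      obtain x y where xy: "z = (x, y)" by (cases z)
      have "(x + t, y) \<in> G"
        by (rule hor[OF _ strip[of 1 y]]) (use z xy A1 m in \<open>auto simp: G'_def\<close>)
      then show "z - t *\<^sub>R (-1, 0) \<in> ?strip"
        using z xy bounds by (auto simp: G'_def)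
    qed (use gQ C0 A1 A2 A3 m in \<open>auto simp: G'_def\<close>)
    have s12: "R ?strip g \<le> ennreal (D2 * \<epsilon>)" unfolding D2_def
      by (rule join[OF s1 s2 D(1) D(1)]) (auto simp: G'_def)
    have s3: "R ?upper g \<le> ennreal (D3 * \<epsilon>)" unfolding D3_def
    proof (rule extend[where v="(0, 1)" and \<phi>=snd and \<alpha>="-1" and \<beta>=1 and W=G, OF _ _ _ _ _ _ _ _ s12])
      fix z :: "plane" and t assume z: "z \<in> G" "1 \<le> snd z" "0 \<le> t" "t \<le> snd z - - 1"
      obtain x y where xy: "z = (x, y)" by (cases z)
      have "(x, y - t) \<in> G"
        by (rule ver[OF hchord[of x]]) (use z xy A1 bounds in auto)
      then show "z - t *\<^sub>R (0, 1) \<in> G" using xy by simp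
    qed (use D A1 A2 bounds in \<open>auto simp: G'_def\<close>)
    have s4: "R (G' (-A - m / 2) A (-A - n) 1) g \<le> ennreal (C * (1 + D2) * \<epsilon>)"
    proof (rule extend[where v="(0, -1)" and \<phi>="\<lambda>z. - snd z" and \<alpha>="-1" and \<beta>=1 and W="?mid",
          OF _ _ _ _ _ _ _ _ s12])
      fix z :: "plane" and t assume z: "z \<in> ?mid" "1 \<le> - snd z" "0 \<le> t" "t \<le> - snd z - - 1"
      obtain x y where xy: "z = (x, y)" by (cases z)
      have "(x, y + t) \<in> G"
        by (rule ver[OF _ strip[of x 1]]) (use z xy A1 in \<open>auto simp: G'_def\<close>)
      then show "z - t *\<^sub>R (0, -1) \<in> ?mid"
        using xy z A1 by (auto simp: G'_def)
    qed (use D A1 A2 A3 m bounds in \<open>auto simp: G'_def\<close>)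
    have s4': "R ?mid g \<le> ennreal (D4 * \<epsilon>)" unfolding D4_def
    proof (rule join[OF _ s4])
      show "R ?upper g \<le> ennreal ((D2 + D3) * \<epsilon>)"
        using s3 D \<epsilon> by (elim order_trans) (intro ennreal_leI mult_right_mono, auto)
    qed (use D C m in \<open>auto simp: G'_def\<close>)
    \<comment> \<open>Below the strip the vertical chord still meets every height, so a move to the
      left may go as far as \<open>x = -A\<close> without leaving \<open>G\<close>. The starting
      slab between \<open>-A\<close> and \<open>A\<close> belongs to the part already
      treated.\<close>
    have s5: "R (G' (-A) (3 * A) (-A - n) (-1)) g \<le> ennreal (D5 * \<epsilon>)" unfolding D5_def
    proof (rule extend[where v="(1, 0)" and \<phi>=fst and \<alpha>="-A" and \<beta>=A and W="?lower",
          OF _ _ _ _ _ _ _ _ s4'])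
      fix z :: "plane" and t assume z: "z \<in> ?lower" "A \<le> fst z" "0 \<le> t" "t \<le> fst z - - A"
      obtain x y where xy: "z = (x, y)" by (cases z)
      have "(x - t, y) \<in> G"
        by (rule hor[OF vchord[of y]]) (use z xy A1 in \<open>auto simp: G'_def\<close>)
      then show "z - t *\<^sub>R (1, 0) \<in> ?lower"
        using xy z bounds by (auto simp: G'_def)
    next
      fix z assume "z \<in> G' (-A) (3 * A) (-A - n) (-1)"
      then show "z \<in> ?lower \<and> -A \<le> fst z \<and> fst z \<le> A + 3 * A * (A - - A)"
        using AA m by (auto simp: G'_def)
    qed (use D A1 m in \<open>auto simp: G'_def\<close>)
    have s6: "R ?corner g \<le> ennreal (D6 * \<epsilon>)"
    \<comment> \<open>For \<open>m = 0\<close> a slab to the left of the vertical chord would have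
      width 0. The corner then lies on the line \<open>x = -A\<close>, which is already covered.
      Otherwise the slab has width \<open>m / 2\<close>, and a single further width
      suffices.\<close>
    proof (cases "m = 0")
      case True
      have "R ?corner g \<le> R ?mid g"
        using True A1 by (intro mono) (auto simp: G'_def)
      then have "R ?corner g \<le> ennreal (D4 * \<epsilon>)" using s4' by (rule order_trans)
      then show ?thesis using D \<epsilon> by (elim order_trans) (intro ennreal_leI mult_right_mono, auto simp: D6_def)
    next
      case False
      have mm: "m / 2 \<le> 3 * A * (m / 2)"
        using mult_right_mono[of 1 "3 * A" "m / 2"] A1 m by simp
      have "R ?corner g \<le> ennreal (D5 * \<epsilon>)" unfolding D5_def
      proof (rule extend[where v="(-1, 0)" and \<phi>="\<lambda>z. - fst z" and \<alpha>=A and \<beta>="A + m / 2" and W="?lower",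
          OF _ _ _ _ _ _ _ _ s4'])
        fix z :: "plane" and t assume z: "z \<in> ?lower" "A + m / 2 \<le> - fst z" "0 \<le> t" "t \<le> - fst z - A"
        obtain x y where xy: "z = (x, y)" by (cases z)
        have "(x + t, y) \<in> G"
          by (rule hor[OF _ vchord[of y]]) (use z xy A1 in \<open>auto simp: G'_def\<close>)
        then show "z - t *\<^sub>R (-1, 0) \<in> ?lower"
          using xy z bounds by (auto simp: G'_def)
      next
        fix z assume "z \<in> ?corner"
        then show "z \<in> ?lower \<and> A \<le> - fst z \<and> - fst z \<le> A + m / 2 + 3 * A * (A + m / 2 - A)"
          using mm A1 by (auto simp: G'_def)
      qed (use D A1 m False in \<open>auto simp: G'_def\<close>)
      then show ?thesis using D \<epsilon> by (elim order_trans) (intro ennreal_leI mult_right_mono, auto simp: D6_def)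
    qed
    have s35: "R (?upper \<union> G' (-A) (3 * A) (-A - n) (-1)) g \<le> ennreal ((D3 + D5) * \<epsilon>)"
      by (rule join[OF s3 s5]) (use D in auto)
    have "R G g \<le> ennreal (D7 * \<epsilon>)" unfolding D7_def
    proof (rule join[OF s35 s6])
      show "G \<subseteq> (?upper \<union> G' (-A) (3 * A) (-A - n) (-1)) \<union> ?corner"
        using bounds by (fastforce simp: G'_def)
    qed (use D in auto)
    then show "\<exists>c. R G (\<lambda>z. f z - coord_poly r c z) \<le> ennreal (D7 * \<epsilon>)"
      unfolding g_def by blast
  qed
qed

end

section \<open>The two gauges\<close>

lemma nn_integral_lborel_shift:
  fixes F :: "'a::euclidean_space \<Rightarrow> ennreal"
  assumes "F \<in> borel_measurable borel"
  shows "(\<integral>\<^sup>+z. F (z + w) \<partial>lborel) = (\<integral>\<^sup>+z. F z \<partial>lborel)"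
proof -
  have "(\<integral>\<^sup>+z. F z \<partial>lborel) = (\<integral>\<^sup>+z. F z \<partial>distr lborel borel ((+) w))"
    by (simp add: lborel_distr_plus)
  also have "\<dots> = (\<integral>\<^sup>+z. F (w + z) \<partial>lborel)"
    using assms by (intro nn_integral_distr) auto
  finally show ?thesis by (simp add: add.commute)
qed

lemma nn_integral_lborel_swap:
  fixes F :: "plane \<Rightarrow> ennreal"
  assumes [measurable]: "F \<in> borel_measurable borel"
  shows "(\<integral>\<^sup>+z. F (prod.swap z) \<partial>lborel) = (\<integral>\<^sup>+z. F z \<partial>lborel)"
proof -
  have F: "F \<in> borel_measurable (lborel \<Otimes>\<^sub>M lborel)"
    using assms by (simp add: lborel_prod)
  have "(\<integral>\<^sup>+z. F z \<partial>(lborel \<Otimes>\<^sub>M lborel)) = (\<integral>\<^sup>+z. F z \<partial>distr (lborel \<Otimes>\<^sub>M lborel) (lborel \<Otimes>\<^sub>M lborel) (\<lambda>(x, y). (y, x)))"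
    using lborel_pair.distr_pair_swap[where 'a=real and 'b=real] by simp
  also have "\<dots> = (\<integral>\<^sup>+z. F ((\<lambda>(x, y). (y, x)) z) \<partial>(lborel \<Otimes>\<^sub>M lborel))"
    by (rule nn_integral_distr[OF measurable_pair_swap']) (use F in simp)
  finally show ?thesis by (simp add: lborel_prod prod.swap_def case_prod_unfold)
qed

lemma exists_le_average:
  fixes I :: "real \<Rightarrow> ennreal"
  assumes [measurable]: "I \<in> borel_measurable borel" and "a < b"
    and I: "(\<integral>\<^sup>+x. I x * indicator {a..b} x \<partial>lborel) \<le> ennreal (b - a) * e"
  shows "\<exists>x\<in>{a..b}. I x \<le> e"
proof (rule ccontr)
  assume "\<not> ?thesis"
  then have less: "e < I x" if "x \<in> {a..b}" for x using that by (auto simp: not_le)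
  \<comment> \<open>Finiteness of \<open>e\<close> is what makes the comparison of the two integrals
    strict.\<close>
  then have e: "e < \<infinity>" using \<open>a < b\<close> less_le_trans[of e "I a" \<infinity>] by simp
  have const: "(\<integral>\<^sup>+x. e * indicator {a..b} x \<partial>lborel) = ennreal (b - a) * e"
    using \<open>a < b\<close> by (simp add: nn_integral_cmult_indicator mult.commute)
  have "(\<integral>\<^sup>+x. e * indicator {a..b} x \<partial>lborel) < (\<integral>\<^sup>+x. I x * indicator {a..b} x \<partial>lborel)"
  proof (rule nn_integral_less)
    show "(\<integral>\<^sup>+x. e * indicator {a..b} x \<partial>lborel) \<noteq> \<infinity>"
      unfolding const using e by (simp add: ennreal_mult_eq_top_iff)
    show "AE x in lborel. e * indicator {a..b} x \<le> I x * indicator {a..b} x"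
      using less by (auto simp: indicator_def intro: less_imp_le)
    show "\<not> (AE x in lborel. I x * indicator {a..b} x \<le> e * indicator {a..b} x)"
    proof
      assume "AE x in lborel. I x * indicator {a..b} x \<le> e * indicator {a..b} x"
      then have "AE x in lborel. x \<notin> {a..b}"
        by eventually_elim (use less in \<open>force simp: indicator_def not_le[symmetric] split: if_splits\<close>)
      then have "{a..b} \<in> null_sets lborel" using AE_iff_null_sets[of "{a..b}" lborel] by auto
      then have "emeasure lborel {a..b} = 0" by auto
      then show False using \<open>a < b\<close> by simp
    qed
  qed auto
  then show False using I by (simp add: const)
qed

text \<open>Average over the line. With \<open>x = fst z + t\<close> the mean over \<open>x\<close>
  becomes one over shifts with \<open>\<bar>t\<bar> \<le> 2\<close>; their range has length 4 and
  that of \<open>x\<close> has length 2, whence the factor 2. An arbitrary even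
  \<open>\<phi>\<close> covers both \<open>\<bar>u\<bar> powr p\<close> and the indicator of
  \<open>\<bar>u\<bar>\<close> exceeding a level.\<close>

lemma exists_good_translate:
  fixes f :: "plane \<Rightarrow> real" and \<phi> :: "real \<Rightarrow> ennreal"
  assumes [measurable]: "f \<in> mble" "\<phi> \<in> borel_measurable borel"
    and even: "\<And>u. \<phi> (- u) = \<phi> u"
    and small: "\<And>t. \<bar>t\<bar> \<le> 2 \<Longrightarrow>
      (\<integral>\<^sup>+z\<in>Q. \<phi> (f (z + (t, 0)) - f z) \<partial>lborel) \<le> e"
  shows "\<exists>x\<in>{-1..1}. (\<integral>\<^sup>+z\<in>Q. \<phi> (f z - f (x, snd z)) \<partial>lborel) \<le> 2 * e"
proof (rule exists_le_average)
  have [measurable]: "Q \<in> sets borel" by (intro borel_closed closed_Times) auto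
  have [measurable]: "fst \<in> borel_measurable (borel :: plane measure)" "snd \<in> borel_measurable (borel :: plane measure)"
    by (intro borel_measurable_continuous_onI continuous_intros)+
  show "(\<lambda>x. \<integral>\<^sup>+z\<in>Q. \<phi> (f z - f (x, snd z)) \<partial>lborel) \<in> borel_measurable borel"
    by measurable
  have "(\<integral>\<^sup>+x. (\<integral>\<^sup>+z\<in>Q. \<phi> (f z - f (x, snd z)) \<partial>lborel) * indicator {-1..1} x \<partial>lborel) =
      (\<integral>\<^sup>+x. \<integral>\<^sup>+z. \<phi> (f z - f (x, snd z)) * indicator Q z * indicator {-1..1} x \<partial>lborel \<partial>lborel)"
    by (intro nn_integral_cong nn_integral_multc[symmetric]) measurable
  also have "\<dots> = (\<integral>\<^sup>+z. \<integral>\<^sup>+x. \<phi> (f z - f (x, snd z)) * indicator Q z * indicator {-1..1} x \<partial>lborel \<partial>lborel)"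
    by (rule lborel_pair.Fubini') measurable
  also have "\<dots> \<le> (\<integral>\<^sup>+z. \<integral>\<^sup>+t. \<phi> (f (z + (t, 0)) - f z) * indicator Q z * indicator {-2..2} t \<partial>lborel \<partial>lborel)"
  proof (rule nn_integral_mono)
    fix z :: "plane"
    have "(\<integral>\<^sup>+x. \<phi> (f z - f (x, snd z)) * indicator Q z * indicator {-1..1} x \<partial>lborel) =
      (\<integral>\<^sup>+t. \<phi> (f z - f (t + fst z, snd z)) * indicator Q z * indicator {-1..1} (t + fst z) \<partial>lborel)"
      by (rule nn_integral_lborel_shift[symmetric]) measurable
    also have "\<dots> \<le> (\<integral>\<^sup>+t. \<phi> (f (z + (t, 0)) - f z) * indicator Q z * indicator {-2..2} t \<partial>lborel)"
    proof (rule nn_integral_mono)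
      fix t
      have 1: "(t + fst z, snd z) = z + (t, 0)" by (cases z) simp
      have 2: "\<phi> (f z - f (z + (t, 0))) = \<phi> (f (z + (t, 0)) - f z)"
        using even[of "f z - f (z + (t, 0))"] by simp
      show "\<phi> (f z - f (t + fst z, snd z)) * indicator Q z * indicator {-1..1} (t + fst z)
        \<le> \<phi> (f (z + (t, 0)) - f z) * indicator Q z * indicator {-2..2} t"
        unfolding 1 2 by (cases z) (auto simp: indicator_def)
    qed
    finally show "(\<integral>\<^sup>+x. \<phi> (f z - f (x, snd z)) * indicator Q z * indicator {-1..1} x \<partial>lborel) \<le>
      (\<integral>\<^sup>+t. \<phi> (f (z + (t, 0)) - f z) * indicator Q z * indicator {-2..2} t \<partial>lborel)" .
  qed
  also have "\<dots> = (\<integral>\<^sup>+t. \<integral>\<^sup>+z. \<phi> (f (z + (t, 0)) - f z) * indicator Q z * indicator {-2..2} t \<partial>lborel \<partial>lborel)"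
    by (rule lborel_pair.Fubini'[symmetric]) measurable
  also have "\<dots> = (\<integral>\<^sup>+t. (\<integral>\<^sup>+z\<in>Q. \<phi> (f (z + (t, 0)) - f z) \<partial>lborel) * indicator {-2..2} t \<partial>lborel)"
    by (intro nn_integral_cong nn_integral_multc) measurable
  also have "\<dots> \<le> (\<integral>\<^sup>+t. e * indicator {-2..2::real} t \<partial>lborel)"
    by (intro nn_integral_mono) (use small in \<open>auto simp: indicator_def\<close>)
  also have "\<dots> = e * 4" by (simp add: nn_integral_cmult_indicator)
  also have "\<dots> = (2 * 2) * e" by (simp add: mult.commute)
  also have "\<dots> = ennreal (1 - -1) * (2 * e)" by (simp only: mult.assoc) simp
  finally show "(\<integral>\<^sup>+x. (\<integral>\<^sup>+z\<in>Q. \<phi> (f z - f (x, snd z)) \<partial>lborel) * indicator {-1..1} x \<partial>lborel)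
    \<le> ennreal (1 - -1) * (2 * e)" .
qed simp

text \<open>By Fubini the integral over \<open>Q\<close> is the integral over \<open>x\<close> of
  the one-dimensional integrals along the lines. Extending a line constantly over \<open>Q\<close>
  doubles its integral, and choosing within \<open>{a..b}\<close> divides by
  \<open>b - a\<close>.\<close>

lemma exists_good_section:
  fixes f :: "plane \<Rightarrow> real" and \<phi> :: "real \<Rightarrow> ennreal"
  assumes [measurable]: "f \<in> mble" "\<phi> \<in> borel_measurable borel"
    and ab: "-1 \<le> a" "a < b" "b \<le> 1"
    and small: "(\<integral>\<^sup>+z\<in>Q. \<phi> (f z) \<partial>lborel) \<le> e"
  shows "\<exists>x\<in>{a..b}. (\<integral>\<^sup>+z\<in>Q. \<phi> (f (x, snd z)) \<partial>lborel) \<le> ennreal (2 / (b - a)) * e"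
proof (rule exists_le_average)
  let ?I = "{-1..1} :: real set"
  have [measurable]: "Q \<in> sets borel" by (intro borel_closed closed_Times) auto
  have [measurable]: "fst \<in> borel_measurable (borel :: plane measure)" "snd \<in> borel_measurable (borel :: plane measure)"
    by (intro borel_measurable_continuous_onI continuous_intros)+
  have ind: "indicator Q (x, y) = (indicator ?I x * indicator ?I y :: ennreal)" for x y
    by (auto simp: indicator_def)
  show "(\<lambda>x. \<integral>\<^sup>+z\<in>Q. \<phi> (f (x, snd z)) \<partial>lborel) \<in> borel_measurable borel"
    by measurable
  have sec: "(\<integral>\<^sup>+z\<in>Q. \<phi> (f (x, snd z)) \<partial>lborel) = 2 * (\<integral>\<^sup>+y. \<phi> (f (x, y)) * indicator ?I y \<partial>lborel)" for x
  proof -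
    have "(\<integral>\<^sup>+z\<in>Q. \<phi> (f (x, snd z)) \<partial>lborel) =
       (\<integral>\<^sup>+x'. \<integral>\<^sup>+y. \<phi> (f (x, y)) * indicator Q (x', y) \<partial>lborel \<partial>lborel)"
      unfolding lborel_prod[symmetric] by (subst lborel.nn_integral_fst[symmetric]) (auto simp: lborel_prod)
    also have "\<dots> = (\<integral>\<^sup>+x'. (\<integral>\<^sup>+y. \<phi> (f (x, y)) * indicator ?I y \<partial>lborel) * indicator ?I x' \<partial>lborel)"
      by (subst nn_integral_multc[symmetric]) (auto simp: ind mult_ac)
    also have "\<dots> = 2 * (\<integral>\<^sup>+y. \<phi> (f (x, y)) * indicator ?I y \<partial>lborel)"
      by (subst nn_integral_cmult) (auto simp: mult.commute)
    finally show ?thesis .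
  qed
  have "(\<integral>\<^sup>+x. (\<integral>\<^sup>+z\<in>Q. \<phi> (f (x, snd z)) \<partial>lborel) * indicator {a..b} x \<partial>lborel)
      \<le> (\<integral>\<^sup>+x. 2 * (\<integral>\<^sup>+y. \<phi> (f (x, y)) * indicator ?I y \<partial>lborel) * indicator ?I x \<partial>lborel)"
    unfolding sec using ab by (intro nn_integral_mono) (auto simp: indicator_def)
  also have "\<dots> = 2 * (\<integral>\<^sup>+x. (\<integral>\<^sup>+y. \<phi> (f (x, y)) * indicator ?I y \<partial>lborel) * indicator ?I x \<partial>lborel)"
    unfolding mult.assoc by (rule nn_integral_cmult) measurable
  also have "(\<integral>\<^sup>+x. (\<integral>\<^sup>+y. \<phi> (f (x, y)) * indicator ?I y \<partial>lborel) * indicator ?I x \<partial>lborel) =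
     (\<integral>\<^sup>+x. \<integral>\<^sup>+y. \<phi> (f (x, y)) * indicator Q (x, y) \<partial>lborel \<partial>lborel)"
    by (subst nn_integral_multc[symmetric]) (auto simp: ind mult_ac)
  also have "\<dots> = (\<integral>\<^sup>+z\<in>Q. \<phi> (f z) \<partial>lborel)"
    unfolding lborel_prod[symmetric] by (subst lborel.nn_integral_fst[symmetric]) (auto simp: lborel_prod)
  also have "2 * (\<integral>\<^sup>+z\<in>Q. \<phi> (f z) \<partial>lborel) \<le> 2 * e"
    using small by (rule mult_left_mono) simp
  also have "2 * e = ennreal (b - a) * (ennreal (2 / (b - a)) * e)"
  proof -
    have "ennreal (b - a) * ennreal (2 / (b - a)) = ennreal ((b - a) * (2 / (b - a)))"
      using ab by (intro ennreal_mult[symmetric]) auto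
    also have "(b - a) * (2 / (b - a)) = 2" using ab by (simp only: times_divide_eq_right nonzero_mult_div_cancel_left)
    finally show ?thesis by (simp flip: mult.assoc)
  qed
  finally show "(\<integral>\<^sup>+x. (\<integral>\<^sup>+z\<in>Q. \<phi> (f (x, snd z)) \<partial>lborel) * indicator {a..b} x \<partial>lborel)
    \<le> ennreal (b - a) * (ennreal (2 / (b - a)) * e)" .
qed (use ab in auto)

definition Lp_integral :: "real \<Rightarrow> plane set \<Rightarrow> (plane \<Rightarrow> real) \<Rightarrow> ennreal" where
  "Lp_integral P S f = (\<integral>\<^sup>+z\<in>S. ennreal (\<bar>f z\<bar> powr P) \<partial>lborel)"

definition sup_norm_on :: "plane set \<Rightarrow> (plane \<Rightarrow> real) \<Rightarrow> ennreal" where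
  "sup_norm_on S f = esssup lborel (\<lambda>z. ennreal \<bar>f z\<bar> * indicator S z)"

text \<open>Either \<open>\<bar>y\<bar> \<le> \<kappa> * \<bar>x\<bar>\<close> or the opposite
  holds, and in each case one term alone dominates. No convexity is involved, so this holds for
  exponents below 1 as well.\<close>

lemma powr_abs_add_le:
  fixes x y :: real
  assumes "0 < P" "0 < \<kappa>"
  shows "\<bar>x + y\<bar> powr P \<le> (1 + \<kappa>) powr P * \<bar>x\<bar> powr P + (1 + 1 / \<kappa>) powr P * \<bar>y\<bar> powr P"
proof (cases "\<bar>y\<bar> \<le> \<kappa> * \<bar>x\<bar>")
  case True
  then have "\<bar>x + y\<bar> \<le> (1 + \<kappa>) * \<bar>x\<bar>" by (simp add: algebra_simps)
  then have "\<bar>x + y\<bar> powr P \<le> ((1 + \<kappa>) * \<bar>x\<bar>) powr P" using assms by (intro powr_mono2) auto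
  then show ?thesis using assms by (simp add: powr_mult add_increasing2)
next
  case False
  then have "\<bar>x\<bar> \<le> (1 / \<kappa>) * \<bar>y\<bar>" using assms by (simp add: field_simps)
  then have "\<bar>x + y\<bar> \<le> (1 + 1 / \<kappa>) * \<bar>y\<bar>" by (simp add: algebra_simps)
  then have "\<bar>x + y\<bar> powr P \<le> ((1 + 1 / \<kappa>) * \<bar>y\<bar>) powr P" using assms by (intro powr_mono2) auto
  then show ?thesis using assms by (simp add: powr_mult add_increasing)
qed

lemma lp_gauge_Lp_integral:
  assumes P: "0 < P"
  shows "lp_gauge (Lp_integral P) P"
proof
  show "0 < P" by fact
  note [measurable] = sets_borel_box
  fix S T :: "plane set" and f g :: "plane \<Rightarrow> real"
  show "Lp_integral P S f \<le> Lp_integral P T g"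
    if "S \<subseteq> T" "\<And>z. z \<in> S \<Longrightarrow> \<bar>f z\<bar> \<le> \<bar>g z\<bar>"
    unfolding Lp_integral_def using that P
    by (intro nn_integral_mono) (auto simp: indicator_def intro!: ennreal_leI powr_mono2)
  show "Lp_integral P (S \<union> T) f \<le> Lp_integral P S f + Lp_integral P T f"
    if [measurable]: "S \<in> sets borel" "T \<in> sets borel" "f \<in> mble"
    unfolding Lp_integral_def
    by (subst nn_integral_add[symmetric]) (auto intro!: nn_integral_mono simp: indicator_def)
  show "Lp_integral P S (\<lambda>z. c * f z) = ennreal (\<bar>c\<bar> powr P) * Lp_integral P S f"
    if [measurable]: "S \<in> sets borel" "f \<in> mble" for c
    unfolding Lp_integral_def
    by (subst nn_integral_cmult[symmetric]) (auto intro!: nn_integral_cong simp: abs_mult powr_mult ennreal_mult mult.assoc)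
  show "Lp_integral P S (\<lambda>z. f z + g z) \<le>
      ennreal ((1 + \<kappa>) powr P) * Lp_integral P S f + ennreal ((1 + 1 / \<kappa>) powr P) * Lp_integral P S g"
    if [measurable]: "S \<in> sets borel" "f \<in> mble" "g \<in> mble" and \<kappa>: "0 < \<kappa>" for \<kappa>
  proof -
    have "Lp_integral P S (\<lambda>z. f z + g z) \<le> (\<integral>\<^sup>+z. ennreal ((1 + \<kappa>) powr P) * (ennreal (\<bar>f z\<bar> powr P) * indicator S z) +
       ennreal ((1 + 1 / \<kappa>) powr P) * (ennreal (\<bar>g z\<bar> powr P) * indicator S z) \<partial>lborel)"
      unfolding Lp_integral_def
    proof (rule nn_integral_mono)
      fix z
      have "ennreal (\<bar>f z + g z\<bar> powr P) \<le>
          ennreal ((1 + \<kappa>) powr P * \<bar>f z\<bar> powr P + (1 + 1 / \<kappa>) powr P * \<bar>g z\<bar> powr P)"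
        by (rule ennreal_leI) (rule powr_abs_add_le[OF P \<kappa>])
      then show "ennreal (\<bar>f z + g z\<bar> powr P) * indicator S z \<le>
         ennreal ((1 + \<kappa>) powr P) * (ennreal (\<bar>f z\<bar> powr P) * indicator S z) +
         ennreal ((1 + 1 / \<kappa>) powr P) * (ennreal (\<bar>g z\<bar> powr P) * indicator S z)"
        by (auto simp: indicator_def ennreal_mult)
    qed
    also have "\<dots> = ennreal ((1 + \<kappa>) powr P) * Lp_integral P S f + ennreal ((1 + 1 / \<kappa>) powr P) * Lp_integral P S g"
      unfolding Lp_integral_def by (subst nn_integral_add) (auto simp: nn_integral_cmult)
    finally show ?thesis .
  qed
  show "Lp_integral P S (\<lambda>z. f (z + w)) \<le> Lp_integral P T f"
    if [measurable]: "S \<in> sets borel" "T \<in> sets borel" "f \<in> mble" and "\<And>z. z \<in> S \<Longrightarrow> z + w \<in> T" for w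
  proof -
    have "Lp_integral P S (\<lambda>z. f (z + w)) \<le> (\<integral>\<^sup>+z. ennreal (\<bar>f (z + w)\<bar> powr P) * indicator T (z + w) \<partial>lborel)"
      unfolding Lp_integral_def using that(4) by (intro nn_integral_mono) (auto simp: indicator_def)
    also have "\<dots> = Lp_integral P T f"
      unfolding Lp_integral_def by (rule nn_integral_lborel_shift) measurable
    finally show ?thesis .
  qed
  show "Lp_integral P S (\<lambda>z. f (prod.swap z)) \<le> Lp_integral P T f"
    if [measurable]: "S \<in> sets borel" "T \<in> sets borel" "f \<in> mble" and "\<And>z. z \<in> S \<Longrightarrow> prod.swap z \<in> T"
  proof -
    have "Lp_integral P S (\<lambda>z. f (prod.swap z)) \<le> (\<integral>\<^sup>+z. ennreal (\<bar>f (prod.swap z)\<bar> powr P) * indicator T (prod.swap z) \<partial>lborel)"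
      unfolding Lp_integral_def using that(4) by (intro nn_integral_mono) (auto simp: indicator_def)
    also have "\<dots> = Lp_integral P T f"
      unfolding Lp_integral_def by (rule nn_integral_lborel_swap) measurable
    finally show ?thesis .
  qed
  show "\<exists>x\<in>{-1..1}. Lp_integral P Q (\<lambda>z. f z - f (x, snd z)) \<le> ennreal (2 * \<epsilon>)"
    if "f \<in> mble" "0 \<le> \<epsilon>"
      "\<And>t. \<bar>t\<bar> \<le> 2 \<Longrightarrow> Lp_integral P Q (\<lambda>z. f (z + (t, 0)) - f z) \<le> ennreal \<epsilon>" for \<epsilon>
    using exists_good_translate[of f "\<lambda>u. ennreal (\<bar>u\<bar> powr P)" "ennreal \<epsilon>"] that
    unfolding Lp_integral_def by (simp add: ennreal_mult)
  show "\<exists>x\<in>{a..b}. Lp_integral P Q (\<lambda>z. f (x, snd z)) \<le> ennreal (2 / (b - a) * \<epsilon>)"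
    if "f \<in> mble" "0 \<le> \<epsilon>" "-1 \<le> a" "a < b" "b \<le> 1"
      "Lp_integral P Q f \<le> ennreal \<epsilon>" for \<epsilon> a b
  proof -
    have eq: "ennreal (2 / (b - a) * \<epsilon>) = ennreal (2 / (b - a)) * ennreal \<epsilon>"
      using that by (intro ennreal_mult) auto
    show ?thesis
      unfolding Lp_integral_def eq by (rule exists_good_section) (use that in \<open>auto simp: Lp_integral_def\<close>)
  qed
qed

text \<open>Turns bounds on the essential supremum into vanishing integrals, to which the averaging
  arguments for integrals apply.\<close>

lemma sup_norm_on_le_iff:
  assumes [measurable]: "S \<in> sets borel" "f \<in> mble"
  shows "sup_norm_on S f \<le> C \<longleftrightarrow> (\<integral>\<^sup>+z\<in>S. indicator {u. C < ennreal \<bar>u\<bar>} (f z) \<partial>lborel) = 0"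
proof -
  have "sup_norm_on S f \<le> C \<longleftrightarrow> (AE z in lborel. ennreal \<bar>f z\<bar> * indicator S z \<le> C)"
  proof
    assume C: "sup_norm_on S f \<le> C"
    have "AE z in lborel. ennreal \<bar>f z\<bar> * indicator S z \<le> sup_norm_on S f"
      unfolding sup_norm_on_def by (rule esssup_AE)
    then show "AE z in lborel. ennreal \<bar>f z\<bar> * indicator S z \<le> C"
      by eventually_elim (use C in auto)
  next
    assume "AE z in lborel. ennreal \<bar>f z\<bar> * indicator S z \<le> C"
    then show "sup_norm_on S f \<le> C" unfolding sup_norm_on_def by (intro esssup_I) auto
  qed
  also have "\<dots> \<longleftrightarrow> (AE z in lborel. (indicator {u. C < ennreal \<bar>u\<bar>} (f z) * indicator S z :: ennreal) = 0)"
    by (intro AE_cong) (auto simp: indicator_def not_less)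
  also have "\<dots> \<longleftrightarrow> (\<integral>\<^sup>+z\<in>S. indicator {u. C < ennreal \<bar>u\<bar>} (f z) \<partial>lborel) = 0"
    by (rule nn_integral_0_iff_AE[symmetric]) measurable
  finally show ?thesis .
qed

lemma sup_norm_on_AE:
  assumes "S \<in> sets borel" "f \<in> mble"
  shows "AE z in lborel. z \<in> S \<longrightarrow> ennreal \<bar>f z\<bar> \<le> sup_norm_on S f"
proof -
  have "AE z in lborel. ennreal \<bar>f z\<bar> * indicator S z \<le> sup_norm_on S f"
    unfolding sup_norm_on_def by (rule esssup_AE)
  then show ?thesis by eventually_elim auto
qed

lemma sup_norm_on_leI:
  assumes [measurable]: "S \<in> sets borel" "f \<in> mble"
    and "AE z in lborel. z \<in> S \<longrightarrow> ennreal \<bar>f z\<bar> \<le> C"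
  shows "sup_norm_on S f \<le> C"
proof -
  have "AE z in lborel. ennreal \<bar>f z\<bar> * indicator S z \<le> C"
    using assms(3) by eventually_elim (auto simp: indicator_def)
  then show ?thesis unfolding sup_norm_on_def by (intro esssup_I) auto
qed

lemma lp_gauge_sup_norm_on: "lp_gauge sup_norm_on 1"
proof
  show "0 < (1::real)" by simp
  note [measurable] = sets_borel_box
  fix S T :: "plane set" and f g :: "plane \<Rightarrow> real"
  show "sup_norm_on S f \<le> sup_norm_on T g"
    if m: "S \<in> sets borel" "T \<in> sets borel" "f \<in> mble" "g \<in> mble"
      and le: "S \<subseteq> T" "\<And>z. z \<in> S \<Longrightarrow> \<bar>f z\<bar> \<le> \<bar>g z\<bar>"
  proof (rule sup_norm_on_leI[OF m(1,3)])
    show "AE z in lborel. z \<in> S \<longrightarrow> ennreal \<bar>f z\<bar> \<le> sup_norm_on T g"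
      using sup_norm_on_AE[OF m(2,4)]
      by eventually_elim (use le in \<open>auto intro: order_trans[OF ennreal_leI]\<close>)
  qed
  show "sup_norm_on (S \<union> T) f \<le> sup_norm_on S f + sup_norm_on T f"
    if m: "S \<in> sets borel" "T \<in> sets borel" "f \<in> mble"
  proof (rule sup_norm_on_leI)
    show "AE z in lborel. z \<in> S \<union> T \<longrightarrow> ennreal \<bar>f z\<bar> \<le> sup_norm_on S f + sup_norm_on T f"
      using sup_norm_on_AE[OF m(1,3)] sup_norm_on_AE[OF m(2,3)]
      by eventually_elim (auto intro: add_increasing add_increasing2)
  qed (use m in auto)
  have cmult_le: "sup_norm_on S (\<lambda>z. c * f z) \<le> ennreal \<bar>c\<bar> * sup_norm_on S f"
    if m: "S \<in> sets borel" "f \<in> mble" for c f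
  proof (rule sup_norm_on_leI)
    show "AE z in lborel. z \<in> S \<longrightarrow> ennreal \<bar>c * f z\<bar> \<le> ennreal \<bar>c\<bar> * sup_norm_on S f"
      using sup_norm_on_AE[OF m] by eventually_elim (auto simp: abs_mult ennreal_mult mult_left_mono)
  qed (use m in auto)
  show "sup_norm_on S (\<lambda>z. c * f z) = ennreal (\<bar>c\<bar> powr 1) * sup_norm_on S f"
    if m: "S \<in> sets borel" "f \<in> mble" for c
  proof (cases "c = 0")
    case True
    then show ?thesis using cmult_le[OF m, of 0] by simp
  next
    case False
    \<comment> \<open>The reverse inequality is the one just proved, applied to the factor
      \<open>1 / c\<close> and the function \<open>c * f\<close>.\<close>
    have "sup_norm_on S (\<lambda>z. (1 / c) * (c * f z)) \<le> ennreal \<bar>1 / c\<bar> * sup_norm_on S (\<lambda>z. c * f z)"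
      by (rule cmult_le) (use m in auto)
    then have "ennreal \<bar>c\<bar> * sup_norm_on S f \<le> ennreal \<bar>c\<bar> * (ennreal \<bar>1 / c\<bar> * sup_norm_on S (\<lambda>z. c * f z))"
      using False by (intro mult_left_mono) auto
    also have "\<dots> = sup_norm_on S (\<lambda>z. c * f z)"
      using False by (simp flip: mult.assoc ennreal_mult)
    finally show ?thesis using cmult_le[OF m, of c] by (simp add: antisym)
  qed
  show "sup_norm_on S (\<lambda>z. f z + g z) \<le>
      ennreal ((1 + \<kappa>) powr 1) * sup_norm_on S f + ennreal ((1 + 1 / \<kappa>) powr 1) * sup_norm_on S g"
    if m: "S \<in> sets borel" "f \<in> mble" "g \<in> mble" and \<kappa>: "0 < \<kappa>" for \<kappa>
  proof (rule sup_norm_on_leI)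
    show "AE z in lborel. z \<in> S \<longrightarrow> ennreal \<bar>f z + g z\<bar> \<le>
      ennreal ((1 + \<kappa>) powr 1) * sup_norm_on S f + ennreal ((1 + 1 / \<kappa>) powr 1) * sup_norm_on S g"
      using sup_norm_on_AE[OF m(1,2)] sup_norm_on_AE[OF m(1,3)]
    proof eventually_elim
      case (elim z)
      show ?case
      proof
        assume z: "z \<in> S"
        have "ennreal \<bar>f z + g z\<bar> \<le> ennreal (\<bar>f z\<bar> + \<bar>g z\<bar>)" by (rule ennreal_leI) simp
        also have "\<dots> = 1 * ennreal \<bar>f z\<bar> + 1 * ennreal \<bar>g z\<bar>" by simp
        also have "\<dots> \<le> ennreal ((1 + \<kappa>) powr 1) * sup_norm_on S f + ennreal ((1 + 1 / \<kappa>) powr 1) * sup_norm_on S g"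
          using elim z \<kappa> by (intro add_mono mult_mono) auto
        finally show "ennreal \<bar>f z + g z\<bar> \<le> ennreal ((1 + \<kappa>) powr 1) * sup_norm_on S f + ennreal ((1 + 1 / \<kappa>) powr 1) * sup_norm_on S g" .
      qed
    qed
  qed (use m in auto)
  show "sup_norm_on S (\<lambda>z. f (z + w)) \<le> sup_norm_on T f"
    if [measurable]: "S \<in> sets borel" "T \<in> sets borel" "f \<in> mble" and "\<And>z. z \<in> S \<Longrightarrow> z + w \<in> T" for w
  proof (subst sup_norm_on_le_iff)
    \<comment> \<open>With the norm on \<open>T\<close> as the level, the claim becomes the
      vanishing of an integral, which translation preserves.\<close>
    let ?\<phi> = "indicator {u. sup_norm_on T f < ennreal \<bar>u\<bar>} :: real \<Rightarrow> ennreal"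
    have "(\<integral>\<^sup>+z\<in>S. ?\<phi> (f (z + w)) \<partial>lborel) \<le> (\<integral>\<^sup>+z. ?\<phi> (f (z + w)) * indicator T (z + w) \<partial>lborel)"
      using that(4) by (intro nn_integral_mono) (auto simp: indicator_def)
    also have "\<dots> = (\<integral>\<^sup>+z\<in>T. ?\<phi> (f z) \<partial>lborel)"
      by (rule nn_integral_lborel_shift) measurable
    also have "\<dots> = 0" using sup_norm_on_le_iff[of T f "sup_norm_on T f"] by simp
    finally show "(\<integral>\<^sup>+z\<in>S. ?\<phi> (f (z + w)) \<partial>lborel) = 0" by simp
  qed auto
  show "sup_norm_on S (\<lambda>z. f (prod.swap z)) \<le> sup_norm_on T f"
    if [measurable]: "S \<in> sets borel" "T \<in> sets borel" "f \<in> mble" and "\<And>z. z \<in> S \<Longrightarrow> prod.swap z \<in> T"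
  proof (subst sup_norm_on_le_iff)
    let ?\<phi> = "indicator {u. sup_norm_on T f < ennreal \<bar>u\<bar>} :: real \<Rightarrow> ennreal"
    have "(\<integral>\<^sup>+z\<in>S. ?\<phi> (f (prod.swap z)) \<partial>lborel) \<le> (\<integral>\<^sup>+z. ?\<phi> (f (prod.swap z)) * indicator T (prod.swap z) \<partial>lborel)"
      using that(4) by (intro nn_integral_mono) (auto simp: indicator_def)
    also have "\<dots> = (\<integral>\<^sup>+z\<in>T. ?\<phi> (f z) \<partial>lborel)"
      by (rule nn_integral_lborel_swap) measurable
    also have "\<dots> = 0" using sup_norm_on_le_iff[of T f "sup_norm_on T f"] by simp
    finally show "(\<integral>\<^sup>+z\<in>S. ?\<phi> (f (prod.swap z)) \<partial>lborel) = 0" by simp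
    have "prod.swap \<in> borel \<rightarrow>\<^sub>M (borel :: plane measure)"
      by (intro borel_measurable_continuous_onI) (simp add: prod.swap_def[abs_def] continuous_intros)
    from measurable_compose[OF this that(3)] show "(\<lambda>z. f (prod.swap z)) \<in> mble" .
  qed auto
  show "\<exists>x\<in>{-1..1}. sup_norm_on Q (\<lambda>z. f z - f (x, snd z)) \<le> ennreal (2 * \<epsilon>)"
    if [measurable]: "f \<in> mble" and \<epsilon>: "0 \<le> \<epsilon>"
      and small: "\<And>t. \<bar>t\<bar> \<le> 2 \<Longrightarrow> sup_norm_on Q (\<lambda>z. f (z + (t, 0)) - f z) \<le> ennreal \<epsilon>" for \<epsilon>
  proof -
    let ?\<phi> = "indicator {u. ennreal \<epsilon> < ennreal \<bar>u\<bar>} :: real \<Rightarrow> ennreal"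
    \<comment> \<open>The averaging bound is used with \<open>e = 0\<close>: its constant multiplies
      0, so the chosen line keeps the level \<open>\<epsilon>\<close> itself.\<close>
    have "\<exists>x\<in>{-1..1}. (\<integral>\<^sup>+z\<in>Q. ?\<phi> (f z - f (x, snd z)) \<partial>lborel) \<le> 2 * 0"
    proof (rule exists_good_translate)
      fix t :: real assume "\<bar>t\<bar> \<le> 2"
      then show "(\<integral>\<^sup>+z\<in>Q. ?\<phi> (f (z + (t, 0)) - f z) \<partial>lborel) \<le> 0"
        using small[of t] by (subst (asm) sup_norm_on_le_iff) auto
    qed (auto simp: indicator_def)
    then obtain x where x: "x \<in> {-1..1}"
      "(\<integral>\<^sup>+z\<in>Q. ?\<phi> (f z - f (x, snd z)) \<partial>lborel) = 0"
      unfolding mult_zero_right le_zero_eq by blast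
    have "(\<lambda>z::plane. f (x, snd z)) \<in> mble"
      by (rule borel_measurable_fst_snd) (rule borel_measurable_section, fact)
    from borel_measurable_diff[OF that(1) this]
    have "(\<lambda>z. f z - f (x, snd z)) \<in> mble" .
    from iffD2[OF sup_norm_on_le_iff[OF sets_borel_box this] x(2)]
    have "sup_norm_on Q (\<lambda>z. f z - f (x, snd z)) \<le> ennreal \<epsilon>" .
    also have "\<dots> \<le> ennreal (2 * \<epsilon>)" using \<epsilon> by (intro ennreal_leI) simp
    finally show ?thesis using x(1) by blast
  qed
  show "\<exists>x\<in>{a..b}. sup_norm_on Q (\<lambda>z. f (x, snd z)) \<le> ennreal (2 / (b - a) * \<epsilon>)"
    if [measurable]: "f \<in> mble" and \<epsilon>: "0 \<le> \<epsilon>" and ab: "-1 \<le> a" "a < b" "b \<le> 1"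
      and small: "sup_norm_on Q f \<le> ennreal \<epsilon>" for \<epsilon> a b
  proof -
    let ?\<phi> = "indicator {u. ennreal \<epsilon> < ennreal \<bar>u\<bar>} :: real \<Rightarrow> ennreal"
    have "\<exists>x\<in>{a..b}. (\<integral>\<^sup>+z\<in>Q. ?\<phi> (f (x, snd z)) \<partial>lborel)
        \<le> ennreal (2 / (b - a)) * 0"
    proof (rule exists_good_section)
      show "(\<integral>\<^sup>+z\<in>Q. ?\<phi> (f z) \<partial>lborel) \<le> 0"
        using small by (subst (asm) sup_norm_on_le_iff) auto
    qed (use ab in auto)
    then obtain x where x: "x \<in> {a..b}"
      "(\<integral>\<^sup>+z\<in>Q. ?\<phi> (f (x, snd z)) \<partial>lborel) = 0"
      unfolding mult_zero_right le_zero_eq by blast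
    have "(\<lambda>z::plane. f (x, snd z)) \<in> mble"
      by (rule borel_measurable_fst_snd) (rule borel_measurable_section, fact)
    from iffD2[OF sup_norm_on_le_iff[OF sets_borel_box this] x(2)]
    have "sup_norm_on Q (\<lambda>z. f (x, snd z)) \<le> ennreal \<epsilon>" .
    also have "\<dots> \<le> ennreal (2 / (b - a) * \<epsilon>)"
    proof (rule ennreal_leI)
      have "1 * \<epsilon> \<le> 2 / (b - a) * \<epsilon>" using ab \<epsilon> by (intro mult_right_mono) (auto simp: pos_le_divide_eq)
      then show "\<epsilon> \<le> 2 / (b - a) * \<epsilon>" by simp
    qed
    finally show ?thesis using x(1) by blast
  qed
qed

section \<open>Affine coordinates\<close>

definition cross :: "real ^ 2 \<Rightarrow> real ^ 2 \<Rightarrow> real" where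
  "cross v w = v $ 1 * w $ 2 - v $ 2 * w $ 1"

lemma cross_simps:
  "cross (u + v) w = cross u w + cross v w" "cross w (u + v) = cross w u + cross w v"
  "cross (u - v) w = cross u w - cross v w" "cross w (u - v) = cross w u - cross w v"
  "cross (c *\<^sub>R u) w = c * cross u w" "cross w (c *\<^sub>R u) = c * cross w u"
  "cross (- u) w = - cross u w" "cross w (- u) = - cross w u" "cross u u = 0"
  by (simp_all add: cross_def algebra_simps)

lemma cross_cramer: "cross v w *\<^sub>R z = cross z w *\<^sub>R v + cross v z *\<^sub>R w"
  by (simp add: vec_eq_iff forall_2 cross_def algebra_simps)

lemma cross_decompose:
  assumes "cross v w \<noteq> 0"
  shows "z = (cross z w / cross v w) *\<^sub>R v + (cross v z / cross v w) *\<^sub>R w"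
proof -
  have "z = (1 / cross v w) *\<^sub>R (cross v w *\<^sub>R z)" using assms by simp
  also have "\<dots> = (1 / cross v w) *\<^sub>R (cross z w *\<^sub>R v + cross v z *\<^sub>R w)"
    by (rule arg_cong[OF cross_cramer])
  also have "\<dots> = (cross z w / cross v w) *\<^sub>R v + (cross v z / cross v w) *\<^sub>R w"
    by (simp add: scaleR_add_right)
  finally show ?thesis .
qed

definition frame :: "real ^ 2 \<Rightarrow> real ^ 2 \<Rightarrow> real ^ 2 \<Rightarrow> plane \<Rightarrow> real ^ 2" where
  "frame a v w z = a + fst z *\<^sub>R v + snd z *\<^sub>R w"

lemma frame_add: "frame a v w (z + z') = frame a v w z + fst z' *\<^sub>R v + snd z' *\<^sub>R w"
  by (simp add: frame_def algebra_simps)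

lemma borel_measurable_frame [measurable]: "frame a v w \<in> borel \<rightarrow>\<^sub>M borel"
  unfolding frame_def[abs_def] by (intro borel_measurable_continuous_onI continuous_intros)

abbreviation vec2 :: "plane \<Rightarrow> real ^ 2" where
  "vec2 \<equiv> \<lambda>z. vector [fst z, snd z]"

text \<open>The gauges live on pairs, which suit Fubini, and the body in \<open>real ^ 2\<close>,
  which suits determinants. This identifies the two Lebesgue measures, by comparison on
  boxes.\<close>

lemma distr_lborel_vec2: "distr lborel borel vec2 = lborel"
proof (rule lborel_eqI[symmetric])
  have "frame 0 (axis 1 1) (axis 2 1) = vec2"
    by (auto simp: frame_def fun_eq_iff vec_eq_iff forall_2 axis_def)
  then have m: "vec2 \<in> borel \<rightarrow>\<^sub>M borel"
    using borel_measurable_frame[of 0 "axis 1 1" "axis 2 1"] by simp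
  fix l u :: "real ^ 2"
  assume le: "\<And>b. b \<in> Basis \<Longrightarrow> l \<bullet> b \<le> u \<bullet> b"
  have le': "l $ i \<le> u $ i" for i using le[of "axis i 1"] by (simp add: inner_axis)
  have "emeasure (distr lborel borel vec2) (box l u) =
     emeasure lborel (vec2 -` box l u \<inter> space lborel)"
    using m by (intro emeasure_distr) auto
  also have "vec2 -` box l u \<inter> space lborel =
      box (l $ 1, l $ 2) (u $ 1, u $ 2)"
    by (auto simp: mem_box_cart forall_2 mem_box Basis_prod_def)
  also have "emeasure lborel (box (l $ 1, l $ 2) (u $ 1, u $ 2)) = ennreal ((u $ 1 - l $ 1) * (u $ 2 - l $ 2))"
    using le' by (subst emeasure_lborel_box) (auto simp: Basis_prod_def prod.union_disjoint image_iff prod.reindex)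
  also have "(u $ 1 - l $ 1) * (u $ 2 - l $ 2) = (\<Prod>b\<in>Basis. (u - l) \<bullet> b)"
  proof -
    have B: "Basis = range (\<lambda>i::2. axis i (1::real))" by (auto simp: Basis_vec_def)
    have "inj (\<lambda>i::2. axis i (1::real))" by (simp add: inj_on_def axis_eq_axis)
    then have "(\<Prod>b\<in>Basis. (u - l) \<bullet> b) = (\<Prod>i\<in>UNIV. (u - l) $ i)"
      unfolding B by (subst prod.reindex) (auto simp: inner_axis)
    then show ?thesis by (simp add: UNIV_2)
  qed
  finally show "emeasure (distr lborel borel vec2) (box l u) =
    ennreal (\<Prod>b\<in>Basis. (u - l) \<bullet> b)" by simp
qed simp

text \<open>A measure with the right values on boxes is Lebesgue measure. On a box the claim is that
  \<open>L\<close> scales the volume of the preimage by the absolute value of its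
  determinant.\<close>

lemma lborel_linear_vec2:
  fixes L :: "real ^ 2 \<Rightarrow> real ^ 2"
  assumes L: "linear L" and det: "det (matrix L) \<noteq> 0"
  shows "density (distr lborel borel L) (\<lambda>_. ennreal \<bar>det (matrix L)\<bar>) = lborel"
proof (rule lborel_eqI[symmetric])
  have m[measurable]: "L \<in> borel \<rightarrow>\<^sub>M borel"
    using L by (intro borel_measurable_continuous_onI linear_continuous_on linear_conv_bounded_linear[THEN iffD1])
  fix l u :: "real ^ 2"
  assume le: "\<And>b. b \<in> Basis \<Longrightarrow> l \<bullet> b \<le> u \<bullet> b"
  have bij: "bij L"
  proof -
    have "(*v) (matrix L) = L" using matrix_vector_mul(2)[OF L] by simp
    then show ?thesis using det invertible_eq_bij[of "matrix L"] by (simp add: invertible_det_nz)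
  qed
  let ?S = "L -` box l u"
  have img: "L ` ?S = box l u" using bij by (simp add: surj_image_vimage_eq bij_is_surj)
  obtain M where M: "linear M" "M \<circ> L = id" "L \<circ> M = id"
    using linear_injective_isomorphism[OF L bij_is_inj[OF bij]] by (auto simp: o_def fun_eq_iff)
  have S: "?S = M ` box l u"
    using M(2,3) by (auto simp: fun_eq_iff image_iff) (metis)
  have "?S \<in> lmeasurable" unfolding S using M(1) by (rule measurable_linear_image) simp
  then have "measure lebesgue (L ` ?S) = \<bar>det (matrix L)\<bar> * measure lebesgue ?S"
    by (rule measure_linear_image[OF L])
  then have *: "measure lborel (box l u) = \<bar>det (matrix L)\<bar> * measure lborel ?S"
    unfolding img using measurable_sets[OF m, of "box l u"] by (simp add: measure_completion)
  have fin: "emeasure lborel ?S < \<infinity>"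
    using \<open>?S \<in> lmeasurable\<close> measurable_sets[OF m, of "box l u"] by (auto simp: fmeasurable_def main_part_sets)
  have "emeasure (density (distr lborel borel L) (\<lambda>_. ennreal \<bar>det (matrix L)\<bar>)) (box l u) =
      ennreal \<bar>det (matrix L)\<bar> * emeasure lborel ?S"
    by (simp add: emeasure_density_const emeasure_distr)
  also have "\<dots> = ennreal (\<bar>det (matrix L)\<bar> * measure lborel ?S)"
    using fin by (simp add: ennreal_mult emeasure_eq_ennreal_measure)
  also have "\<dots> = emeasure lborel (box l u)"
    unfolding *[symmetric]
    by (rule emeasure_eq_ennreal_measure[symmetric]) (use emeasure_lborel_box_finite[of l u] in auto)
  also have "\<dots> = ennreal (\<Prod>b\<in>Basis. (u - l) \<bullet> b)"
    using le by (subst emeasure_lborel_box) auto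
  finally show "emeasure (density (distr lborel borel L) (\<lambda>_. ennreal \<bar>det (matrix L)\<bar>)) (box l u) =
    ennreal (\<Prod>b\<in>Basis. (u - l) \<bullet> b)" .
qed simp

text \<open>\<open>frame\<close> is \<open>vec2\<close>, followed by the linear map with columns
  \<open>v\<close> and \<open>w\<close>, followed by a translation; \<open>cross v w\<close> is the
  determinant.\<close>

lemma nn_integral_frame:
  fixes F :: "real ^ 2 \<Rightarrow> ennreal"
  assumes F[measurable]: "F \<in> borel_measurable borel" and vw: "cross v w \<noteq> 0"
  shows "(\<integral>\<^sup>+x. F x \<partial>lborel) = ennreal \<bar>cross v w\<bar> * (\<integral>\<^sup>+z. F (frame a v w z) \<partial>lborel)"
proof -
  define L where "L x = x $ 1 *\<^sub>R v + x $ 2 *\<^sub>R w" for x :: "real ^ 2"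
  have L: "linear L" unfolding L_def by (intro linearI) (auto simp: algebra_simps)
  have det: "det (matrix L) = cross v w"
    by (simp add: det_2 matrix_def L_def cross_def axis_def algebra_simps)
  have m[measurable]: "L \<in> borel \<rightarrow>\<^sub>M borel"
    using L by (intro borel_measurable_continuous_onI linear_continuous_on linear_conv_bounded_linear[THEN iffD1])
  have "frame 0 (axis 1 1) (axis 2 1) = vec2"
    by (auto simp: frame_def fun_eq_iff vec_eq_iff forall_2 axis_def)
  then have T[measurable]: "vec2 \<in> borel \<rightarrow>\<^sub>M borel"
    using borel_measurable_frame[of 0 "axis 1 1" "axis 2 1"] by simp
  have "(\<integral>\<^sup>+x. F x \<partial>lborel) = (\<integral>\<^sup>+x. F (x + a) \<partial>lborel)"
    by (rule nn_integral_lborel_shift[symmetric]) measurable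
  also have "\<dots> = (\<integral>\<^sup>+x. F (x + a) \<partial>density (distr lborel borel L) (\<lambda>_. ennreal \<bar>cross v w\<bar>))"
    using lborel_linear_vec2[OF L] vw by (simp add: det)
  also have "\<dots> = ennreal \<bar>cross v w\<bar> * (\<integral>\<^sup>+x. F (x + a) \<partial>distr lborel borel L)"
    by (simp add: nn_integral_density nn_integral_cmult)
  also have "(\<integral>\<^sup>+x. F (x + a) \<partial>distr lborel borel L) = (\<integral>\<^sup>+x. F (L x + a) \<partial>lborel)"
    by (rule nn_integral_distr) measurable
  also have "\<dots> = (\<integral>\<^sup>+x. F (L x + a) \<partial>distr lborel borel vec2)"
    by (simp add: distr_lborel_vec2)
  also have "\<dots> = (\<integral>\<^sup>+z. F (L (vec2 z) + a) \<partial>lborel)"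
    by (rule nn_integral_distr) measurable
  also have "(\<lambda>z. L (vec2 z) + a) = frame a v w"
    by (auto simp: L_def frame_def algebra_simps)
  then have "(\<integral>\<^sup>+z. F (L (vec2 z) + a) \<partial>lborel) = (\<integral>\<^sup>+z. F (frame a v w z) \<partial>lborel)"
    by (metis (no_types, lifting))
  finally show ?thesis .
qed

lemma AE_frame_iff:
  assumes [measurable]: "Measurable.pred borel P" and vw: "cross v w \<noteq> 0"
  shows "(AE x in lborel. P x) \<longleftrightarrow> (AE z in lborel. P (frame a v w z))"
proof -
  have "(AE x in lborel. P x) \<longleftrightarrow> (\<integral>\<^sup>+x. indicator {x. \<not> P x} x \<partial>lborel) = 0"
    by (subst nn_integral_0_iff_AE) (auto simp: indicator_def)
  also have "\<dots> \<longleftrightarrow> (\<integral>\<^sup>+z. indicator {x. \<not> P x} (frame a v w z) \<partial>lborel) = 0"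
    using vw by (subst nn_integral_frame[OF _ vw, of _ a]) auto
  also have "\<dots> \<longleftrightarrow> (AE z in lborel. P (frame a v w z))"
    by (subst nn_integral_0_iff_AE) (auto simp: indicator_def)
  finally show ?thesis .
qed

section \<open>\<open>L^p\<close> norms as gauges in affine coordinates\<close>

lemma Lp_norm_cong_AE:
  assumes S: "S \<in> sets lebesgue" and f: "f \<in> borel_measurable (lebesgue_on S)" and g: "g \<in> borel_measurable (lebesgue_on S)"
    and ae: "AE x in lebesgue. x \<in> S \<longrightarrow> f x = g x"
  shows "Lp_norm p S f = Lp_norm p S g"
proof -
  have ae': "AE x in lebesgue_on S. f x = g x" using ae S by (simp add: AE_restrict_space_iff)
  have "esssup (lebesgue_on S) (\<lambda>x. ennreal \<bar>f x\<bar>) = esssup (lebesgue_on S) (\<lambda>x. ennreal \<bar>g x\<bar>)"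
    using ae' f g by (intro esssup_AE_cong) auto
  moreover have "(\<integral>\<^sup>+x. ennreal (\<bar>f x\<bar> powr enn2real p) \<partial>lebesgue_on S) = (\<integral>\<^sup>+x. ennreal (\<bar>g x\<bar> powr enn2real p) \<partial>lebesgue_on S)"
    using ae' by (intro nn_integral_cong_AE) auto
  ultimately show ?thesis by (simp add: Lp_norm_def)
qed

lemma Lp_norm_fin_le_iff:
  assumes p: "0 < p" "p \<noteq> \<infinity>" and c: "0 \<le> c"
  shows "Lp_norm p S f \<le> ennreal c \<longleftrightarrow>
    (\<integral>\<^sup>+x. ennreal (\<bar>f x\<bar> powr enn2real p) \<partial>lebesgue_on S) \<le> ennreal (c powr enn2real p)"
proof -
  define P where "P = enn2real p"
  have P: "0 < P" using p by (simp add: P_def enn2real_positive_iff less_top)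
  define I where "I = (\<integral>\<^sup>+x. ennreal (\<bar>f x\<bar> powr P) \<partial>lebesgue_on S)"
  have L: "Lp_norm p S f = (if I = \<infinity> then \<infinity> else ennreal (enn2real I powr (1 / P)))"
    using p by (simp add: Lp_norm_def I_def P_def Let_def)
  show ?thesis
  proof (cases I rule: ennreal_cases)
    case (real i)
    have "i powr (1 / P) \<le> c \<longleftrightarrow> i \<le> c powr P"
    proof
      assume "i powr (1 / P) \<le> c"
      then have "(i powr (1 / P)) powr P \<le> c powr P" using P by (intro powr_mono2) auto
      then show "i \<le> c powr P" using P real by (simp add: powr_powr)
    next
      assume "i \<le> c powr P"
      then have "i powr (1 / P) \<le> (c powr P) powr (1 / P)" using P real by (intro powr_mono2) auto
      then show "i powr (1 / P) \<le> c" using P c by (simp add: powr_powr)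
    qed
    then show ?thesis unfolding L I_def[symmetric] P_def[symmetric] using real c by simp
  next
    case top
    then show ?thesis unfolding L I_def[symmetric] P_def[symmetric] by (simp add: top_unique)
  qed
qed

text \<open>The order of the quantifiers is the point. \<open>R\<close> and \<open>s\<close> depend
  on \<open>p\<close> alone; only the Jacobian \<open>\<kappa>\<close> depends on the frame. It
  divides the bound on the differences and the bound on the error alike, so it cancels in the end
  and the constant is the same for all bodies.\<close>

lemma Lp_norm_gauge:
  assumes p: "0 < p"
  shows "\<exists>R s. lp_gauge R s \<and> (\<forall>a v w. cross v w \<noteq> 0 \<longrightarrow> (\<exists>\<kappa>>0. \<forall>S g c.
    S \<in> sets borel \<longrightarrow> g \<in> borel_measurable borel \<longrightarrow> 0 \<le> c \<longrightarrow>
    (Lp_norm p S g \<le> ennreal c \<longleftrightarrow> R (frame a v w -` S) (\<lambda>z. g (frame a v w z)) \<le> ennreal (c powr s / \<kappa>))))"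
proof (cases "p = \<infinity>")
  case True
  show ?thesis
  proof (intro exI[of _ sup_norm_on] exI[of _ 1] conjI allI impI lp_gauge_sup_norm_on zero_less_one)
    fix a v w and S :: "(real ^ 2) set" and g :: "real ^ 2 \<Rightarrow> real" and c :: real
    assume vw: "cross v w \<noteq> 0" and S[measurable]: "S \<in> sets borel" and g[measurable]: "g \<in> borel_measurable borel" and c: "0 \<le> c"
    have "frame a v w -` S \<inter> space borel \<in> sets borel" by measurable
    then have S': "frame a v w -` S \<in> sets borel" by simp
    have gm: "g \<in> borel_measurable (lebesgue_on S)"
      by (intro measurable_restrict_space1 measurable_completion) simp
    have "Lp_norm p S g \<le> ennreal c \<longleftrightarrow> (AE x in lebesgue_on S. ennreal \<bar>g x\<bar> \<le> ennreal c)"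
    proof
      assume "Lp_norm p S g \<le> ennreal c"
      moreover have "AE x in lebesgue_on S. ennreal \<bar>g x\<bar> \<le> Lp_norm p S g"
        using esssup_AE[of "\<lambda>x. ennreal \<bar>g x\<bar>" "lebesgue_on S"] True by (simp add: Lp_norm_def)
      ultimately show "AE x in lebesgue_on S. ennreal \<bar>g x\<bar> \<le> ennreal c" by (auto elim: eventually_mono)
    next
      assume "AE x in lebesgue_on S. ennreal \<bar>g x\<bar> \<le> ennreal c"
      then have "esssup (lebesgue_on S) (\<lambda>x. ennreal \<bar>g x\<bar>) \<le> ennreal c" using gm by (intro esssup_I) auto
      then show "Lp_norm p S g \<le> ennreal c" using True by (simp add: Lp_norm_def)
    qed
    also have "\<dots> \<longleftrightarrow> (AE x in lborel. x \<in> S \<longrightarrow> ennreal \<bar>g x\<bar> \<le> ennreal c)"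
      by (subst AE_restrict_space_iff) (auto simp: AE_completion_iff)
    also have "\<dots> \<longleftrightarrow> (AE z in lborel. frame a v w z \<in> S \<longrightarrow> ennreal \<bar>g (frame a v w z)\<bar> \<le> ennreal c)"
      by (rule AE_frame_iff[OF _ vw]) measurable
    also have "\<dots> \<longleftrightarrow> sup_norm_on (frame a v w -` S) (\<lambda>z. g (frame a v w z)) \<le> ennreal c"
    proof
      assume "AE z in lborel. frame a v w z \<in> S \<longrightarrow> ennreal \<bar>g (frame a v w z)\<bar> \<le> ennreal c"
      then show "sup_norm_on (frame a v w -` S) (\<lambda>z. g (frame a v w z)) \<le> ennreal c"
        by (intro sup_norm_on_leI S') auto
    next
      assume le: "sup_norm_on (frame a v w -` S) (\<lambda>z. g (frame a v w z)) \<le> ennreal c"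
      have "AE z in lborel. z \<in> frame a v w -` S \<longrightarrow> ennreal \<bar>g (frame a v w z)\<bar> \<le>
          sup_norm_on (frame a v w -` S) (\<lambda>z. g (frame a v w z))"
        by (rule sup_norm_on_AE[OF S']) measurable
      then show "AE z in lborel. frame a v w z \<in> S \<longrightarrow> ennreal \<bar>g (frame a v w z)\<bar> \<le> ennreal c"
        by eventually_elim (use le in auto)
    qed
    finally show "Lp_norm p S g \<le> ennreal c \<longleftrightarrow>
        sup_norm_on (frame a v w -` S) (\<lambda>z. g (frame a v w z)) \<le> ennreal (c powr 1 / 1)"
      using c by simp
  qed
next
  case False
  define P where "P = enn2real p"
  have P: "0 < P" using p False by (simp add: P_def enn2real_positive_iff less_top)
  show ?thesis
  proof (rule exI[of _ "Lp_integral P"], rule exI[of _ P], intro conjI lp_gauge_Lp_integral P allI impI)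
    fix a v w assume vw: "cross v w \<noteq> 0"
    show "\<exists>\<kappa>>0. \<forall>S g c. S \<in> sets borel \<longrightarrow> g \<in> borel_measurable borel \<longrightarrow> 0 \<le> c \<longrightarrow>
      (Lp_norm p S g \<le> ennreal c \<longleftrightarrow>
        Lp_integral P (frame a v w -` S) (\<lambda>z. g (frame a v w z)) \<le> ennreal (c powr P / \<kappa>))"
    proof (intro exI[of _ "\<bar>cross v w\<bar>"] conjI allI impI)
      show "0 < \<bar>cross v w\<bar>" using vw by simp
      fix S :: "(real ^ 2) set" and g :: "real ^ 2 \<Rightarrow> real" and c :: real
      assume S[measurable]: "S \<in> sets borel" and g[measurable]: "g \<in> borel_measurable borel" and c: "0 \<le> c"
      let ?I = "Lp_integral P (frame a v w -` S) (\<lambda>z. g (frame a v w z))"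
      have "(\<integral>\<^sup>+x. ennreal (\<bar>g x\<bar> powr P) \<partial>lebesgue_on S) = (\<integral>\<^sup>+x. ennreal (\<bar>g x\<bar> powr P) * indicator S x \<partial>lebesgue)"
        by (rule nn_integral_restrict_space) simp
      also have "\<dots> = (\<integral>\<^sup>+x. ennreal (\<bar>g x\<bar> powr P) * indicator S x \<partial>lborel)"
        by (rule nn_integral_completion)
      also have "\<dots> = ennreal \<bar>cross v w\<bar> * (\<integral>\<^sup>+z. ennreal (\<bar>g (frame a v w z)\<bar> powr P) * indicator S (frame a v w z) \<partial>lborel)"
        by (rule nn_integral_frame[OF _ vw]) measurable
      also have "\<dots> = ennreal \<bar>cross v w\<bar> * ?I"
        unfolding Lp_integral_def by (simp add: indicator_def vimage_def)
      finally have I: "(\<integral>\<^sup>+x. ennreal (\<bar>g x\<bar> powr P) \<partial>lebesgue_on S) = ennreal \<bar>cross v w\<bar> * ?I" .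
      have "Lp_norm p S g \<le> ennreal c \<longleftrightarrow> ennreal \<bar>cross v w\<bar> * ?I \<le> ennreal (c powr P)"
        using Lp_norm_fin_le_iff[OF p False c, of S g] I by (simp add: P_def)
      also have "\<dots> \<longleftrightarrow> ?I \<le> ennreal (c powr P / \<bar>cross v w\<bar>)"
      proof (cases ?I rule: ennreal_cases)
        case (real i)
        then show ?thesis using vw by (simp add: pos_le_divide_eq mult.commute flip: ennreal_mult)
      next
        case top
        then show ?thesis using vw by (simp add: ennreal_mult_top top_unique)
      qed
      finally show "Lp_norm p S g \<le> ennreal c \<longleftrightarrow> ?I \<le> ennreal (c powr P / \<bar>cross v w\<bar>)" .
    qed
  qed
qed

section \<open>Chords of maximal cross product\<close>

text \<open>The chords of \<open>G\<close> through \<open>m\<close> are those from \<open>m - \<mu> v\<close> to \<open>m + v\<close> and from \<open>m - \<nu> w\<close> to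
  \<open>m + w\<close>. By the last condition their ends lie on opposite sides of a parallelogram that contains \<open>G\<close>.\<close>

definition chord_frame :: "(real ^ 2) set \<Rightarrow> real ^ 2 \<Rightarrow> real ^ 2 \<Rightarrow> real ^ 2 \<Rightarrow> real \<Rightarrow> real \<Rightarrow> bool" where
  "chord_frame G m v w \<mu> \<nu> \<longleftrightarrow> cross v w \<noteq> 0 \<and> \<mu> \<in> {0..1} \<and> \<nu> \<in> {0..1} \<and>
    m + v \<in> G \<and> m - \<mu> *\<^sub>R v \<in> G \<and> m + w \<in> G \<and> m - \<nu> *\<^sub>R w \<in> G \<and>
    (\<forall>z\<in>G. \<exists>x\<in>{-\<mu>..1}. \<exists>y\<in>{-\<nu>..1}. z = m + x *\<^sub>R v + y *\<^sub>R w)"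

text \<open>For chords \<open>p - q\<close> and \<open>s - t\<close> of maximal cross product, the lines through \<open>p\<close> and \<open>q\<close> parallel to
  \<open>s - t\<close> support \<open>G\<close>, and conversely. The vectors of the frame are the longer parts into which
  these chords divide each other.\<close>

lemma convex_body_chord_frame:
  assumes "convex_body G"
  obtains m v w \<mu> \<nu> where "chord_frame G m v w \<mu> \<nu>"
proof -
  have G: "compact G" "interior G \<noteq> {}" using assms by (auto simp: convex_body_def)
  define F where "F = (\<lambda>(p, q, s, t). cross (p - q) (s - t))"
  have "continuous_on (G \<times> G \<times> G \<times> G) F"
    unfolding F_def cross_def case_prod_unfold by (intro continuous_intros)
  moreover have "compact (G \<times> G \<times> G \<times> G)" using G by (intro compact_Times)
  moreover have "G \<times> G \<times> G \<times> G \<noteq> {}" using G interior_subset[of G] by auto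
  ultimately obtain y where y: "y \<in> G \<times> G \<times> G \<times> G" "\<And>z. z \<in> G \<times> G \<times> G \<times> G \<Longrightarrow> F z \<le> F y"
    using continuous_attains_sup by metis
  obtain p q s t where pqst: "y = (p, q, s, t)" by (cases y)
  have in_G: "p \<in> G" "q \<in> G" "s \<in> G" "t \<in> G" using y(1) pqst by auto
  define D where "D = cross (p - q) (s - t)"
  have max: "cross (p' - q') (s' - t') \<le> D" if "p' \<in> G" "q' \<in> G" "s' \<in> G" "t' \<in> G" for p' q' s' t'
    using y(2)[of "(p', q', s', t')"] that by (simp add: pqst F_def D_def)
  have D: "0 < D"
  proof -
    obtain c e where e: "0 < e" "cball c e \<subseteq> G"
      using G(2) by (metis ex_in_conv mem_interior_cball)
    have "c \<in> G" "c + e *\<^sub>R axis 1 1 \<in> G" "c + e *\<^sub>R axis 2 1 \<in> G"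
      using e by (auto intro!: subsetD[OF e(2)] simp: dist_norm)
    \<comment> \<open>Two perpendicular segments of length \<open>e\<close> from the centre of a
      ball inside \<open>G\<close> have cross product \<open>e * e\<close>, so the maximum is
      positive.\<close>
    from max[OF this(2,1,3,1)] have "e * e \<le> D" by (simp add: cross_simps) (simp add: cross_def axis_def)
    then show ?thesis using e(1) by (meson less_le_trans mult_pos_pos)
  qed
  define v w where "v = p - q" and "w = s - t"
  have vw: "cross v w = D" by (simp add: v_def w_def D_def)
  \<comment> \<open>Replacing one end of a chord by \<open>z\<close> cannot increase the cross
    product. Replacing \<open>p\<close> gives the upper bound for \<open>cross (z - q) w\<close>,
    and replacing \<open>q\<close> gives the lower one; likewise \<open>s\<close> and
    \<open>t\<close> for the other chord.\<close>
  have bd: "0 \<le> cross (z - q) w" "cross (z - q) w \<le> D" "0 \<le> cross v (z - t)" "cross v (z - t) \<le> D" if "z \<in> G" for z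
  proof -
    show "cross (z - q) w \<le> D" "cross v (z - t) \<le> D"
      unfolding v_def w_def using that in_G by (auto intro: max)
    have "cross (p - z) w \<le> D" "cross v (s - z) \<le> D"
      unfolding v_def w_def using that in_G by (auto intro: max)
    moreover have "cross (p - z) w = D - cross (z - q) w" "cross v (s - z) = D - cross v (z - t)"
      unfolding vw[symmetric] by (simp_all add: v_def w_def cross_simps)
    ultimately show "0 \<le> cross (z - q) w" "0 \<le> cross v (z - t)" by simp_all
  qed
  \<comment> \<open>The parameters of the crossing point \<open>m = q + a v = t + b w\<close>. The
    bounds for \<open>t\<close> and \<open>q\<close> in the two pairs of support lines put it on
    both chords.\<close>
  define a where "a = cross (t - q) w / D"
  define b where "b = cross v (q - t) / D"
  have ab: "a \<in> {0..1}" "b \<in> {0..1}" using bd[OF in_G(4)] bd[OF in_G(2)] D by (auto simp: a_def b_def)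
  define m where "m = q + a *\<^sub>R v"
  have m1: "m - a *\<^sub>R v = q" "m + (1 - a) *\<^sub>R v = p" by (simp_all add: m_def v_def algebra_simps)
  have m_t: "m = t + b *\<^sub>R w"
  proof -
    have "q - t = (cross (q - t) w / D) *\<^sub>R v + (cross v (q - t) / D) *\<^sub>R w"
      using cross_decompose[of v w "q - t"] D vw by simp
    moreover have "cross (q - t) w / D = - a" using D by (simp add: a_def cross_simps field_simps)
    ultimately have "q - t = - a *\<^sub>R v + b *\<^sub>R w" by (simp only: b_def)
    then show ?thesis by (simp add: m_def algebra_simps)
  qed
  have m2: "m - b *\<^sub>R w = t" "m + (1 - b) *\<^sub>R w = s" unfolding m_t by (simp_all add: w_def algebra_simps)
  have frac: "(x - k * D) / D \<in> {- k..1 - k}" if "0 \<le> x" "x \<le> D" for x k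
  proof -
    have "(x - k * D) / D = x / D - k" using D by (simp add: diff_divide_distrib)
    moreover have "0 \<le> x / D" "x / D \<le> 1" using that D by simp_all
    ultimately show ?thesis by simp
  qed
  have rep: "\<exists>x\<in>{-a..1 - a}. \<exists>y\<in>{-b..1 - b}. z = m + x *\<^sub>R v + y *\<^sub>R w" if "z \<in> G" for z
  proof -
    have 1: "cross (z - m) w = cross (z - q) w - a * D"
      by (simp add: m_def cross_simps flip: vw)
    have 2: "cross v (z - m) = cross v (z - t) - b * D"
      by (simp add: m_t cross_simps flip: vw)
    have "z - m = (cross (z - m) w / D) *\<^sub>R v + (cross v (z - m) / D) *\<^sub>R w" (is "_ = ?u + ?u'")
      using cross_decompose[of v w "z - m"] D vw by simp
    moreover have "z = m + a + b" if "z - m = a + b" for a b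
      using that unfolding diff_eq_eq by (simp add: ac_simps)
    ultimately have "z = m + ?u + ?u'" by blast
    moreover have "cross (z - m) w / D \<in> {-a..1 - a}" "cross v (z - m) / D \<in> {-b..1 - b}"
      unfolding 1 2 by (rule frac; rule bd[OF that])+
    ultimately show ?thesis by blast
  qed
  \<comment> \<open>A chord divided at \<open>m\<close> in the ratio \<open>a\<close> to
    \<open>1 - a\<close> is measured by its longer part: \<open>c\<close> is that part with its
    sign, and \<open>\<mu>\<close> is the ratio of the shorter to the longer one, hence at most 1.
    The sign turns the longer part into the positive direction.\<close>
  have half: "\<exists>\<mu>\<in>{0..1}. \<exists>c. c \<noteq> 0 \<and> c \<in> {-a, 1 - a} \<and> - \<mu> * c \<in> {-a, 1 - a} \<and>
      (\<forall>x\<in>{-a..1 - a}. \<exists>y\<in>{-\<mu>..1}. x = y * c)" if "a \<in> {0..1}" for a :: real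
  proof (cases "a \<le> 1 / 2")
    case True
    show ?thesis
    proof (rule bexI[of _ "a / (1 - a)"], rule exI[of _ "1 - a"], intro conjI ballI)
      fix x assume "x \<in> {-a..1 - a}"
      then have "- a / (1 - a) \<le> x / (1 - a)" "x / (1 - a) \<le> (1 - a) / (1 - a)"
        using True by (intro divide_right_mono; simp)+
      then show "\<exists>y\<in>{-(a / (1 - a))..1}. x = y * (1 - a)"
        using True by (intro bexI[of _ "x / (1 - a)"]) auto
    qed (use True that in \<open>auto simp: field_simps\<close>)
  next
    case False
    show ?thesis
    proof (rule bexI[of _ "(1 - a) / a"], rule exI[of _ "- a"], intro conjI ballI)
      fix x assume "x \<in> {-a..1 - a}"
      then show "\<exists>y\<in>{-((1 - a) / a)..1}. x = y * - a"
        using False by (intro bexI[of _ "- x / a"]) (auto simp: field_simps)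
    qed (use False that in \<open>auto simp: field_simps\<close>)
  qed
  obtain \<mu> c where \<mu>: "\<mu> \<in> {0..1}" "c \<noteq> 0" "c \<in> {-a, 1 - a}" "- \<mu> * c \<in> {-a, 1 - a}"
    "\<And>x. x \<in> {-a..1 - a} \<Longrightarrow> \<exists>y\<in>{-\<mu>..1}. x = y * c"
    using half[OF ab(1)] by blast
  obtain \<nu> d where \<nu>: "\<nu> \<in> {0..1}" "d \<noteq> 0" "d \<in> {-b, 1 - b}" "- \<nu> * d \<in> {-b, 1 - b}"
    "\<And>x. x \<in> {-b..1 - b} \<Longrightarrow> \<exists>y\<in>{-\<nu>..1}. x = y * d"
    using half[OF ab(2)] by blast
  have va: "m + k *\<^sub>R v \<in> G" if "k \<in> {-a, 1 - a}" for k using that m1 in_G by auto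
  have wb: "m + k *\<^sub>R w \<in> G" if "k \<in> {-b, 1 - b}" for k using that m2 in_G by auto
  have "chord_frame G m (c *\<^sub>R v) (d *\<^sub>R w) \<mu> \<nu>"
    unfolding chord_frame_def
  proof (intro conjI ballI)
    show "cross (c *\<^sub>R v) (d *\<^sub>R w) \<noteq> 0" using \<mu>(2) \<nu>(2) D vw by (simp add: cross_simps)
    show "m + c *\<^sub>R v \<in> G" "m - \<mu> *\<^sub>R c *\<^sub>R v \<in> G" using va[OF \<mu>(3)] va[OF \<mu>(4)] by simp_all
    show "m + d *\<^sub>R w \<in> G" "m - \<nu> *\<^sub>R d *\<^sub>R w \<in> G" using wb[OF \<nu>(3)] wb[OF \<nu>(4)] by simp_all
    fix z assume "z \<in> G"
    then obtain x y where xy: "x \<in> {-a..1 - a}" "y \<in> {-b..1 - b}" "z = m + x *\<^sub>R v + y *\<^sub>R w"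
      using rep by blast
    obtain x' where x': "x' \<in> {-\<mu>..1}" "x = x' * c" using \<mu>(5)[OF xy(1)] by blast
    obtain y' where y': "y' \<in> {-\<nu>..1}" "y = y' * d" using \<nu>(5)[OF xy(2)] by blast
    show "\<exists>x\<in>{-\<mu>..1}. \<exists>y\<in>{-\<nu>..1}. z = m + x *\<^sub>R c *\<^sub>R v + y *\<^sub>R d *\<^sub>R w"
      by (rule bexI[OF _ x'(1)], rule bexI[OF _ y'(1)]) (simp add: xy(3) x'(2) y'(2))
  qed (rule \<mu>(1) \<nu>(1))+
  then show thesis by (rule that)
qed

text \<open>The modulus tests positive steps only. A difference with step 0 vanishes since
  \<open>r\<close> is positive, and one with a negative step is, up to sign, the reversed difference
  based at its other end.\<close>

lemma (in lp_gauge) small_diffsI: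
  assumes G: "G \<in> sets borel" and f: "f \<in> mble" and r: "1 \<le> r"
    and pos: "\<And>t. 0 < t \<Longrightarrow> R {z\<in>G. z + (real r * t) *\<^sub>R v \<in> G} (fin_diff r (t *\<^sub>R v) f) \<le> ennreal \<epsilon>"
  shows "small_diffs r G v f \<epsilon>"
  unfolding small_diffs_def
proof
  fix t :: real
  consider "0 < t" | "t = 0" | "t < 0" by linarith
  then show "R {z\<in>G. z + (real r * t) *\<^sub>R v \<in> G} (fin_diff r (t *\<^sub>R v) f) \<le> ennreal \<epsilon>"
  proof cases
    case 1 then show ?thesis by (rule pos)
  next
    case 2
    obtain n where "r = Suc n" using r by (cases r) auto
    then have "fin_diff r (t *\<^sub>R v) f = (\<lambda>z. 0)" using 2 by (auto simp: fin_diff_eq_mixed_diff)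
    then show ?thesis using R_zero[OF sets_borel_shift[OF G]] by simp
  next
    case 3
    define u where "u = - t"
    have u: "0 < u" using 3 by (simp add: u_def)
    have eq: "fin_diff r (t *\<^sub>R v) f z = (-1) ^ r * fin_diff r (u *\<^sub>R v) f (z + (real r * t) *\<^sub>R v)" for z
      using fin_diff_minus[of r "u *\<^sub>R v" f "z + (real r * t) *\<^sub>R v"] by (simp add: u_def)
    have D: "fin_diff r (u *\<^sub>R v) f \<in> mble" using f by (rule borel_measurable_fin_diff)
    have "R {z\<in>G. z + (real r * t) *\<^sub>R v \<in> G} (fin_diff r (t *\<^sub>R v) f) =
        R {z\<in>G. z + (real r * t) *\<^sub>R v \<in> G} (\<lambda>z. fin_diff r (u *\<^sub>R v) f (z + (real r * t) *\<^sub>R v))"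
      unfolding eq[abs_def] using G borel_measurable_shift[OF D]
      by (subst cmult[OF sets_borel_shift[OF G]]) (auto simp: power_abs)
    also have "\<dots> \<le> R {z\<in>G. z + (real r * u) *\<^sub>R v \<in> G} (fin_diff r (u *\<^sub>R v) f)"
      by (rule shift[OF sets_borel_shift[OF G] sets_borel_shift[OF G] D]) (auto simp: u_def)
    also have "\<dots> \<le> ennreal \<epsilon>" by (rule pos[OF u])
    finally show ?thesis .
  qed
qed

section \<open>Null sets and measurability under translation\<close>

lemma AE_lborel_shift:
  fixes w :: "'a::euclidean_space"
  assumes "AE x in lborel. P x"
  shows "AE x in lborel. P (x + w)"
proof -
  obtain N where N: "{x. \<not> P x} \<subseteq> N" "emeasure lborel N = 0" "N \<in> sets lborel"
    using AE_E[OF assms] by auto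
  have [measurable]: "N \<in> sets borel" using N by simp
  have "(\<integral>\<^sup>+x. indicator N (x + w) \<partial>lborel) = (\<integral>\<^sup>+x. indicator N x \<partial>lborel)"
    by (rule nn_integral_lborel_shift) measurable
  also have "\<dots> = 0" using N by simp
  finally have "AE x in lborel. indicator N (x + w) = (0::ennreal)"
    by (subst (asm) nn_integral_0_iff_AE) auto
  then show ?thesis by eventually_elim (use N(1) in \<open>auto simp: indicator_def split: if_splits\<close>)
qed

lemma lebesgue_measurable_shift:
  fixes f :: "'a::euclidean_space \<Rightarrow> real"
  assumes "f \<in> borel_measurable lebesgue"
  shows "(\<lambda>x. f (x + w)) \<in> borel_measurable lebesgue"
proof -
  have "(\<lambda>x::'a. w + (\<Sum>j\<in>Basis. (1 * (x \<bullet> j)) *\<^sub>R j)) \<in> lebesgue \<rightarrow>\<^sub>M lebesgue"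
    by (rule lebesgue_affine_measurable) auto
  then have "(\<lambda>x. x + w) \<in> lebesgue \<rightarrow>\<^sub>M lebesgue" by (simp add: euclidean_representation add.commute)
  from measurable_compose[OF this assms] show ?thesis .
qed

section \<open>The directional Whitney inequality\<close>

abbreviation directions :: "real ^ 2 \<Rightarrow> real ^ 2 \<Rightarrow> (real ^ 2) set" where
  "directions v w \<equiv> {(1 / norm v) *\<^sub>R v, (1 / norm w) *\<^sub>R w}"

lemma real_polynomial_function_cross:
  "real_polynomial_function (\<lambda>x. cross (x - a) w)" "real_polynomial_function (\<lambda>x. cross v (x - a))"
  unfolding cross_def by (auto intro!: real_polynomial_function_diff real_polynomial_function.intros(4)
      real_polynomial_function.intros(1)[OF bounded_linear_vec_nth] real_polynomial_function.intros(2)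
      simp: vector_minus_component)

text \<open>\<open>X\<close> and \<open>Y\<close> are the coordinates of the frame by Cramer's rule.
  A move along \<open>v\<close> changes \<open>X\<close> affinely and fixes \<open>Y\<close>, and a
  move along \<open>w\<close> does the opposite, so the degree in each variable becomes the degree
  along a direction.\<close>

lemma coord_poly_dir_poly:
  fixes a v w :: "real ^ 2"
  assumes vw: "cross v w \<noteq> 0" and r: "1 \<le> r"
  defines "X \<equiv> \<lambda>x. cross (x - a) w / cross v w" and "Y \<equiv> \<lambda>x. cross v (x - a) / cross v w"
  shows "(\<lambda>x. coord_poly r c (X x, Y x)) \<in> dir_poly r (directions v w)"
proof -
  have XY: "real_polynomial_function X" "real_polynomial_function Y"
    unfolding X_def Y_def by (intro real_polynomial_function_divide real_polynomial_function_cross)+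
  have "real_polynomial_function (\<lambda>x. coord_poly r c (X x, Y x))"
    unfolding coord_poly_def fst_conv snd_conv
    by (intro real_polynomial_function_sum real_polynomial_function.intros(4) real_polynomial_function.intros(2)
        real_polynomial_function_power XY finite_lessThan)
  moreover have "\<exists>q. (q = 0 \<or> degree q < r) \<and>
      (\<forall>t. coord_poly r c (X (x + t *\<^sub>R e), Y (x + t *\<^sub>R e)) = poly q t)"
    if "e \<in> directions v w" for x e
    using that
  proof (elim insertE emptyE)
    assume e: "e = (1 / norm v) *\<^sub>R v"
    define q where "q = (\<Sum>i<r. smult (\<Sum>j<r. c i j * Y x ^ j) ([:X x, 1 / norm v:] ^ i))"
    have eqs: "X (x + t *\<^sub>R e) = X x + t / norm v" "Y (x + t *\<^sub>R e) = Y x" for t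
      using vw by (simp_all add: X_def Y_def e cross_simps field_simps)
    have "degree q < r"
      unfolding q_def
    proof (rule degree_sum_less)
      fix i assume "i \<in> {..<r}"
      have "degree ([:X x, 1 / norm v:] ^ i) \<le> degree [:X x, 1 / norm v:] * i" by (rule degree_power_le)
      also have "\<dots> \<le> 1 * i" by (intro mult_right_mono) auto
      finally show "degree (smult (\<Sum>j<r. c i j * Y x ^ j) ([:X x, 1 / norm v:] ^ i)) < r"
        using \<open>i \<in> {..<r}\<close> by (intro le_less_trans[OF degree_smult_le]) auto
    qed (use r in auto)
    moreover have "coord_poly r c (X (x + t *\<^sub>R e), Y (x + t *\<^sub>R e)) = poly q t" for t
      unfolding coord_poly_def eqs q_def
      by (simp add: poly_sum poly_power sum_distrib_left sum_distrib_right mult_ac)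
    ultimately show ?thesis by blast
  next
    assume e: "e = (1 / norm w) *\<^sub>R w"
    define q where "q = (\<Sum>j<r. smult (\<Sum>i<r. c i j * X x ^ i) ([:Y x, 1 / norm w:] ^ j))"
    have eqs: "X (x + t *\<^sub>R e) = X x" "Y (x + t *\<^sub>R e) = Y x + t / norm w" for t
      using vw by (simp_all add: X_def Y_def e cross_simps field_simps)
    have "degree q < r"
      unfolding q_def
    proof (rule degree_sum_less)
      fix j assume "j \<in> {..<r}"
      have "degree ([:Y x, 1 / norm w:] ^ j) \<le> degree [:Y x, 1 / norm w:] * j" by (rule degree_power_le)
      also have "\<dots> \<le> 1 * j" by (intro mult_right_mono) auto
      finally show "degree (smult (\<Sum>i<r. c i j * X x ^ i) ([:Y x, 1 / norm w:] ^ j)) < r"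
        using \<open>j \<in> {..<r}\<close> by (intro le_less_trans[OF degree_smult_le]) auto
    qed (use r in auto)
    moreover have "coord_poly r c (X (x + t *\<^sub>R e), Y (x + t *\<^sub>R e)) = poly q t" for t
    proof -
      have "coord_poly r c (X (x + t *\<^sub>R e), Y (x + t *\<^sub>R e)) =
          (\<Sum>j<r. \<Sum>i<r. c i j * X x ^ i * (Y x + t / norm w) ^ j)"
        unfolding coord_poly_def eqs fst_conv snd_conv by (rule sum.swap)
      then show ?thesis
        by (simp add: q_def poly_sum poly_power sum_distrib_left sum_distrib_right mult_ac)
    qed
    ultimately show ?thesis by blast
  qed
  ultimately show ?thesis unfolding dir_poly_def by blast
qed

lemma closed_segment_subset_iff:
  assumes "convex G"
  shows "{x\<in>G. closed_segment x (x + w) \<subseteq> G} = {x\<in>G. x + w \<in> G}"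
  using assms closed_segment_subset[of _ G] by fastforce

text \<open>Allows \<open>f\<close> to be replaced by a Borel function. By convexity all nodes lie
  in \<open>G\<close>, so the unknown values of \<open>f\<close> outside do not matter and
  \<open>f\<close> may be extended by 0. The exceptional set is contained in countably many
  translates of a null set.\<close>

lemma Lp_norm_fin_diff_cong:
  fixes G :: "(real ^ 2) set"
  assumes G: "compact G" "convex G" and f: "f \<in> borel_measurable (lebesgue_on G)"
    and g[measurable]: "g \<in> borel_measurable borel" and fg: "AE x in lborel. x \<in> G \<longrightarrow> f x = g x"
  shows "Lp_norm p {x\<in>G. x + real r *\<^sub>R b \<in> G} (fin_diff r b f) = Lp_norm p {x\<in>G. x + real r *\<^sub>R b \<in> G} (fin_diff r b g)"
proof -
  let ?S = "{x\<in>G. x + real r *\<^sub>R b \<in> G}"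
  have [measurable]: "G \<in> sets borel" using G by (simp add: borel_compact)
  have S: "?S \<in> sets borel" by (rule sets_borel_shift) simp
  define f0 where "f0 = (\<lambda>x. if x \<in> G then f x else 0)"
  have f0: "f0 \<in> borel_measurable lebesgue" unfolding f0_def by (rule borel_measurable_if_I[OF f]) simp
  have inG: "x + real j *\<^sub>R b \<in> G" if "x \<in> ?S" "j \<le> r" for x j
  proof (cases "r = 0")
    case False
    have "(1 - real j / real r) *\<^sub>R x + (real j / real r) *\<^sub>R (x + real r *\<^sub>R b) \<in> G"
      by (rule convexD_alt[OF G(2)]) (use that False in auto)
    then show ?thesis using False by (simp add: algebra_simps)
  qed (use that in auto)
  have eq: "fin_diff r b f x = fin_diff r b f0 x" if "x \<in> ?S" for x
    unfolding fin_diff_def f0_def using inG[OF that] by (intro sum.cong) auto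
  have "fin_diff r b f0 \<in> borel_measurable lebesgue"
    unfolding fin_diff_def[abs_def]
    by (intro borel_measurable_sum borel_measurable_times borel_measurable_const lebesgue_measurable_shift f0)
  then have "fin_diff r b f0 \<in> borel_measurable (lebesgue_on ?S)" by (rule measurable_restrict_space1)
  then have m: "fin_diff r b f \<in> borel_measurable (lebesgue_on ?S)"
    by (rule measurable_cong[THEN iffD1, rotated]) (simp add: eq)
  have "AE x in lborel. \<forall>j. x + real j *\<^sub>R b \<in> G \<longrightarrow> f (x + real j *\<^sub>R b) = g (x + real j *\<^sub>R b)"
    unfolding AE_all_countable by (intro allI AE_lborel_shift[OF fg])
  then have ae: "AE x in lborel. x \<in> ?S \<longrightarrow> fin_diff r b f x = fin_diff r b g x"
  proof eventually_elim
    case (elim x)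
    then show ?case unfolding fin_diff_def using inG[of x] by (auto intro!: sum.cong)
  qed
  show ?thesis
  proof (rule Lp_norm_cong_AE)
    show "?S \<in> sets lebesgue" using S by simp
    show "fin_diff r b g \<in> borel_measurable (lebesgue_on ?S)"
      by (intro measurable_restrict_space1 measurable_completion) simp
  qed (use m ae in \<open>auto simp: AE_completion_iff\<close>)
qed

lemma whitney_chord_frame:
  assumes p: "0 < p" and r: "1 \<le> r"
  shows "\<exists>C>0. \<forall>G m v w \<mu> \<nu> f. convex_body G \<longrightarrow> chord_frame G m v w \<mu> \<nu> \<longrightarrow> f \<in> Lp_space p G \<longrightarrow>
    best_approx r (directions v w) p G f \<le>
      ennreal C * dir_modulus r (directions v w) p G f"
proof -
  obtain R s where gauge: "lp_gauge R s" and transfer: "\<And>a v w. cross v w \<noteq> 0 \<Longrightarrow> \<exists>\<kappa>>0. \<forall>S g c.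
    S \<in> sets borel \<longrightarrow> g \<in> borel_measurable borel \<longrightarrow> 0 \<le> c \<longrightarrow>
    (Lp_norm p S g \<le> ennreal c \<longleftrightarrow> R (frame a v w -` S) (\<lambda>z. g (frame a v w z)) \<le> ennreal (c powr s / \<kappa>))"
    using Lp_norm_gauge[OF p] by blast
  interpret lp_gauge R s by (rule gauge)
  define A where "A = 1 + 4 * (real r)\<^sup>2"
  have A: "0 < A" by (simp add: A_def add_pos_nonneg)
  obtain C0 where C0: "0 \<le> C0" and body: "\<And>f \<epsilon> G m n. f \<in> mble \<Longrightarrow> 0 \<le> \<epsilon> \<Longrightarrow> G \<in> sets borel \<Longrightarrow> convex G \<Longrightarrow>
     m \<in> {0..4 * A} \<Longrightarrow> n \<in> {0..4 * A} \<Longrightarrow>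
     (-A, 3 * A) \<in> G \<Longrightarrow> (3 * A, -A) \<in> G \<Longrightarrow> (-A - m, -A) \<in> G \<Longrightarrow> (-A, -A - n) \<in> G \<Longrightarrow>
     G \<subseteq> {-A - m..3 * A} \<times> {-A - n..3 * A} \<Longrightarrow> R G f < \<infinity> \<Longrightarrow>
     small_diffs r G (1, 0) f \<epsilon> \<Longrightarrow> small_diffs r G (0, 1) f \<epsilon> \<Longrightarrow>
     (\<exists>c. R G (\<lambda>z. f z - coord_poly r c z) \<le> ennreal (C0 * \<epsilon>))"
    using body_approximation[OF r] unfolding A_def by blast
  \<comment> \<open>Undoes the exponent \<open>s\<close> that separates gauges from norms. The
    maximum with 1 makes \<open>C\<close> positive, as the case of an infinite modulus
    requires.\<close>
  define C where "C = max 1 C0 powr (1 / s)"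
  have Cs: "C0 \<le> C powr s" using s_pos by (simp add: C_def powr_powr)
  have C: "0 < C" by (simp add: C_def)
  show ?thesis
  proof (intro exI[of _ C] conjI allI impI C)
    fix G :: "(real ^ 2) set" and m v w \<mu> \<nu> f
    assume cb: "convex_body G" and fr: "chord_frame G m v w \<mu> \<nu>" and f: "f \<in> Lp_space p G"
    then have vw: "cross v w \<noteq> 0" and \<mu>: "\<mu> \<in> {0..1}" and \<nu>: "\<nu> \<in> {0..1}"
      and pts: "m + v \<in> G" "m - \<mu> *\<^sub>R v \<in> G" "m + w \<in> G" "m - \<nu> *\<^sub>R w \<in> G"
      and rep: "\<forall>z\<in>G. \<exists>x\<in>{-\<mu>..1}. \<exists>y\<in>{-\<nu>..1}. z = m + x *\<^sub>R v + y *\<^sub>R w"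
      unfolding chord_frame_def by blast+
    have G: "compact G" "convex G" using cb by (auto simp: convex_body_def)
    have Gm[measurable]: "G \<in> sets borel" using G by (simp add: borel_compact)
    have fm: "f \<in> borel_measurable (lebesgue_on G)" and ffin: "Lp_norm p G f < \<infinity>"
      using f by (auto simp: Lp_space_def)
    show "best_approx r (directions v w) p G f \<le> ennreal C * dir_modulus r (directions v w) p G f"
    proof (cases "dir_modulus r (directions v w) p G f" rule: ennreal_cases)
      case top
      then show ?thesis using C by (simp add: ennreal_mult_top)
    next
      case (real \<omega>)
      have "(\<lambda>x. if x \<in> G then f x else 0) \<in> borel_measurable lebesgue"
        by (rule borel_measurable_if_I[OF fm]) simp
      from completion_ex_borel_measurable_real[OF this] obtain g where "g \<in> borel_measurable lborel"
        and *: "AE x in lborel. (if x \<in> G then f x else 0) = g x" by blast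
      then have g[measurable]: "g \<in> borel_measurable borel" by simp
      from * have fg: "AE x in lborel. x \<in> G \<longrightarrow> f x = g x" by (auto elim: eventually_mono)
      \<comment> \<open>The frame that puts the crossing point \<open>m\<close> at
        \<open>(-A, -A)\<close> and the ends \<open>m + v\<close> and \<open>m + w\<close> at
        \<open>(3 * A, -A)\<close> and \<open>(-A, 3 * A)\<close>, the position assumed in
        \<open>body_approximation\<close>.\<close>
      define v' w' a where "v' = (1 / (4 * A)) *\<^sub>R v" and "w' = (1 / (4 * A)) *\<^sub>R w"
        and "a = m + (1 / 4) *\<^sub>R v + (1 / 4) *\<^sub>R w"
      define T where "T = frame a v' w'"
      have v'w': "cross v' w' \<noteq> 0" using vw A by (simp add: v'_def w'_def cross_simps)
      have Tm[measurable]: "T \<in> borel \<rightarrow>\<^sub>M borel" unfolding T_def by (rule borel_measurable_frame)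
      have T: "T (x, y) = m + ((x + A) / (4 * A)) *\<^sub>R v + ((y + A) / (4 * A)) *\<^sub>R w" for x y
        using A by (simp add: T_def frame_def a_def v'_def w'_def add_divide_distrib scaleR_add_left)
      define G' where "G' = T -` G"
      have pre: "T -` S \<in> sets borel" if [measurable]: "S \<in> sets borel" for S
      proof -
        have "T -` S \<inter> space borel \<in> sets borel" by measurable
        then show ?thesis by simp
      qed
      have G'm: "G' \<in> sets borel" unfolding G'_def by (rule pre) simp
      have "convex G'"
      proof (rule convexI)
        fix x y and k l :: real assume *: "x \<in> G'" "y \<in> G'" "0 \<le> k" "0 \<le> l" "k + l = 1"
        have "T (k *\<^sub>R x + l *\<^sub>R y) = (k + l) *\<^sub>R a - a + k *\<^sub>R T x + l *\<^sub>R T y - ((k + l) *\<^sub>R a - a)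
            + (a - (k + l) *\<^sub>R a)"
          by (simp add: T_def frame_def algebra_simps)
        then have "T (k *\<^sub>R x + l *\<^sub>R y) = k *\<^sub>R T x + l *\<^sub>R T y" using *(5) by simp
        then show "k *\<^sub>R x + l *\<^sub>R y \<in> G'"
          using * convexD[OF G(2), of "T x" "T y" k l] by (simp add: G'_def)
      qed
      have in_G': "(-A, 3 * A) \<in> G'" "(3 * A, -A) \<in> G'" "(-A - 4 * A * \<mu>, -A) \<in> G'" "(-A, -A - 4 * A * \<nu>) \<in> G'"
        using pts A by (simp_all add: G'_def T)
      have "G' \<subseteq> {-A - 4 * A * \<mu>..3 * A} \<times> {-A - 4 * A * \<nu>..3 * A}"
      proof
        fix z assume "z \<in> G'"
        obtain x y where z: "z = (x, y)" by (cases z)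
        obtain k l where kl: "k \<in> {-\<mu>..1}" "l \<in> {-\<nu>..1}" "T z = m + k *\<^sub>R v + l *\<^sub>R w"
          using rep \<open>z \<in> G'\<close> unfolding G'_def by blast
        have "((x + A) / (4 * A)) *\<^sub>R v + ((y + A) / (4 * A)) *\<^sub>R w = k *\<^sub>R v + l *\<^sub>R w"
          using kl(3) by (simp add: z T add.assoc)
        then have "cross (((x + A) / (4 * A)) *\<^sub>R v + ((y + A) / (4 * A)) *\<^sub>R w) w = cross (k *\<^sub>R v + l *\<^sub>R w) w"
          "cross v (((x + A) / (4 * A)) *\<^sub>R v + ((y + A) / (4 * A)) *\<^sub>R w) = cross v (k *\<^sub>R v + l *\<^sub>R w)"
          by simp_all
        then have "((x + A) / (4 * A)) * cross v w = k * cross v w" "((y + A) / (4 * A)) * cross v w = l * cross v w"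
          by (simp_all add: cross_simps)
        then have "(x + A) / (4 * A) = k" "(y + A) / (4 * A) = l" using vw by (simp_all only: mult_cancel_right simp_thms)
        then have "x + A = 4 * A * k" "y + A = 4 * A * l" using A by (auto simp: field_simps)
        moreover have "4 * A * - \<mu> \<le> 4 * A * k" "4 * A * k \<le> 4 * A * 1" "4 * A * - \<nu> \<le> 4 * A * l" "4 * A * l \<le> 4 * A * 1"
          using kl A by (intro mult_left_mono; simp)+
        ultimately show "z \<in> {-A - 4 * A * \<mu>..3 * A} \<times> {-A - 4 * A * \<nu>..3 * A}" using z by auto
      qed
      note sub = this
      obtain \<kappa> where \<kappa>: "0 < \<kappa>" and tr: "\<And>S g c. S \<in> sets borel \<Longrightarrow> g \<in> borel_measurable borel \<Longrightarrow> 0 \<le> c \<Longrightarrow>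
        Lp_norm p S g \<le> ennreal c \<longleftrightarrow> R (T -` S) (\<lambda>z. g (T z)) \<le> ennreal (c powr s / \<kappa>)"
        using transfer[OF v'w', of a] unfolding T_def by blast
      define f' where "f' z = g (T z)" for z
      have f'm: "f' \<in> mble" unfolding f'_def by measurable
      define \<epsilon> where "\<epsilon> = \<omega> powr s / \<kappa>"
      have \<epsilon>: "0 \<le> \<epsilon>" using \<kappa> by (simp add: \<epsilon>_def)
      have gm: "g \<in> borel_measurable (lebesgue_on G)"
        by (intro measurable_restrict_space1 measurable_completion) simp
      have fin: "R G' f' < \<infinity>"
      proof -
        have "Lp_norm p G g = Lp_norm p G f"
          by (rule Lp_norm_cong_AE[OF _ gm fm]) (use fg in \<open>auto simp: AE_completion_iff elim: eventually_mono\<close>)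
        then obtain c where "0 \<le> c" "Lp_norm p G g = ennreal c" using ffin by (cases "Lp_norm p G f") auto
        then have "R G' f' \<le> ennreal (c powr s / \<kappa>)" using tr[OF Gm g, of c] unfolding G'_def f'_def by simp
        then show ?thesis by (rule le_less_trans) simp
      qed
      have sd: "small_diffs r G' e f' \<epsilon>"
        if b0: "b \<noteq> 0" and bE: "(1 / norm b) *\<^sub>R b \<in> directions v w" and Tb: "\<And>z t. T (z + t *\<^sub>R e) = T z + t *\<^sub>R b" for e b
      proof (rule small_diffsI[OF G'm f'm r])
        fix t :: real assume t: "0 < t"
        define S where "S = {x\<in>G. x + real r *\<^sub>R (t *\<^sub>R b) \<in> G}"
        have Sm: "S \<in> sets borel" unfolding S_def by (rule sets_borel_shift) simp
        have set_eq: "{z\<in>G'. z + (real r * t) *\<^sub>R e \<in> G'} = T -` S"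
          by (auto simp: G'_def S_def Tb)
        have diff_eq: "fin_diff r (t *\<^sub>R e) f' = (\<lambda>z. fin_diff r (t *\<^sub>R b) g (T z))"
          unfolding f'_def by (intro ext fin_diff_comp) (simp add: Tb)
        have Dm: "fin_diff r (t *\<^sub>R b) g \<in> borel_measurable borel" by (rule borel_measurable_fin_diff) simp
        show "R {z\<in>G'. z + (real r * t) *\<^sub>R e \<in> G'} (fin_diff r (t *\<^sub>R e) f') \<le> ennreal \<epsilon>"
        proof (cases "S = {}")
          case True
          have "R {} (fin_diff r (t *\<^sub>R e) f') \<le> R {} (\<lambda>z. 0)"
            by (rule mono) (use f'm borel_measurable_fin_diff in auto)
          then show ?thesis unfolding set_eq True using R_zero[of "{}"] by simp
        next
          case False
          then obtain x where x: "x \<in> G" "x + real r *\<^sub>R (t *\<^sub>R b) \<in> G" by (auto simp: S_def)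
          \<comment> \<open>The step length along a unit vector, as in the modulus. Two points of
            \<open>G\<close> at distance \<open>r * u\<close> give
            \<open>u \<le> diameter G\<close>, so every step with a nonempty domain is tested by the
            modulus.\<close>
          define u where "u = t * norm b"
          have u0: "0 < u" using t b0 by (simp add: u_def)
          have "dist (x + real r *\<^sub>R (t *\<^sub>R b)) x \<le> diameter G"
            by (rule diameter_bounded_bound) (use G x in \<open>auto intro: compact_imp_bounded\<close>)
          then have "real r * u \<le> diameter G" using t by (simp add: dist_norm u_def mult.assoc)
          moreover have "1 * u \<le> real r * u" using r u0 by (intro mult_right_mono) auto
          ultimately have "u \<le> diameter G" by linarith
          then have u: "u \<in> {0<..diameter G}" using u0 by simp
          have ub: "u *\<^sub>R ((1 / norm b) *\<^sub>R b) = t *\<^sub>R b" using b0 by (simp add: u_def)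
          have S_eq: "{\<xi>\<in>G. closed_segment \<xi> (\<xi> + (real r * u) *\<^sub>R ((1 / norm b) *\<^sub>R b)) \<subseteq> G} = S"
            unfolding closed_segment_subset_iff[OF G(2)] S_def scaleR_scaleR[symmetric] ub ..
          have "Lp_norm p S (fin_diff r (t *\<^sub>R b) g) = Lp_norm p S (fin_diff r (t *\<^sub>R b) f)"
            unfolding S_def by (rule Lp_norm_fin_diff_cong[OF G fm g fg, symmetric])
          also have "\<dots> \<le> dir_modulus r (directions v w) p G f"
            unfolding dir_modulus_def
            by (rule SUP_upper2[OF bE], rule SUP_upper2[OF u]) (simp only: S_eq ub order_refl)
          also have "\<dots> = ennreal \<omega>" by (rule real)
          finally have "R (T -` S) (\<lambda>z. fin_diff r (t *\<^sub>R b) g (T z)) \<le> ennreal (\<omega> powr s / \<kappa>)"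
            using tr[OF Sm Dm, of \<omega>] real by simp
          then show ?thesis unfolding set_eq diff_eq \<epsilon>_def .
        qed
      qed
      have vw0: "v \<noteq> 0" "w \<noteq> 0" using vw by (auto simp: cross_def)
      have sd1: "small_diffs r G' (1, 0) f' \<epsilon>"
        by (rule sd[of v']) (use vw0 A in \<open>auto simp: v'_def T_def frame_add\<close>)
      have sd2: "small_diffs r G' (0, 1) f' \<epsilon>"
        by (rule sd[of w']) (use vw0 A in \<open>auto simp: w'_def T_def frame_add\<close>)
      have "4 * A * \<mu> \<in> {0..4 * A}" "4 * A * \<nu> \<in> {0..4 * A}" using \<mu> \<nu> A by auto
      from body[OF f'm \<epsilon> G'm \<open>convex G'\<close> this in_G' sub fin sd1 sd2]
      obtain c where c: "R G' (\<lambda>z. f' z - coord_poly r c z) \<le> ennreal (C0 * \<epsilon>)" by blast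
      define X where "X x = cross (x - a) w' / cross v' w'" for x
      define Y where "Y x = cross v' (x - a) / cross v' w'" for x
      define q where "q x = coord_poly r c (X x, Y x)" for x
      have "(1 / norm v') *\<^sub>R v' = (1 / norm v) *\<^sub>R v" "(1 / norm w') *\<^sub>R w' = (1 / norm w) *\<^sub>R w"
        using A by (simp_all add: v'_def w'_def)
      then have q_dir: "q \<in> dir_poly r (directions v w)"
        using coord_poly_dir_poly[OF v'w' r, where a = a and c = c] unfolding q_def X_def Y_def by simp
      have "real_polynomial_function q" using q_dir by (simp add: dir_poly_def)
      then have qm[measurable]: "q \<in> borel_measurable borel"
        by (intro borel_measurable_continuous_onI continuous_on_polymonial_function) (simp add: real_polynomial_function_eq)
      have qT: "q (T z) = coord_poly r c z" for z
      proof -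
        have "X (T z) = fst z" "Y (T z) = snd z"
          using v'w' by (simp_all add: X_def Y_def T_def frame_def cross_simps)
        then show ?thesis by (simp add: q_def)
      qed
      have "R (T -` G) (\<lambda>z. g (T z) - q (T z)) \<le> ennreal (C0 * \<epsilon>)"
        using c by (simp add: qT G'_def f'_def)
      \<comment> \<open>Both \<open>\<epsilon>\<close> and the bound wanted contain the factor
        \<open>1 / \<kappa>\<close>, so the frame drops out of the constant.\<close>
      also have "\<dots> \<le> ennreal ((C * \<omega>) powr s / \<kappa>)"
        using Cs C real \<kappa> by (intro ennreal_leI) (simp add: \<epsilon>_def powr_mult divide_right_mono mult_right_mono)
      finally have le: "Lp_norm p G (\<lambda>x. g x - q x) \<le> ennreal (C * \<omega>)"
        using tr[OF Gm, of "\<lambda>x. g x - q x" "C * \<omega>"] C real by simp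
      have "best_approx r (directions v w) p G f \<le> Lp_norm p G (\<lambda>x. f x - q x)"
        unfolding best_approx_def by (rule INF_lower[OF q_dir])
      also have "\<dots> = Lp_norm p G (\<lambda>x. g x - q x)"
      proof (rule Lp_norm_cong_AE)
        have "q \<in> borel_measurable (lebesgue_on G)"
          by (intro measurable_restrict_space1 measurable_completion) simp
        then show "(\<lambda>x. f x - q x) \<in> borel_measurable (lebesgue_on G)" "(\<lambda>x. g x - q x) \<in> borel_measurable (lebesgue_on G)"
          using fm gm by simp_all
        show "AE x in lebesgue. x \<in> G \<longrightarrow> f x - q x = g x - q x"
          unfolding AE_completion_iff using fg by (auto elim: eventually_mono)
      qed simp
      also have "\<dots> \<le> ennreal C * dir_modulus r (directions v w) p G f"
        using le C real by (simp add: ennreal_mult)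
      finally show ?thesis .
    qed
  qed
qed

theorem theorem5p12:
  shows "\<exists>C :: ennreal \<Rightarrow> nat \<Rightarrow> real. \<forall>G :: (real^2) set. convex_body G \<longrightarrow>
    (\<exists>\<xi>1 \<xi>2. \<xi>1 \<in> sphere 0 1 \<and> \<xi>2 \<in> sphere 0 1 \<and> \<xi>1 \<noteq> \<xi>2 \<and> independent {\<xi>1, \<xi>2} \<and>
      (\<forall>r p f. 1 \<le> r \<longrightarrow> 0 < p \<longrightarrow> f \<in> Lp_space p G \<longrightarrow>
        best_approx r {\<xi>1, \<xi>2} p G f \<le> ennreal (C p r) * dir_modulus r {\<xi>1, \<xi>2} p G f))"
proof -
  define good where "good C p r \<longleftrightarrow> (\<forall>G m v w \<mu> \<nu> f. convex_body G \<longrightarrow> chord_frame G m v w \<mu> \<nu> \<longrightarrow> f \<in> Lp_space p G \<longrightarrow>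
    best_approx r (directions v w) p G f \<le>
      ennreal C * dir_modulus r (directions v w) p G f)" for C p r
  \<comment> \<open>The constant is chosen here for \<open>p\<close> and \<open>r\<close>, before
    any body is given; \<open>good\<close> quantifies over all bodies and frames at once.\<close>
  have "\<exists>C. 0 < p \<longrightarrow> 1 \<le> r \<longrightarrow> good C p r" for p r
    using whitney_chord_frame[of p r] unfolding good_def by blast
  then have "\<exists>C. \<forall>p r. 0 < p \<longrightarrow> 1 \<le> r \<longrightarrow> good (C p r) p r" by metis
  then obtain C where C: "\<And>p r. 0 < p \<Longrightarrow> 1 \<le> r \<Longrightarrow> good (C p r) p r" by blast
  show ?thesis
  proof (intro exI[of _ C] allI impI)
    fix G :: "(real ^ 2) set" assume G: "convex_body G"
    from convex_body_chord_frame[OF G] obtain m v w \<mu> \<nu> where fr: "chord_frame G m v w \<mu> \<nu>" .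
    then have vw: "cross v w \<noteq> 0" by (simp add: chord_frame_def)
    define \<xi>1 \<xi>2 where "\<xi>1 = (1 / norm v) *\<^sub>R v" and "\<xi>2 = (1 / norm w) *\<^sub>R w"
    have vw0: "v \<noteq> 0" "w \<noteq> 0" using vw by (auto simp: cross_def)
    have cr: "cross \<xi>1 \<xi>2 \<noteq> 0" using vw vw0 by (simp add: \<xi>1_def \<xi>2_def cross_simps)
    have "\<xi>1 \<noteq> \<xi>2" using cr by (auto simp: cross_simps)
    moreover have "independent {\<xi>1, \<xi>2}"
    proof -
      have "\<xi>1 \<notin> span {\<xi>2}" using cr by (auto simp: span_singleton cross_simps)
      moreover have "independent {\<xi>2}" using vw0 by (simp add: \<xi>2_def)
      ultimately show ?thesis by (simp add: independent_insertI)
    qed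
    moreover have "\<xi>1 \<in> sphere 0 1" "\<xi>2 \<in> sphere 0 1" using vw0 by (simp_all add: \<xi>1_def \<xi>2_def)
    moreover have "\<forall>r p f. 1 \<le> r \<longrightarrow> 0 < p \<longrightarrow> f \<in> Lp_space p G \<longrightarrow>
        best_approx r {\<xi>1, \<xi>2} p G f \<le> ennreal (C p r) * dir_modulus r {\<xi>1, \<xi>2} p G f"
      using C G fr unfolding good_def \<xi>1_def \<xi>2_def by blast
    ultimately show "\<exists>\<xi>1 \<xi>2. \<xi>1 \<in> sphere 0 1 \<and> \<xi>2 \<in> sphere 0 1 \<and> \<xi>1 \<noteq> \<xi>2 \<and> independent {\<xi>1, \<xi>2} \<and>
      (\<forall>r p f. 1 \<le> r \<longrightarrow> 0 < p \<longrightarrow> f \<in> Lp_space p G \<longrightarrow>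
        best_approx r {\<xi>1, \<xi>2} p G f \<le> ennreal (C p r) * dir_modulus r {\<xi>1, \<xi>2} p G f)"
      by blast
  qed
qed

end
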